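(* Let $b\in L^q(\Omega)$ for some $q>1$ with $b>0$ a.e. in $\Omega$, and let $$1<\delta<\frac{q(2\phi_+-1)-\phi_+}{q(\phi_+-1)}=:\delta_q.$$ Then the problem $$-\Delta_\Phi u=b(x)u^{-\delta}\ \text{in }\Omega,\qquad u>0\ \text{in }\Omega,\qquad u=0\ \text{on }\partial\Omega$$ admits a (unique) weak solution in $W_0^{1,\Phi}(\Omega)$.
   Context: $\Omega\subset\mathbb{R}^N$ is a bounded domain with smooth boundary. Assumptions on $\Phi$: $a\in C^1((0,\infty),(0,\infty))$; $\phi(t)=a(|t|)t$ for $t\ne0$, $\phi(0)=0$, is an increasing odd homeomorphism of $\mathbb{R}$ onto $\mathbb{R}$; $\Phi(t)=\int_0^{|t|}\phi(s)\,ds$; $0<a_-:=\inf_{t>0}\frac{t\phi'(t)}{\phi(t)}\le a_+:=\sup_{t>0}\frac{t\phi'(t)}{\phi(t)}<\infty$; $\phi_-:=a_-+1$, $\phi_+:=a_++1$. Also $\int_0^1\Phi^{-1}(s)s^{-1-1/N}ds<\infty$, $\int_1^\infty\Phi^{-1}(s)s^{-1-1/N}ds=\infty$; $\Phi_*$ is the N-function with $\Phi_*^{-1}(t)=\int_0^t\Phi^{-1}(s)s^{-1-1/N}ds$ for $t>0$, written $\Phi_*(t)=\int_0^{|t|}\phi_*(s)ds$; and $\phi_+<\phi_-^*:=\inf_{t>0}\frac{t\phi_*(t)}{\Phi_*(t)}$. $L^\Phi(\Omega)$ is the Orlicz space with Luxemburg norm $\|\cdot\|_\Phi$; $W^{1,\Phi}(\Omega)$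 is the set of $u\in L^\Phi(\Omega)$ with $u_{x_i}\in L^\Phi(\Omega)$, with norm $\|u\|_\Phi+\|\nabla u\|_\Phi$; $W_0^{1,\Phi}(\Omega)$ is the closure of $C_0^\infty(\Omega)$ in it. $\Delta_\Phi u=\mathrm{div}(a(|\nabla u|)\nabla u)$. A weak solution of the problem is $u\in W_0^{1,\Phi}(\Omega)$ with $u>0$ a.e. in $\Omega$, $bu^{-\delta}\varphi\in L^1(\Omega)$ and $\int_\Omega a(|\nabla u|)\nabla u\nabla\varphi\,dx=\int_\Omega bu^{-\delta}\varphi\,dx$ for all $\varphi\in W_0^{1,\Phi}(\Omega)$. *)

theory Defs
  imports "HOL-Analysis.Analysis"
begin

section \<open>Smooth functions, test functions, smooth domains\<close>

text \<open>\<open>Ck_on\<close> is meant for open sets in finite-dimensional spaces.\<close>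

primrec Ck_on ::
  "nat \<Rightarrow> 'a::euclidean_space set \<Rightarrow> ('a \<Rightarrow> 'b::real_normed_vector) \<Rightarrow> bool" where
  "Ck_on 0 S f \<longleftrightarrow> continuous_on S f"
| "Ck_on (Suc k) S f \<longleftrightarrow>
     f differentiable_on S \<and> (\<forall>v. Ck_on k S (\<lambda>x. frechet_derivative f (at x) v))"

definition smooth_on ::
  "'a::euclidean_space set \<Rightarrow> ('a \<Rightarrow> 'b::real_normed_vector) \<Rightarrow> bool" where
  "smooth_on S f \<longleftrightarrow> (\<forall>k. Ck_on k S f)"

definition test_functions :: "(real^'n) set \<Rightarrow> (real^'n \<Rightarrow> real) set" where
  "test_functions \<Omega> =
     {\<psi>. smooth_on UNIV \<psi> \<and> compact (closure {x. \<psi> x \<noteq> 0}) \<and> closure {x. \<psi> x \<noteq> 0} \<subseteq> \<Omega>}"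

text \<open>Near each of its boundary points, the set is mapped by a smooth diffeomorphism onto a
  piece of an open half-space, its boundary going to the bounding hyperplane.\<close>

definition smooth_boundary :: "(real^'n) set \<Rightarrow> bool" where
  "smooth_boundary \<Omega> \<longleftrightarrow>
     (\<forall>p\<in>frontier \<Omega>. \<exists>U V \<psi> \<eta> k.
        open U \<and> p \<in> U \<and> open V \<and> homeomorphism U V \<psi> \<eta> \<and>
        smooth_on U (\<psi> :: real^'n \<Rightarrow> real^'n) \<and> smooth_on V \<eta> \<and>
        (\<forall>x\<in>U. (x \<in> \<Omega> \<longleftrightarrow> \<psi> x $ k > 0) \<and> (x \<in> frontier \<Omega> \<longleftrightarrow> \<psi> x $ k = 0)))"

definition smooth_bounded_domain :: "(real^'n) set \<Rightarrow> bool" where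
  "smooth_bounded_domain \<Omega> \<longleftrightarrow>
     open \<Omega> \<and> connected \<Omega> \<and> \<Omega> \<noteq> {} \<and> bounded \<Omega> \<and> smooth_boundary \<Omega>"


section \<open>N-functions\<close>

definition even_primitive :: "(real \<Rightarrow> real) \<Rightarrow> real \<Rightarrow> real" where
  "even_primitive m t = (LBINT s:{0..\<bar>t\<bar>}. m s)"

text \<open>\<open>m\<close> is the (right-continuous) density of the N-function \<open>even_primitive m\<close>.\<close>

definition N_density :: "(real \<Rightarrow> real) \<Rightarrow> bool" where
  "N_density m \<longleftrightarrow>
     m 0 = 0 \<and> (\<forall>t>0. m t > 0) \<and> mono_on {0..} m \<and>
     (\<forall>t\<ge>0. continuous (at_right t) m) \<and> filterlim m at_top at_top"

definition phi :: "(real \<Rightarrow> real) \<Rightarrow> real \<Rightarrow> real" where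
  "phi a t = (if t = 0 then 0 else a \<bar>t\<bar> * t)"

abbreviation Phi :: "(real \<Rightarrow> real) \<Rightarrow> real \<Rightarrow> real" where
  "Phi a \<equiv> even_primitive (phi a)"

definition Phi_inv :: "(real \<Rightarrow> real) \<Rightarrow> real \<Rightarrow> real" where
  "Phi_inv a = inv_into {0..} (Phi a)"

text \<open>The real-valued infimum and supremum below are the intended ones only for bounded sets.
  For increasing \<open>phi a\<close> the quotients are nonnegative, so the infimum is unproblematic;
  finiteness of the supremum is the separate condition \<open>phi_quotient_bounded\<close>.\<close>

definition phi_quotient :: "(real \<Rightarrow> real) \<Rightarrow> real \<Rightarrow> real" where
  "phi_quotient a t = t * deriv (phi a) t / phi a t"

definition phi_quotient_bounded :: "(real \<Rightarrow> real) \<Rightarrow> bool" where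
  "phi_quotient_bounded a \<longleftrightarrow> bdd_above (phi_quotient a ` {0<..})"

definition a_minus :: "(real \<Rightarrow> real) \<Rightarrow> real" where
  "a_minus a = (INF t\<in>{0<..}. phi_quotient a t)"

definition a_plus :: "(real \<Rightarrow> real) \<Rightarrow> real" where
  "a_plus a = (SUP t\<in>{0<..}. phi_quotient a t)"

definition phi_plus :: "(real \<Rightarrow> real) \<Rightarrow> real" where
  "phi_plus a = a_plus a + 1"

definition admissible :: "(real \<Rightarrow> real) \<Rightarrow> bool" where
  "admissible a \<longleftrightarrow>
     a C1_differentiable_on {0<..} \<and> (\<forall>t>0. a t > 0) \<and>
     strict_mono (phi a) \<and> (\<forall>t. phi a (- t) = - phi a t) \<and>
     (\<exists>\<psi>. homeomorphism UNIV UNIV (phi a) \<psi>) \<and>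
     0 < a_minus a \<and> a_minus a \<le> a_plus a \<and> phi_quotient_bounded a"

definition sobolev_integrand :: "nat \<Rightarrow> (real \<Rightarrow> real) \<Rightarrow> real \<Rightarrow> real" where
  "sobolev_integrand N a s = Phi_inv a s * s powr (- 1 - 1 / real N)"

text \<open>\<open>phis\<close> is the density of the Sobolev conjugate N-function of \<open>Phi a\<close> in dimension \<open>N\<close>.
  On \<open>{0<..}\<close> it is uniquely determined, being right-continuous.\<close>

definition sobolev_conjugate_density :: "nat \<Rightarrow> (real \<Rightarrow> real) \<Rightarrow> (real \<Rightarrow> real) \<Rightarrow> bool" where
  "sobolev_conjugate_density N a phis \<longleftrightarrow>
     N_density phis \<and>
     (\<forall>t>0. inv_into {0..} (even_primitive phis) t = (LBINT s:{0<..t}. sobolev_integrand N a s))"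

definition phi_star_minus :: "(real \<Rightarrow> real) \<Rightarrow> real" where
  "phi_star_minus phis = (INF t\<in>{0<..}. t * phis t / even_primitive phis t)"


section \<open>Orlicz and Orlicz-Sobolev spaces\<close>

text \<open>Elements of the function spaces are represented by functions on the whole of \<open>real^'n\<close>;
  only their values on \<open>\<Omega>\<close>, up to null sets, matter.\<close>

definition orlicz :: "(real \<Rightarrow> real) \<Rightarrow> (real^'n) set \<Rightarrow> (real^'n \<Rightarrow> real) set" where
  "orlicz F \<Omega> =
     {u \<in> borel_measurable (lebesgue_on \<Omega>).
        \<exists>l>0. (\<integral>\<^sup>+x. ennreal (F (u x / l)) \<partial>lebesgue_on \<Omega>) < \<infinity>}"

definition luxemburg_norm :: "(real \<Rightarrow> real) \<Rightarrow> (real^'n) set \<Rightarrow> (real^'n \<Rightarrow> real) \<Rightarrow> real" where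
  "luxemburg_norm F \<Omega> u =
     Inf {l. l > 0 \<and> (\<integral>\<^sup>+x. ennreal (F (u x / l)) \<partial>lebesgue_on \<Omega>) \<le> 1}"

definition locally_integrable :: "(real^'n) set \<Rightarrow> (real^'n \<Rightarrow> real) \<Rightarrow> bool" where
  "locally_integrable \<Omega> u \<longleftrightarrow> (\<forall>K. compact K \<and> K \<subseteq> \<Omega> \<longrightarrow> integrable (lebesgue_on K) u)"

definition is_weak_gradient ::
  "(real^'n) set \<Rightarrow> (real^'n \<Rightarrow> real) \<Rightarrow> (real^'n \<Rightarrow> real^'n) \<Rightarrow> bool" where
  "is_weak_gradient \<Omega> u g \<longleftrightarrow>
     locally_integrable \<Omega> u \<and>
     (\<forall>i. locally_integrable \<Omega> (\<lambda>x. g x $ i) \<and>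
       (\<forall>\<psi>\<in>test_functions \<Omega>.
          (\<integral>x. u x * frechet_derivative \<psi> (at x) (axis i 1) \<partial>lebesgue_on \<Omega>)
          = - (\<integral>x. g x $ i * \<psi> x \<partial>lebesgue_on \<Omega>)))"

text \<open>A weak gradient is unique up to null sets, which makes the choice below harmless.\<close>

definition weak_gradient :: "(real^'n) set \<Rightarrow> (real^'n \<Rightarrow> real) \<Rightarrow> real^'n \<Rightarrow> real^'n" where
  "weak_gradient \<Omega> u = (SOME g. is_weak_gradient \<Omega> u g)"

definition orlicz_sobolev :: "(real \<Rightarrow> real) \<Rightarrow> (real^'n) set \<Rightarrow> (real^'n \<Rightarrow> real) set" where
  "orlicz_sobolev F \<Omega> =
     {u \<in> orlicz F \<Omega>. (\<exists>g. is_weak_gradient \<Omega> u g) \<and>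
        (\<forall>i. (\<lambda>x. weak_gradient \<Omega> u x $ i) \<in> orlicz F \<Omega>)}"

definition orlicz_sobolev_norm ::
  "(real \<Rightarrow> real) \<Rightarrow> (real^'n) set \<Rightarrow> (real^'n \<Rightarrow> real) \<Rightarrow> real" where
  "orlicz_sobolev_norm F \<Omega> u =
     luxemburg_norm F \<Omega> u + luxemburg_norm F \<Omega> (\<lambda>x. norm (weak_gradient \<Omega> u x))"

definition orlicz_sobolev0 :: "(real \<Rightarrow> real) \<Rightarrow> (real^'n) set \<Rightarrow> (real^'n \<Rightarrow> real) set" where
  "orlicz_sobolev0 F \<Omega> =
     {u \<in> orlicz_sobolev F \<Omega>.
        \<forall>\<epsilon>>0. \<exists>\<psi>\<in>test_functions \<Omega>. orlicz_sobolev_norm F \<Omega> (\<lambda>x. u x - \<psi> x) < \<epsilon>}"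

definition in_Lp :: "real \<Rightarrow> (real^'n) set \<Rightarrow> (real^'n \<Rightarrow> real) \<Rightarrow> bool" where
  "in_Lp p \<Omega> f \<longleftrightarrow>
     f \<in> borel_measurable (lebesgue_on \<Omega>) \<and> integrable (lebesgue_on \<Omega>) (\<lambda>x. \<bar>f x\<bar> powr p)"


section \<open>The singular problem\<close>

text \<open>The value \<open>a 0\<close> is irrelevant, since it is multiplied by the zero vector. For admissible
  \<open>a\<close> the integrand on the left-hand side is integrable by Hoelder's inequality.\<close>

definition weak_solution ::
  "(real \<Rightarrow> real) \<Rightarrow> (real^'n) set \<Rightarrow> (real^'n \<Rightarrow> real) \<Rightarrow> real \<Rightarrow> (real^'n \<Rightarrow> real) \<Rightarrow> bool" where
  "weak_solution a \<Omega> b \<delta> u \<longleftrightarrow>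
     u \<in> orlicz_sobolev0 (Phi a) \<Omega> \<and> (AE x in lebesgue_on \<Omega>. u x > 0) \<and>
     (\<forall>\<phi>\<in>orlicz_sobolev0 (Phi a) \<Omega>.
        integrable (lebesgue_on \<Omega>) (\<lambda>x. b x * u x powr (- \<delta>) * \<phi> x) \<and>
        (\<integral>x. (a (norm (weak_gradient \<Omega> u x)) *\<^sub>R weak_gradient \<Omega> u x) \<bullet> weak_gradient \<Omega> \<phi> x
           \<partial>lebesgue_on \<Omega>)
        = (\<integral>x. b x * u x powr (- \<delta>) * \<phi> x \<partial>lebesgue_on \<Omega>))"

end

theory Submission
  imports Defs "HOL-Real_Asymp.Real_Asymp"
begin

text \<open>
  The solution is the minimiser of
  \<open>J u = \<integral> \<Phi> \<bar>\<nabla>u\<bar> + 1 / (\<delta> - 1) * \<integral> b u powr (1 - \<delta>)\<close> over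
  \<open>W\<^sub>0\<^sup>1\<^sup>,\<^sup>\<Phi>\<close>; the second term is infinite unless \<open>u > 0\<close>, and it is convex there.
  The lower bound \<open>a_minus a > 0\<close> makes \<open>\<Phi>\<close> uniformly convex, so the gradients of a minimising
  sequence are Cauchy in the modular; this replaces weak compactness, and Fatou's lemma handles the
  singular term. Comparing \<open>u\<close> with \<open>u + t \<phi>\<close> for \<open>\<phi> \<ge> 0\<close> and with \<open>(1 - t) u\<close>, and
  then testing with the positive part of \<open>u + \<epsilon> \<phi>\<close>, gives the weak equation. The bound on
  \<open>\<delta>\<close> says exactly that some power \<open>\<theta> < 1\<close> of the distance to the boundary has both finite
  gradient modular, \<open>(1 - \<theta>) \<phi>\<^sub>+ < 1\<close>, and finite singular energy,
  \<open>\<theta> (\<delta> - 1) q / (q - 1) < 1\<close>, so \<open>J\<close> is not identically infinite. Uniqueness follows by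
  testing the difference of the two equations with \<open>u - v\<close>, as \<open>s \<mapsto> s powr (- \<delta>)\<close> is strictly
  decreasing.
\<close>

section \<open>Calculus of smooth functions\<close>

text \<open>The constraint \<open>u > 0\<close> is the obstacle: for a general direction
  \<open>f\<close> there may be no \<open>t > 0\<close> with \<open>u + t * f\<close> positive, so
  only one-sided variations are available. They give an inequality for \<open>f \<ge> 0\<close>, and
  shrinking \<open>u\<close> gives the opposite one along \<open>u\<close> itself. In the test with
  the positive part of \<open>u + \<epsilon> * f\<close> the terms with \<open>u\<close> alone then
  cancel, and the cut-off set shrinks to a null set because \<open>u > 0\<close>. Convergence is
  measured by the modular; the growth bound \<open>\<Phi> (l * t) \<le> l powr p * \<Phi> t\<close>
  for \<open>l \<ge> 1\<close> ties it to the norm. Functions are carried as pairs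
  \<open>W0 u g\<close>, since \<open>weak_gradient\<close> is fixed only up to null sets. The trial
  function is modelled on \<open>s powr \<theta>\<close> with a local defining function
  \<open>s\<close> of the domain. A strip of width \<open>r\<close> along the boundary has measure
  \<open>O(r)\<close>, so \<open>s powr (- \<alpha>)\<close> is integrable for
  \<open>0 < \<alpha> < 1\<close>: this is why two exponents have to stay below 1. The factor
  \<open>q / (q - 1)\<close> in the second comes from separating \<open>b\<close>, whose
  \<open>q\<close>-th power is integrable, from the power of \<open>s\<close>.\<close>

lemma frechet_derivative_has:
  "(f has_derivative D) (at x) \<Longrightarrow> frechet_derivative f (at x) = D"
  using frechet_derivative_at by metis

text \<open>On an open set the derivative at a point depends only on nearby values, so the recursion
  passes from equal functions to equal derivatives.\<close>

lemma Ck_on_cong: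
  assumes "open S" "\<And>x. x \<in> S \<Longrightarrow> f x = g x"
  shows "Ck_on k S f \<longleftrightarrow> Ck_on k S g"
  using assms(2)
proof (induction k arbitrary: f g)
  case 0
  then show ?case by (simp cong: continuous_on_cong)
next
  case (Suc k)
  have d: "(f has_derivative D) (at x) \<longleftrightarrow> (g has_derivative D) (at x)" if "x \<in> S" for x D
    using that Suc.prems has_derivative_transform_within_open[OF _ assms(1) that]
    by metis
  then have "frechet_derivative f (at x) = frechet_derivative g (at x)" if "x \<in> S" for x
    unfolding frechet_derivative_def using that by simp
  then have "Ck_on k S (\<lambda>x. frechet_derivative f (at x) v) \<longleftrightarrow> Ck_on k S (\<lambda>x. frechet_derivative g (at x) v)" for v
    by (intro Suc.IH) simp
  moreover have "f differentiable_on S \<longleftrightarrow> g differentiable_on S"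
    using d by (simp add: differentiable_on_eq_differentiable_at[OF assms(1)] differentiable_def)
  ultimately show ?case by simp
qed

text \<open>Allows the derivative to be given by an explicit \<open>D\<close> instead of the choice
  term \<open>frechet_derivative\<close>; most closure properties below rest on this.\<close>

lemma Ck_on_Suc_intro:
  assumes "open S" "\<And>x. x \<in> S \<Longrightarrow> (f has_derivative D x) (at x)"
    "\<And>v. Ck_on k S (\<lambda>x. D x v)"
  shows "Ck_on (Suc k) S f"
proof -
  have "Ck_on k S (\<lambda>x. frechet_derivative f (at x) v)" for v
    by (subst Ck_on_cong[OF assms(1), where g = "\<lambda>x. D x v"])
      (use assms frechet_derivative_has[OF assms(2)] in simp_all)
  then show ?thesis
    using assms(1,2) by (auto simp: differentiable_on_eq_differentiable_at differentiable_def)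
qed

lemma Ck_on_has_derivative:
  assumes "open S" "Ck_on (Suc k) S f" "x \<in> S"
  shows "(f has_derivative frechet_derivative f (at x)) (at x)"
  using assms by (auto simp: differentiable_on_eq_differentiable_at frechet_derivative_works)

lemma Ck_on_SucD: "Ck_on (Suc k) S f \<Longrightarrow> Ck_on k S f"
  by (induction k arbitrary: f) (auto intro: differentiable_imp_continuous_on)

lemma Ck_on_subset: "Ck_on k S f \<Longrightarrow> T \<subseteq> S \<Longrightarrow> Ck_on k T f"
  by (induction k arbitrary: f) (auto intro: continuous_on_subset differentiable_on_subset)

lemma Ck_on_Un:
  assumes "open S" "open T"
  shows "Ck_on k S f \<Longrightarrow> Ck_on k T f \<Longrightarrow> Ck_on k (S \<union> T) f"
  by (induction k arbitrary: f)
    (use assms in \<open>auto intro: continuous_on_open_Un simp: differentiable_on_eq_differentiable_at open_Un\<close>)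

lemma Ck_on_const: "open S \<Longrightarrow> Ck_on k S (\<lambda>x. c)"
proof (induction k arbitrary: c)
  case (Suc k)
  show ?case
    by (rule Ck_on_Suc_intro[where D = "\<lambda>x v. 0"]) (use Suc in auto)
qed simp

lemma Ck_on_linear:
  assumes "open S" "bounded_linear L"
  shows "Ck_on k S L"
proof (cases k)
  case 0
  then show ?thesis
    using assms by (simp add: linear_continuous_on)
next
  case (Suc m)
  show ?thesis
    unfolding Suc
    by (rule Ck_on_Suc_intro[where D = "\<lambda>x v. L v"])
      (use assms in \<open>auto intro: bounded_linear_imp_has_derivative Ck_on_const\<close>)
qed

lemma Ck_on_compose_linear:
  assumes "open S" "bounded_linear L"
  shows "Ck_on k S f \<Longrightarrow> Ck_on k S (\<lambda>x. L (f x))"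
proof (induction k arbitrary: f)
  case 0
  then show ?case
    using assms by (simp add: bounded_linear.continuous_on)
next
  case (Suc k)
  show ?case
    by (rule Ck_on_Suc_intro[where D = "\<lambda>x v. L (frechet_derivative f (at x) v)"])
      (use assms Suc Ck_on_has_derivative[OF assms(1) Suc.prems] in
        \<open>auto intro: bounded_linear.has_derivative\<close>)
qed

lemma Ck_on_add:
  assumes "open S"
  shows "Ck_on k S f \<Longrightarrow> Ck_on k S g \<Longrightarrow> Ck_on k S (\<lambda>x. f x + g x)"
proof (induction k arbitrary: f g)
  case 0
  then show ?case by (simp add: continuous_on_add)
next
  case (Suc k)
  show ?case
    by (rule Ck_on_Suc_intro
        [where D = "\<lambda>x v. frechet_derivative f (at x) v + frechet_derivative g (at x) v"])
      (use assms Suc Ck_on_has_derivative[OF assms Suc.prems(1)]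
        Ck_on_has_derivative[OF assms Suc.prems(2)] in \<open>auto intro: has_derivative_add\<close>)
qed

lemma Ck_on_mult:
  fixes f g :: "'a::euclidean_space \<Rightarrow> real"
  assumes "open S"
  shows "Ck_on k S f \<Longrightarrow> Ck_on k S g \<Longrightarrow> Ck_on k S (\<lambda>x. f x * g x)"
proof (induction k arbitrary: f g)
  case 0
  then show ?case by (simp add: continuous_on_mult)
next
  case (Suc k)
  show ?case
  proof (rule Ck_on_Suc_intro
      [where D = "\<lambda>x v. f x * frechet_derivative g (at x) v + frechet_derivative f (at x) v * g x"])
    fix v
    show "Ck_on k S (\<lambda>x. f x * frechet_derivative g (at x) v + frechet_derivative f (at x) v * g x)"
      by (intro Ck_on_add[OF assms] Suc.IH) (use Suc.prems Ck_on_SucD in auto)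
  qed (use assms Ck_on_has_derivative[OF assms Suc.prems(1)]
        Ck_on_has_derivative[OF assms Suc.prems(2)] in \<open>auto intro: has_derivative_mult\<close>)
qed

lemma Ck_on_prod:
  fixes f :: "'i \<Rightarrow> 'a::euclidean_space \<Rightarrow> real"
  assumes "open S" "finite I" "\<And>i. i \<in> I \<Longrightarrow> Ck_on k S (f i)"
  shows "Ck_on k S (\<lambda>x. \<Prod>i\<in>I. f i x)"
  using assms(2,3) by (induction I rule: finite_induct) (auto intro: Ck_on_mult Ck_on_const assms(1))

lemma has_derivative_compose_real:
  fixes h :: "real \<Rightarrow> real"
  assumes "(h has_real_derivative d) (at (f x))" "(f has_derivative D) (at x)"
  shows "((\<lambda>x. h (f x)) has_derivative (\<lambda>v. d * D v)) (at x)"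
  using has_derivative_compose[OF assms(2) assms(1)[unfolded has_field_derivative_def]] by simp

text \<open>Only \<open>h\<close> is generalised: the chain rule turns the derivative into a product
  whose outer factor is again a function composed with the same \<open>f\<close>.\<close>

lemma Ck_on_compose:
  fixes h :: "real \<Rightarrow> real" and f :: "'a::euclidean_space \<Rightarrow> real"
  assumes "open S" "open T" "f ` S \<subseteq> T"
  shows "Ck_on k T h \<Longrightarrow> Ck_on k S f \<Longrightarrow> Ck_on k S (\<lambda>x. h (f x))"
proof (induction k arbitrary: h)
  case 0
  then show ?case
    using continuous_on_compose2[of T h S f] assms(3) by simp
next
  case (Suc k)
  let ?h' = "\<lambda>t. frechet_derivative h (at t) 1"
  have h': "(h has_real_derivative ?h' t) (at t)" if "t \<in> T" for t
  proof -
    have d: "(h has_derivative frechet_derivative h (at t)) (at t)"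
      using that by (rule Ck_on_has_derivative[OF assms(2) Suc.prems(1)])
    have "frechet_derivative h (at t) v = ?h' t * v" for v
      using linear_scale[OF has_derivative_linear[OF d], of v 1] by (simp add: mult.commute)
    then have "frechet_derivative h (at t) = (*) (?h' t)"
      by (rule ext)
    then show ?thesis
      using d by (simp add: has_field_derivative_def)
  qed
  show ?case
  proof (rule Ck_on_Suc_intro[where D = "\<lambda>x v. ?h' (f x) * frechet_derivative f (at x) v"])
    fix v
    show "Ck_on k S (\<lambda>x. ?h' (f x) * frechet_derivative f (at x) v)"
      by (rule Ck_on_mult[OF assms(1) Suc.IH])
        (use Suc.prems Ck_on_SucD[OF Suc.prems(2)] in simp_all)
    show "((\<lambda>x. h (f x)) has_derivative (\<lambda>v. ?h' (f x) * frechet_derivative f (at x) v)) (at x)"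
      if "x \<in> S" for x
      using that assms(3) h' Ck_on_has_derivative[OF assms(1) Suc.prems(2)]
      by (intro has_derivative_compose_real) auto
  qed (rule assms(1))
qed

lemma Ck_on_Suc_real:
  fixes f f' :: "real \<Rightarrow> real"
  assumes "open S" "\<And>x. x \<in> S \<Longrightarrow> (f has_real_derivative f' x) (at x)" "Ck_on k S f'"
  shows "Ck_on (Suc k) S f"
  by (rule Ck_on_Suc_intro[where D = "\<lambda>x v. f' x * v"])
    (use assms in \<open>auto intro: Ck_on_mult Ck_on_const simp: has_field_derivative_def\<close>)

lemma Ck_on_powr: "Ck_on k {0<..} (\<lambda>s::real. s powr p)"
proof (induction k arbitrary: p)
  case 0
  then show ?case by (auto intro!: continuous_intros)
next
  case (Suc k)
  show ?case
    by (rule Ck_on_Suc_real[where f' = "\<lambda>s. p * s powr (p - 1)"])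
      (auto intro!: Ck_on_mult Ck_on_const Suc has_real_derivative_powr)
qed

text \<open>The functions \<open>exp (- 1 / t) / t ^ m\<close>, extended by zero to \<open>t \<le> 0\<close>, are closed under
  differentiation, which makes them smooth at the origin.\<close>

definition flat :: "nat \<Rightarrow> real \<Rightarrow> real" where
  "flat m t = (if t > 0 then exp (- 1 / t) / t ^ m else 0)"

lemma flat_tendsto_0: "(flat m \<longlongrightarrow> 0) (at 0)"
proof -
  have "((\<lambda>t::real. inverse t ^ m / exp (inverse t)) \<longlongrightarrow> 0) (at_right 0)"
    by (rule filterlim_compose[OF tendsto_power_div_exp_0 filterlim_inverse_at_top_right])
  then have "(flat m \<longlongrightarrow> 0) (at_right 0)"
    by (rule Lim_transform_eventually)
      (auto simp: flat_def eventually_at_right_less field_simps exp_minus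
        intro!: eventually_at_rightI[of 0 1])
  moreover have "(flat m \<longlongrightarrow> 0) (at_left 0)"
    by (rule Lim_transform_eventually[OF tendsto_const])
      (auto simp: flat_def intro!: eventually_at_leftI[of "-1" 0])
  ultimately show ?thesis
    by (simp add: filterlim_at_split)
qed

lemma flat_has_derivative:
  "(flat m has_real_derivative (flat (m + 2) t - real m * flat (m + 1) t)) (at t)"
proof -
  consider "t > 0" | "t < 0" | "t = 0" by linarith
  then show ?thesis
  proof cases
    case 1
    have "((\<lambda>t. exp (- 1 / t) / t ^ m) has_real_derivative
        (exp (- 1 / t) * (1 / t^2) * t ^ m - exp (- 1 / t) * (real m * t ^ (m - 1))) / (t ^ m * t ^ m)) (at t)"
      using 1 by (auto intro!: derivative_eq_intros simp: power2_eq_square)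
    also have "(exp (- 1 / t) * (1 / t^2) * t ^ m - exp (- 1 / t) * (real m * t ^ (m - 1))) / (t ^ m * t ^ m)
      = flat (m + 2) t - real m * flat (m + 1) t"
      using 1 by (cases m) (auto simp: flat_def field_simps power2_eq_square)
    finally show ?thesis
      by (rule has_field_derivative_transform_within_open[where S = "{0<..}"])
        (use 1 in \<open>auto simp: flat_def\<close>)
  next
    case 2
    have "((\<lambda>t. 0) has_real_derivative (flat (m + 2) t - real m * flat (m + 1) t)) (at t)"
      using 2 by (auto simp: flat_def)
    then show ?thesis
      by (rule has_field_derivative_transform_within_open[where S = "{..<0}"])
        (use 2 in \<open>auto simp: flat_def\<close>)
  next
    case 3
    \<comment> \<open>At the origin the difference quotient of \<open>flat m\<close> is
      \<open>flat (m + 1)\<close> itself, whose limit 0 is the claimed derivative there.\<close>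
    have "flat m h / h = flat (m + 1) h" for h
      by (auto simp: flat_def)
    then show ?thesis
      using 3 flat_tendsto_0[of "m + 1"] by (simp add: has_field_derivative_iff flat_def[of _ 0])
  qed
qed

lemma Ck_on_flat: "Ck_on k UNIV (flat m)"
proof (induction k arbitrary: m)
  case 0
  then show ?case
    using flat_has_derivative by (auto intro!: DERIV_continuous_on)
next
  case (Suc k)
  have "Ck_on k UNIV (\<lambda>t. flat (m + 2) t + (- real m) * flat (m + 1) t)"
    by (intro Ck_on_add Ck_on_mult Ck_on_const Suc) auto
  then show ?case
    using flat_has_derivative by (intro Ck_on_Suc_real) auto
qed

lemma flat0_bounds: "0 \<le> flat 0 t" "flat 0 t \<le> 1" "flat 0 t = 0 \<longleftrightarrow> t \<le> 0"
  by (auto simp: flat_def)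

text \<open>The shift \<open>c\<close> serves two kinds of cutoff: 0 where the cutoff may start at
  the edge of the positive set, 1 where it has to vanish on a whole neighbourhood of that
  edge.\<close>

lemma flat0_scaled_tendsto:
  assumes "t > 0"
  shows "(\<lambda>n. flat 0 (real n * t - c)) \<longlonglongrightarrow> 1"
proof -
  have "filterlim (\<lambda>n. real n * t - c) at_top sequentially"
    using assms by real_asymp
  moreover have "(flat 0 \<longlongrightarrow> 1) at_top"
  proof (rule Lim_transform_eventually)
    show "((\<lambda>t::real. exp (- 1 / t)) \<longlongrightarrow> 1) at_top" by real_asymp
  qed (auto simp: flat_def eventually_at_top_dense)
  ultimately show ?thesis
    by (rule filterlim_compose[rotated])
qed

subsection \<open>Test functions\<close>

text \<open>Collects the partial derivatives against which \<open>is_weak_gradient\<close>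
  integrates, so that the inner product with \<open>grad \<psi> x\<close> is the derivative of a
  differentiable \<open>\<psi>\<close>.\<close>

definition grad :: "(real^'n \<Rightarrow> real) \<Rightarrow> real^'n \<Rightarrow> real^'n" where
  "grad \<psi> x = (\<chi> i. frechet_derivative \<psi> (at x) (axis i 1))"

lemma grad_has_derivative:
  assumes "(\<psi> has_derivative D) (at x)"
  shows "grad \<psi> x \<bullet> v = D v"
proof -
  have l: "linear D"
    using assms has_derivative_linear by blast
  have "D v = D (\<Sum>i\<in>UNIV. (v $ i) *\<^sub>R axis i 1)"
    using basis_expansion[of v] by (simp add: scalar_mult_eq_scaleR)
  also have "\<dots> = (\<Sum>i\<in>UNIV. v $ i * D (axis i 1))"
    using l by (simp add: linear_sum linear_scale)
  finally show ?thesis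
    using assms by (simp add: grad_def frechet_derivative_has inner_vec_def mult.commute)
qed

lemma grad_unique:
  assumes "(\<psi> has_derivative (\<lambda>v. w \<bullet> v)) (at x)"
  shows "grad \<psi> x = w"
  using grad_has_derivative[OF assms] vector_eq_rdot[of "grad \<psi> x" w] by simp

text \<open>Weaker than a test function on purpose: integration by parts must also cover
  \<open>\<Phi> (\<psi> x)\<close> and its product with a coordinate, for which only one continuous
  derivative is at hand. The set \<open>K\<close> merely contains the support.\<close>

definition C1_compact :: "(real^'n) set \<Rightarrow> (real^'n \<Rightarrow> real) \<Rightarrow> bool" where
  "C1_compact K f \<longleftrightarrow> compact K \<and> (\<forall>x. x \<notin> K \<longrightarrow> f x = 0) \<and>
     (\<forall>x. (f has_derivative (\<lambda>v. grad f x \<bullet> v)) (at x)) \<and> continuous_on UNIV (grad f)"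

lemma C1_compactI:
  assumes "compact K" "\<And>x. x \<notin> K \<Longrightarrow> f x = 0"
    "\<And>x. (f has_derivative (\<lambda>v. g x \<bullet> v)) (at x)" "continuous_on UNIV g"
  shows "C1_compact K f" "grad f = g"
proof -
  show "grad f = g"
    using grad_unique[OF assms(3)] by auto
  then show "C1_compact K f"
    using assms by (simp add: C1_compact_def)
qed

lemma C1_compact_continuous: "C1_compact K f \<Longrightarrow> continuous_on UNIV f"
  by (auto simp: C1_compact_def intro: has_derivative_continuous_on)

lemma C1_compact_grad_outside:
  assumes "C1_compact K f" "x \<notin> K"
  shows "grad f x = 0"
proof -
  have "open (- K)" "\<And>y. y \<in> - K \<Longrightarrow> f y = 0"
    using assms by (auto simp: C1_compact_def compact_imp_closed)
  then have "(f has_derivative (\<lambda>v. 0)) (at x)"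
    using assms(2) has_derivative_transform_within_open[of "\<lambda>_. 0" "\<lambda>v. 0" x UNIV "- K" f] by auto
  then show ?thesis
    by (intro grad_unique) simp
qed

lemma continuous_compact_support_bounded:
  fixes f :: "'a::euclidean_space \<Rightarrow> 'b::real_normed_vector"
  assumes "continuous_on UNIV f" "compact K" "\<And>x. x \<notin> K \<Longrightarrow> f x = 0"
  obtains B where "B > 0" "\<And>x. norm (f x) \<le> B"
proof -
  have "bounded (f ` K)"
    using assms compact_continuous_image compact_imp_bounded continuous_on_subset by (metis subset_UNIV)
  then obtain B where "B > 0" "\<And>x. x \<in> K \<Longrightarrow> norm (f x) \<le> B"
    by (metis bounded_pos imageI)
  then show ?thesis
    using that[of B] assms(3) by (metis less_eq_real_def norm_zero)
qed

lemma test_functionI: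
  assumes "\<And>k. Ck_on k UNIV \<psi>" "compact K" "K \<subseteq> \<Omega>" "\<And>x. x \<notin> K \<Longrightarrow> \<psi> x = 0"
  shows "\<psi> \<in> test_functions \<Omega>"
proof -
  have "closure {x. \<psi> x \<noteq> 0} \<subseteq> K"
    using assms by (intro closure_minimal) (auto simp: compact_imp_closed)
  then show ?thesis
    using assms by (auto simp: test_functions_def smooth_on_def compact_eq_bounded_closed intro: bounded_subset)
qed

lemma test_function_C1:
  assumes "\<psi> \<in> test_functions \<Omega>"
  obtains K where "C1_compact K \<psi>" "K \<subseteq> \<Omega>"
proof
  let ?K = "closure {x. \<psi> x \<noteq> 0}"
  have C: "Ck_on (Suc k) UNIV \<psi>" for k
    using assms by (auto simp: test_functions_def smooth_on_def simp del: Ck_on.simps)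
  have d: "(\<psi> has_derivative (\<lambda>v. grad \<psi> x \<bullet> v)) (at x)" for x
    using Ck_on_has_derivative[OF open_UNIV C] grad_has_derivative by (metis (lifting) UNIV_I ext)
  have "continuous_on UNIV (\<lambda>x. grad \<psi> x)"
    unfolding grad_def
    using C[of 0] by (intro continuous_on_vec_lambda) simp
  then show "C1_compact ?K \<psi>"
    using d assms closure_subset[of "{x. \<psi> x \<noteq> 0}"]
    by (auto simp: C1_compact_def test_functions_def)
  show "?K \<subseteq> \<Omega>"
    using assms by (simp add: test_functions_def)
qed

lemma not_in_support: "x \<notin> closure {x. f x \<noteq> 0} \<Longrightarrow> f x = 0"
  using closure_subset[of "{x. f x \<noteq> 0}"] by auto

lemma test_function_zero: "(\<lambda>x. 0) \<in> test_functions \<Omega>"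
  by (rule test_functionI[of _ "{}"]) (auto intro: Ck_on_const)

lemma test_function_add:
  assumes "\<psi> \<in> test_functions \<Omega>" "\<eta> \<in> test_functions \<Omega>"
  shows "(\<lambda>x. \<psi> x + \<eta> x) \<in> test_functions \<Omega>"
proof (rule test_functionI)
  show "compact (closure {x. \<psi> x \<noteq> 0} \<union> closure {x. \<eta> x \<noteq> 0})"
    "closure {x. \<psi> x \<noteq> 0} \<union> closure {x. \<eta> x \<noteq> 0} \<subseteq> \<Omega>"
    using assms by (auto simp: test_functions_def)
  show "\<psi> x + \<eta> x = 0" if "x \<notin> closure {x. \<psi> x \<noteq> 0} \<union> closure {x. \<eta> x \<noteq> 0}" for x
    using that not_in_support[of x \<psi>] not_in_support[of x \<eta>] by simp
qed (use assms in \<open>auto intro!: Ck_on_add simp: test_functions_def smooth_on_def\<close>)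

lemma test_function_compose:
  assumes "\<psi> \<in> test_functions \<Omega>" "\<And>k. Ck_on k UNIV h" "h 0 = (0::real)"
  shows "(\<lambda>x. h (\<psi> x)) \<in> test_functions \<Omega>"
proof (rule test_functionI)
  show "compact (closure {x. \<psi> x \<noteq> 0})" "closure {x. \<psi> x \<noteq> 0} \<subseteq> \<Omega>"
    using assms by (auto simp: test_functions_def)
  show "h (\<psi> x) = 0" if "x \<notin> closure {x. \<psi> x \<noteq> 0}" for x
    using not_in_support[OF that] assms(3) by simp
  show "Ck_on k UNIV (\<lambda>x. h (\<psi> x))" for k
    by (rule Ck_on_compose[where T = UNIV and h = h and f = \<psi>])
      (use assms in \<open>auto simp: test_functions_def smooth_on_def\<close>)
qed

lemma grad_compose:
  assumes "C1_compact K \<psi>" "(h has_real_derivative d) (at (\<psi> x))"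
  shows "grad (\<lambda>x. h (\<psi> x)) x = d *\<^sub>R grad \<psi> x"
proof (rule grad_unique)
  have "(\<psi> has_derivative (\<lambda>v. grad \<psi> x \<bullet> v)) (at x)"
    using assms(1) by (simp add: C1_compact_def)
  from has_derivative_compose_real[where f = \<psi> and h = h, OF assms(2) this]
  show "((\<lambda>x. h (\<psi> x)) has_derivative (\<lambda>v. (d *\<^sub>R grad \<psi> x) \<bullet> v)) (at x)"
    by simp
qed

lemma grad_add:
  assumes "C1_compact K \<psi>" "C1_compact L \<eta>"
  shows "grad (\<lambda>x. \<psi> x + \<eta> x) x = grad \<psi> x + grad \<eta> x"
  using assms unfolding C1_compact_def
  by (intro grad_unique) (auto simp: inner_add_left intro!: has_derivative_add)

lemma test_function_scale:
  assumes "\<psi> \<in> test_functions \<Omega>"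
  shows "(\<lambda>x. c * \<psi> x) \<in> test_functions \<Omega>"
  by (rule test_function_compose[OF assms])
    (auto intro: Ck_on_linear bounded_linear_mult_right)

lemma grad_scale:
  assumes "C1_compact K \<psi>"
  shows "grad (\<lambda>x. c * \<psi> x) x = c *\<^sub>R grad \<psi> x"
  by (rule grad_compose[OF assms, where h = "\<lambda>s. c * s"]) (auto intro!: derivative_eq_intros)

text \<open>For \<open>n > 0\<close> this is smooth and positive exactly on \<open>box c d\<close>.
  The family in \<open>n\<close> approximates the indicator of the box; the single member
  \<open>n = 1\<close> serves as a cutoff in the local constructions.\<close>

definition bump :: "nat \<Rightarrow> real^'n \<Rightarrow> real^'n \<Rightarrow> real^'n \<Rightarrow> real" where
  "bump n c d x = (\<Prod>i\<in>UNIV. flat 0 (real n * (x $ i - c $ i)) * flat 0 (real n * (d $ i - x $ i)))"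

lemma bump_bounds: "0 \<le> bump n c d x" "bump n c d x \<le> 1"
  unfolding bump_def by (auto intro!: prod_nonneg prod_le_1 mult_le_one simp: flat0_bounds)

lemma bump_eq_0:
  assumes "x \<notin> box c d"
  shows "bump n c d x = 0"
proof -
  obtain i where "x $ i \<le> c $ i \<or> d $ i \<le> x $ i"
    using assms by (meson mem_box_cart(1) not_le)
  then have "flat 0 (real n * (x $ i - c $ i)) * flat 0 (real n * (d $ i - x $ i)) = 0"
    by (auto simp: flat0_bounds mult_nonneg_nonpos)
  then show ?thesis
    unfolding bump_def by (intro prod_zero) auto
qed

lemma bump_pos:
  assumes "n > 0" "x \<in> box c d"
  shows "bump n c d x > 0"
proof -
  have "0 < flat 0 (real n * (x $ i - c $ i)) * flat 0 (real n * (d $ i - x $ i))" for i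
    using assms by (auto simp: mem_box_cart flat_def)
  then show ?thesis
    unfolding bump_def by (intro prod_pos) auto
qed

lemma bump_tendsto: "(\<lambda>n. bump n c d x) \<longlonglongrightarrow> indicat_real (box c d) x"
proof (cases "x \<in> box c d")
  case True
  have "(\<lambda>n. bump n c d x) \<longlonglongrightarrow> (\<Prod>i\<in>(UNIV::'a set). 1 * 1)"
    unfolding bump_def
    using True flat0_scaled_tendsto[where c = 0]
    by (intro tendsto_prod tendsto_mult) (auto simp: mem_box_cart)
  then show ?thesis using True by simp
next
  case False
  then show ?thesis by (simp add: bump_eq_0)
qed

lemma Ck_on_bump: "Ck_on k UNIV (bump n c d)"
proof -
  have a: "Ck_on k UNIV (\<lambda>x::real^'a. r * (x $ i) + s)" for i r s
    by (intro Ck_on_add Ck_on_mult Ck_on_const open_UNIV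
        Ck_on_linear[where L = "\<lambda>x. x $ i", OF _ bounded_linear_vec_nth])
  have f: "Ck_on k UNIV (\<lambda>x::real^'a. flat 0 (r * (x $ i) + s))" for i r s
    by (rule Ck_on_compose[where h = "flat 0" and f = "\<lambda>x. r * (x $ i) + s" and T = UNIV])
      (simp_all add: a Ck_on_flat)
  have "Ck_on k UNIV (\<lambda>x. \<Prod>i\<in>UNIV. flat 0 (real n * x $ i + (- real n * c $ i)) *
      flat 0 (- real n * x $ i + real n * d $ i))"
    by (intro Ck_on_prod Ck_on_mult open_UNIV finite f)
  then show ?thesis
    by (simp add: bump_def[abs_def] algebra_simps)
qed

lemma test_function_bump: "cbox c d \<subseteq> \<Omega> \<Longrightarrow> bump n c d \<in> test_functions \<Omega>"
  by (rule test_functionI[OF Ck_on_bump, of "cbox c d"])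
    (use box_subset_cbox in \<open>auto intro!: bump_eq_0\<close>)

section \<open>The N-function\<close>

locale N_function =
  fixes a :: "real \<Rightarrow> real"
  assumes adm: "admissible a"
begin

abbreviation \<phi> where "\<phi> \<equiv> phi a"
abbreviation \<Phi> where "\<Phi> \<equiv> Phi a"
abbreviation p where "p \<equiv> phi_plus a"

lemma phi_0 [simp]: "\<phi> 0 = 0"
  by (simp add: phi_def)

lemma phi_minus: "\<phi> (- t) = - \<phi> t"
  using adm by (simp add: admissible_def)

lemma phi_less: "s < t \<Longrightarrow> \<phi> s < \<phi> t"
  using adm by (simp add: admissible_def strict_mono_def)

lemma phi_mono: "s \<le> t \<Longrightarrow> \<phi> s \<le> \<phi> t"
  using phi_less[of s t] by (cases "s = t") auto

lemma phi_pos: "t > 0 \<Longrightarrow> \<phi> t > 0"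
  using phi_less[of 0 t] by simp

lemma phi_nonneg: "t \<ge> 0 \<Longrightarrow> \<phi> t \<ge> 0"
  using phi_mono[of 0 t] by simp

lemma phi_continuous: "continuous_on UNIV \<phi>"
  using adm by (auto simp: admissible_def homeomorphism_def)

lemma phi_has_derivative:
  assumes "t > 0"
  shows "(\<phi> has_real_derivative deriv \<phi> t) (at t)"
proof -
  obtain D where "(a has_vector_derivative D t) (at t)"
    using adm assms by (auto simp: admissible_def C1_differentiable_on_def)
  then have "(a has_real_derivative D t) (at t)"
    by (simp add: has_real_derivative_iff_has_vector_derivative)
  then have "((\<lambda>t. a t * t) has_real_derivative (D t * t + a t)) (at t)"
    by (auto intro!: derivative_eq_intros)
  then have "(\<phi> has_real_derivative (D t * t + a t)) (at t)"
    by (rule has_field_derivative_transform_within_open[where S = "{0<..}"])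
      (use assms in \<open>auto simp: phi_def\<close>)
  then show ?thesis
    using DERIV_imp_deriv by metis
qed

lemma phi_quotient_bounds:
  assumes "t > 0"
  shows "a_minus a * \<phi> t \<le> t * deriv \<phi> t" "t * deriv \<phi> t \<le> a_plus a * \<phi> t"
proof -
  have "mono_on UNIV \<phi>" using phi_mono by (simp add: mono_on_def)
  then have "deriv \<phi> s \<ge> 0" if "s > 0" for s
    using phi_has_derivative[OF that] by (rule mono_on_imp_deriv_nonneg) simp
  then have "phi_quotient a s \<ge> 0" if "s > 0" for s
    unfolding phi_quotient_def using that phi_pos[OF that] by simp
  then have "a_minus a \<le> phi_quotient a t"
    unfolding a_minus_def using assms by (intro cINF_lower bdd_belowI2[where m = 0]) auto
  moreover have "phi_quotient a t \<le> a_plus a"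
    unfolding a_plus_def using assms adm
    by (intro cSUP_upper) (auto simp: admissible_def phi_quotient_bounded_def)
  ultimately show "a_minus a * \<phi> t \<le> t * deriv \<phi> t" "t * deriv \<phi> t \<le> a_plus a * \<phi> t"
    using phi_pos[OF assms] by (auto simp: phi_quotient_def field_simps)
qed

lemma a_minus_pos: "0 < a_minus a"
  using adm by (simp add: admissible_def)

lemma p_gt_1: "p > 1"
  using adm by (simp add: admissible_def phi_plus_def)

section \<open>Derivative, convexity and growth of \<open>\<Phi>\<close>\<close>

lemma Phi_0 [simp]: "\<Phi> 0 = 0"
proof -
  have "(\<lambda>s. indicat_real {0..0} s *\<^sub>R \<phi> s) = (\<lambda>s. 0)"
    by (auto simp: indicator_def)
  then show ?thesis
    by (simp add: even_primitive_def set_lebesgue_integral_def)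
qed

lemma Phi_abs: "\<Phi> \<bar>t\<bar> = \<Phi> t"
  by (simp add: even_primitive_def)

lemma Phi_minus [simp]: "\<Phi> (- t) = \<Phi> t"
  by (simp add: even_primitive_def)

text \<open>Since \<open>\<Phi>\<close> integrates over \<open>{0..\<bar>t\<bar>}\<close>, the
  fundamental theorem applies directly only on the positive side. An antiderivative \<open>F\<close>
  on a symmetric interval is even because \<open>\<phi>\<close> is odd, hence \<open>\<Phi>\<close>
  equals \<open>F - F 0\<close> near every \<open>t\<close>, including 0 and negative
  values.\<close>

lemma Phi_has_derivative: "(\<Phi> has_real_derivative \<phi> t) (at t)"
proof -
  define K where "K = \<bar>t\<bar> + 1"
  have t: "- K < t" "t < K"
    unfolding K_def by linarith+
  obtain F where F: "\<And>x. x \<in> {-K..K} \<Longrightarrow> (F has_vector_derivative \<phi> x) (at x within {-K..K})"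
    using antiderivative_continuous[OF continuous_on_subset[OF phi_continuous], of "-K" K] by auto
  have F': "(F has_real_derivative \<phi> x) (at x within {-K..K})" if "x \<in> {-K..K}" for x
    using F[OF that] by (simp add: has_real_derivative_iff_has_vector_derivative)
  have Fi: "(F has_real_derivative \<phi> x) (at x)" if "x \<in> {-K<..<K}" for x
    using F'[of x] that by (simp add: at_within_Icc_at)
  have even: "F x = F (- x)" if "x \<in> {-K<..<K}" for x
  proof -
    have "((\<lambda>x. F x - F (- x)) has_real_derivative 0) (at y)" if "y \<in> {-K<..<K}" for y
    proof -
      have "((\<lambda>x. F (- x)) has_real_derivative - \<phi> (- y)) (at y)"
        using DERIV_chain2[where f = F and g = uminus and x = y and Db = "-1" and s = UNIV,
            OF Fi[of "- y"]] that
        by (simp add: DERIV_minus)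
      then show ?thesis
        using DERIV_diff[OF Fi[OF that]] by (fastforce simp: phi_minus)
    qed
    then have "\<exists>c. \<forall>x\<in>{-K<..<K}. F x - F (- x) = c"
      by (intro has_field_derivative_zero_constant) (auto intro: has_field_derivative_at_within)
    then obtain c where c: "\<And>x. x \<in> {-K<..<K} \<Longrightarrow> F x - F (- x) = c" by auto
    have "0 \<in> {-K<..<K}" using t by auto
    then show ?thesis using c[OF that] c[of 0] by simp
  qed
  have "\<Phi> x = F x - F 0" if x: "x \<in> {-K<..<K}" for x
  proof -
    have "\<Phi> x = integral {0..\<bar>x\<bar>} \<phi>"
      unfolding even_primitive_def
      by (intro set_borel_integral_eq_integral borel_integrable_atLeastAtMost')
        (rule continuous_on_subset[OF phi_continuous], simp)
    also have "\<dots> = F \<bar>x\<bar> - F 0"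
    proof (intro integral_unique fundamental_theorem_of_calculus)
      show "(F has_vector_derivative \<phi> y) (at y within {0..\<bar>x\<bar>})" if "y \<in> {0..\<bar>x\<bar>}" for y
      proof (rule has_vector_derivative_within_subset)
        show "(F has_vector_derivative \<phi> y) (at y within {-K..K})"
          by (rule F) (use that x in \<open>auto simp: abs_if split: if_splits\<close>)
        show "{0..\<bar>x\<bar>} \<subseteq> {-K..K}"
          using x by (simp add: subset_iff) linarith
      qed
    qed simp
    also have "F \<bar>x\<bar> = F x"
      using even[OF x] by (cases "x \<ge> 0") auto
    finally show ?thesis .
  qed
  note Phi_eq = this
  have "((\<lambda>x. F x - F 0) has_real_derivative \<phi> t - 0) (at t)"
    by (rule DERIV_diff[OF Fi DERIV_const]) (use t in simp)
  then have "((\<lambda>x. F x - F 0) has_real_derivative \<phi> t) (at t)"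
    by simp
  then show ?thesis
  proof (rule has_field_derivative_transform_within_open[where S = "{-K<..<K}"])
    show "F x - F 0 = \<Phi> x" if "x \<in> {-K<..<K}" for x
      using Phi_eq[OF that] by simp
  qed (use t in auto)
qed

lemma Phi_continuous: "continuous_on S \<Phi>"
  using Phi_has_derivative by (intro DERIV_continuous_on) (auto intro: has_field_derivative_at_within)

lemma tendsto_Phi:
  assumes "(f \<longlongrightarrow> l) F"
  shows "((\<lambda>x. \<Phi> (f x)) \<longlongrightarrow> \<Phi> l) F"
  by (rule isCont_tendsto_compose[OF _ assms])
    (use Phi_continuous[of UNIV] in \<open>simp add: continuous_on_eq_continuous_at\<close>)

text \<open>The derivative of \<open>\<Phi> x - \<phi> z * x\<close> changes sign at
  \<open>z\<close> because \<open>\<phi>\<close> is increasing. This supporting line is the form in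
  which convexity is used.\<close>

lemma Phi_tangent: "\<Phi> s \<ge> \<Phi> z + \<phi> z * (s - z)"
proof -
  have d: "((\<lambda>x. \<Phi> x - \<phi> z * x) has_real_derivative (\<phi> x - \<phi> z)) (at x)" for x
    using Phi_has_derivative by (auto intro!: derivative_eq_intros)
  have "\<Phi> z - \<phi> z * z \<le> \<Phi> s - \<phi> z * s"
  proof (cases "z \<le> s")
    case True
    show ?thesis
    proof (rule DERIV_nonneg_imp_nondecreasing[of z s "\<lambda>x. \<Phi> x - \<phi> z * x"])
      show "\<exists>y. ((\<lambda>x. \<Phi> x - \<phi> z * x) has_real_derivative y) (at x) \<and> 0 \<le> y" if "z \<le> x" for x
        using d[of x] phi_mono[OF that] by (intro exI[of _ "\<phi> x - \<phi> z"]) simp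
    qed (rule True)
  next
    case False
    show ?thesis
    proof (rule DERIV_nonpos_imp_nonincreasing[of s z "\<lambda>x. \<Phi> x - \<phi> z * x"])
      show "\<exists>y. ((\<lambda>x. \<Phi> x - \<phi> z * x) has_real_derivative y) (at x) \<and> y \<le> 0" if "x \<le> z" for x
        using d[of x] phi_mono[OF that] by (intro exI[of _ "\<phi> x - \<phi> z"]) simp
    qed (use False in simp)
  qed
  then show ?thesis by (simp add: algebra_simps)
qed

lemma Phi_nonneg: "\<Phi> t \<ge> 0"
  using Phi_tangent[of 0 t] by simp

lemma Phi_mono: "0 \<le> s \<Longrightarrow> s \<le> t \<Longrightarrow> \<Phi> s \<le> \<Phi> t"
  using Phi_tangent[of s t] mult_nonneg_nonneg[of "\<phi> s" "t - s"] phi_nonneg[of s] by linarith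

lemma Phi_mono_abs: "\<bar>s\<bar> \<le> \<bar>t\<bar> \<Longrightarrow> \<Phi> s \<le> \<Phi> t"
  using Phi_mono[of "\<bar>s\<bar>" "\<bar>t\<bar>"] by (simp add: Phi_abs)

lemma Phi_pos: "t \<noteq> 0 \<Longrightarrow> \<Phi> t > 0"
proof -
  assume "t \<noteq> 0"
  then have "\<phi> (\<bar>t\<bar> / 2) * (\<bar>t\<bar> - \<bar>t\<bar> / 2) > 0"
    by (auto intro!: mult_pos_pos phi_pos)
  then show ?thesis
    using Phi_tangent[of "\<bar>t\<bar> / 2" "\<bar>t\<bar>"] Phi_nonneg[of "\<bar>t\<bar> / 2"] by (simp add: Phi_abs)
qed

text \<open>The upper bound \<open>a_plus a\<close> on the quotient, integrated from 0: the
  derivative of \<open>p * \<Phi> t - t * \<phi> t\<close> is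
  \<open>a_plus a * \<phi> t - t * deriv \<phi> t\<close>. The monotonicity criterion for open
  intervals is used because \<open>\<phi>\<close> is differentiated only at positive points.\<close>

lemma phi_le_Phi: "t * \<phi> t \<le> p * \<Phi> t"
proof -
  have *: "t * \<phi> t \<le> p * \<Phi> t" if "t \<ge> 0" for t
  proof -
    have "p * \<Phi> 0 - 0 * \<phi> 0 \<le> p * \<Phi> t - t * \<phi> t"
    proof (rule DERIV_nonneg_imp_increasing_open[OF that])
      show "continuous_on {0..t} (\<lambda>t. p * \<Phi> t - t * \<phi> t)"
        by (intro continuous_intros Phi_continuous continuous_on_subset[OF phi_continuous]) auto
      show "\<exists>y. ((\<lambda>t. p * \<Phi> t - t * \<phi> t) has_real_derivative y) (at x) \<and> 0 \<le> y" if "0 < x" for x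
      proof (intro exI conjI)
        show "((\<lambda>t. p * \<Phi> t - t * \<phi> t) has_real_derivative (p * \<phi> x - (\<phi> x + x * deriv \<phi> x))) (at x)"
          using Phi_has_derivative[of x] phi_has_derivative[OF that]
          by (auto intro!: derivative_eq_intros)
        show "0 \<le> p * \<phi> x - (\<phi> x + x * deriv \<phi> x)"
          using phi_quotient_bounds(2)[OF that] by (simp add: phi_plus_def algebra_simps)
      qed
    qed
    then show ?thesis by simp
  qed
  show ?thesis
    using *[of "\<bar>t\<bar>"] phi_minus[of t] by (cases "t \<ge> 0") auto
qed

lemma Phi_scale_le_1:
  assumes "0 \<le> l" "l \<le> 1"
  shows "\<Phi> (l * t) \<le> l * \<Phi> t"
proof -
  have "\<Phi> t \<ge> \<Phi> (l * t) + \<phi> (l * t) * (t - l * t)" "\<Phi> 0 \<ge> \<Phi> (l * t) + \<phi> (l * t) * (0 - l * t)"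
    by (rule Phi_tangent)+
  \<comment> \<open>Weights \<open>l\<close> and \<open>1 - l\<close> on the supporting line at
    \<open>l * t\<close>: the slope terms cancel.\<close>
  then have "l * \<Phi> t + (1 - l) * \<Phi> 0 \<ge> l * (\<Phi> (l * t) + \<phi> (l * t) * (t - l * t))
      + (1 - l) * (\<Phi> (l * t) + \<phi> (l * t) * (0 - l * t))"
    using assms by (intro add_mono mult_left_mono) auto
  then show ?thesis by (simp add: algebra_simps)
qed

text \<open>By \<open>phi_le_Phi\<close> the function \<open>\<Phi> (l * s) * l powr (- p)\<close>
  is nonincreasing in \<open>l\<close>. This growth bound is what makes convergence in the modular
  and in the Luxemburg norm agree.\<close>

lemma Phi_scale_ge_1:
  assumes "1 \<le> l"
  shows "\<Phi> (l * t) \<le> l powr p * \<Phi> t"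
proof -
  define s where "s = \<bar>t\<bar>"
  have s: "s \<ge> 0" by (simp add: s_def)
  have "\<Phi> (l * s) * l powr (- p) \<le> \<Phi> (1 * s) * 1 powr (- p)"
  proof (rule DERIV_nonpos_imp_nonincreasing[OF assms, of "\<lambda>l. \<Phi> (l * s) * l powr (- p)"])
    fix x :: real assume x: "1 \<le> x"
    have "((\<lambda>l. \<Phi> (l * s)) has_real_derivative \<phi> (x * s) * s) (at x)"
      by (rule DERIV_chain2[OF Phi_has_derivative]) (auto intro!: derivative_eq_intros)
    then have "((\<lambda>l. \<Phi> (l * s) * l powr (- p)) has_real_derivative
        (\<phi> (x * s) * s * x powr (- p) + (- p * x powr (- p - 1)) * \<Phi> (x * s))) (at x)"
      using x by (intro DERIV_mult has_real_derivative_powr) auto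
    moreover have "\<phi> (x * s) * s * x powr (- p) + (- p * x powr (- p - 1)) * \<Phi> (x * s)
       = x powr (- p - 1) * ((x * s) * \<phi> (x * s) - p * \<Phi> (x * s))"
      using x by (simp add: powr_diff field_simps)
    moreover have "\<dots> \<le> 0"
      using phi_le_Phi[of "x * s"] by (intro mult_nonneg_nonpos) auto
    ultimately show "\<exists>y. ((\<lambda>l. \<Phi> (l * s) * l powr (- p)) has_real_derivative y) (at x) \<and> y \<le> 0"
      by metis
  qed
  then have "\<Phi> (l * s) \<le> l powr p * \<Phi> s"
    using assms by (simp add: powr_minus field_simps)
  moreover have "\<Phi> (l * s) = \<Phi> (l * t)"
    using Phi_abs[of "l * s"] Phi_abs[of "l * t"] by (simp add: s_def abs_mult)
  ultimately show ?thesis by (simp add: s_def Phi_abs)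
qed

lemma Phi_scale:
  assumes "0 \<le> l"
  shows "\<Phi> (l * t) \<le> max 1 (l powr p) * \<Phi> t"
proof (cases "l \<le> 1")
  case True
  have "\<Phi> (l * t) \<le> l * \<Phi> t" by (rule Phi_scale_le_1[OF assms True])
  also have "\<dots> \<le> 1 * \<Phi> t" using True Phi_nonneg by (intro mult_right_mono) auto
  also have "\<dots> \<le> max 1 (l powr p) * \<Phi> t" using Phi_nonneg by (intro mult_right_mono) auto
  finally show ?thesis .
next
  case False
  have "\<Phi> (l * t) \<le> l powr p * \<Phi> t" by (rule Phi_scale_ge_1) (use False in simp)
  also have "\<dots> \<le> max 1 (l powr p) * \<Phi> t" using Phi_nonneg by (intro mult_right_mono) auto
  finally show ?thesis .
qed

text \<open>Constant of the quasi-triangle inequality for \<open>\<Phi>\<close>: the growth factor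
  under doubling.\<close>

definition Kq where "Kq = 2 powr p"

lemma Kq_ge_1: "Kq \<ge> 1"
  using p_gt_1 by (simp add: Kq_def ge_one_powr_ge_zero)

lemma Phi_add: "\<Phi> (s + t) \<le> Kq * (\<Phi> s + \<Phi> t)"
proof -
  have *: "\<Phi> (s + t) \<le> Kq * (\<Phi> s + \<Phi> t)" if "\<bar>s\<bar> \<le> \<bar>t\<bar>" for s t
  proof -
    have "\<Phi> (s + t) \<le> \<Phi> (2 * t)"
      using that by (intro Phi_mono_abs) auto
    also have "\<dots> \<le> Kq * \<Phi> t"
      unfolding Kq_def by (rule Phi_scale_ge_1) simp
    also have "\<dots> \<le> Kq * (\<Phi> s + \<Phi> t)"
      using Kq_ge_1 Phi_nonneg by (intro mult_left_mono) auto
    finally show ?thesis .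
  qed
  show ?thesis
    using *[of s t] *[of t s] by (cases "\<bar>s\<bar> \<le> \<bar>t\<bar>") (auto simp: add.commute)
qed

lemma Phi_norm_add:
  fixes X Y :: "'v::real_normed_vector"
  shows "\<Phi> (norm (X + Y)) \<le> Kq * (\<Phi> (norm X) + \<Phi> (norm Y))"
  using Phi_mono[OF norm_ge_zero norm_triangle_ineq[of X Y]] Phi_add[of "norm X" "norm Y"] by simp

lemma Phi_norm_diff:
  fixes X Y :: "'v::real_normed_vector"
  shows "\<Phi> (norm (X - Y)) \<le> Kq * (\<Phi> (norm X) + \<Phi> (norm Y))"
  using Phi_norm_add[of X "- Y"] by simp

text \<open>Beyond \<open>\<epsilon>\<close> convexity makes \<open>\<Phi>\<close> grow at least
  linearly. The free \<open>\<epsilon>\<close> lets a small modular force a small L1 norm on a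
  domain of finite measure.\<close>

lemma abs_le_Phi:
  assumes "\<epsilon> > 0"
  shows "\<bar>t\<bar> \<le> \<epsilon> + \<epsilon> / \<Phi> \<epsilon> * \<Phi> t"
proof (cases "\<bar>t\<bar> \<le> \<epsilon>")
  case True
  then show ?thesis
    using Phi_nonneg assms by (smt (verit) divide_nonneg_nonneg mult_nonneg_nonneg)
next
  case False
  then have "\<Phi> (\<epsilon> / \<bar>t\<bar> * \<bar>t\<bar>) \<le> \<epsilon> / \<bar>t\<bar> * \<Phi> \<bar>t\<bar>"
    using assms by (intro Phi_scale_le_1) (auto simp: field_simps)
  then have "\<Phi> \<epsilon> * \<bar>t\<bar> \<le> \<epsilon> * \<Phi> t"
    using False assms by (simp add: Phi_abs field_simps)
  then have "\<bar>t\<bar> \<le> \<epsilon> / \<Phi> \<epsilon> * \<Phi> t"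
    using Phi_pos[of \<epsilon>] assms by (simp add: field_simps)
  then show ?thesis using assms by simp
qed

text \<open>Young's inequality with \<open>\<Phi>\<close> on both sides. If
  \<open>t \<le> e * s\<close>, the product is at most \<open>e * (s * \<phi> s)\<close>; otherwise
  \<open>\<phi> s\<close> is raised to \<open>\<phi> (1 / e * t)\<close>. In both cases
  \<open>phi_le_Phi\<close> takes over, and \<open>e\<close> is chosen so that
  \<open>e * p = \<epsilon>\<close>.\<close>

lemma young:
  assumes "\<epsilon> > 0"
  obtains C where "C > 0" "\<And>s t. 0 \<le> s \<Longrightarrow> 0 \<le> t \<Longrightarrow> \<phi> s * t \<le> \<epsilon> * \<Phi> s + C * \<Phi> t"
proof
  define e where "e = \<epsilon> / p"
  have e: "e > 0" using assms p_gt_1 by (simp add: e_def)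
  define C where "C = \<epsilon> * max 1 ((1 / e) powr p)"
  show "C > 0" using assms by (simp add: C_def)
  fix s t :: real assume s: "0 \<le> s" and t: "0 \<le> t"
  show "\<phi> s * t \<le> \<epsilon> * \<Phi> s + C * \<Phi> t"
  proof (cases "t \<le> e * s")
    case True
    have "\<phi> s * t \<le> \<phi> s * (e * s)"
      using True phi_nonneg[OF s] by (rule mult_left_mono)
    also have "\<dots> = e * (s * \<phi> s)" by simp
    also have "\<dots> \<le> e * (p * \<Phi> s)" using e phi_le_Phi by (intro mult_left_mono) auto
    also have "\<dots> = \<epsilon> * \<Phi> s" using p_gt_1 by (simp add: e_def)
    finally show ?thesis
      using \<open>C > 0\<close> mult_nonneg_nonneg[OF _ Phi_nonneg[of t], of C] by linarith
  next
    case False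
    then have "s \<le> 1 / e * t" using e by (simp add: field_simps)
    then have "\<phi> s * t \<le> \<phi> (1 / e * t) * t" using t by (intro mult_right_mono phi_mono)
    also have "\<dots> = e * ((1 / e * t) * \<phi> (1 / e * t))" using e by simp
    also have "\<dots> \<le> e * (p * \<Phi> (1 / e * t))" using e by (intro mult_left_mono phi_le_Phi) auto
    also have "\<dots> \<le> e * (p * (max 1 ((1 / e) powr p) * \<Phi> t))"
      using e p_gt_1 by (intro mult_left_mono Phi_scale) auto
    also have "\<dots> = C * \<Phi> t" using p_gt_1 by (simp add: C_def e_def)
    finally show ?thesis
      using assms mult_nonneg_nonneg[OF _ Phi_nonneg[of s], of \<epsilon>] by linarith
  qed
qed

subsection \<open>The vector field\<close>

text \<open>The field of the operator, which is the gradient of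
  \<open>\<Phi> (norm X)\<close>.\<close>

definition A :: "'v::real_inner \<Rightarrow> 'v" where
  "A X = a (norm X) *\<^sub>R X"

lemma A_0 [simp]: "A 0 = 0"
  by (simp add: A_def)

lemma norm_A: "norm (A X) = \<phi> (norm X)"
proof (cases "X = 0")
  case False
  then have "a (norm X) > 0"
    using adm by (simp add: admissible_def)
  then show ?thesis by (simp add: A_def phi_def)
qed simp

lemma A_inner_self: "A X \<bullet> X = \<phi> (norm X) * norm X"
  by (simp add: A_def phi_def power2_norm_eq_inner[symmetric] power2_eq_square)

text \<open>Away from 0 this is continuity of \<open>a\<close>. At 0, where \<open>a\<close> may be
  unbounded, it follows from \<open>norm (A X) = \<phi> (norm X)\<close>.\<close>

lemma A_continuous: "continuous_on UNIV (A :: 'v::real_inner \<Rightarrow> 'v)"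
proof -
  have "continuous (at X) (A :: 'v \<Rightarrow> 'v)" for X
  proof (cases "X = 0")
    case True
    have "continuous_on UNIV (\<lambda>X::'v. \<phi> (norm X))"
      by (rule continuous_on_compose2[OF phi_continuous]) (auto intro!: continuous_intros)
    then have "((\<lambda>X::'v. \<phi> (norm X)) \<longlongrightarrow> 0) (at 0)"
      by (auto simp: continuous_on_eq_continuous_at continuous_at dest!: spec[of _ 0])
    then have "((A :: 'v \<Rightarrow> 'v) \<longlongrightarrow> 0) (at 0)"
      by (subst tendsto_norm_zero_iff[symmetric]) (simp add: norm_A)
    then show ?thesis using True by (simp add: continuous_at)
  next
    case False
    have "isCont a t" if "t > 0" for t
      using adm that by (auto simp: admissible_def C1_differentiable_on_def
          intro: has_vector_derivative_continuous)
    then have "isCont (\<lambda>X. a (norm X)) X"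
      using False by (intro isCont_o2[where f = norm and g = a]) auto
    then show ?thesis
      unfolding A_def by (intro continuous_scaleR continuous_ident)
  qed
  then show ?thesis by (simp add: continuous_on_eq_continuous_at)
qed

text \<open>Cauchy-Schwarz gives \<open>A Z \<bullet> X \<le> \<phi> (norm Z) * norm X\<close>, with
  equality at \<open>X = Z\<close>, which reduces the claim to the scalar supporting line.\<close>

lemma Phi_subgradient: "\<Phi> (norm X) \<ge> \<Phi> (norm Z) + A Z \<bullet> (X - Z)"
proof -
  have "A Z \<bullet> X \<le> \<phi> (norm Z) * norm X"
    using norm_cauchy_schwarz[of "A Z" X] by (simp add: norm_A)
  then show ?thesis
    using Phi_tangent[of "norm Z" "norm X"] by (simp add: inner_diff_right A_inner_self algebra_simps)
qed

text \<open>Adding the two subgradient inequalities with \<open>X\<close> and \<open>Y\<close>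
  exchanged cancels the values of \<open>\<Phi>\<close>.\<close>

lemma A_monotone: "(A X - A Y) \<bullet> (X - Y) \<ge> 0"
  using Phi_subgradient[of X Y] Phi_subgradient[of Y X]
  by (simp add: inner_diff_left inner_diff_right)

lemma Phi_midpoint_convex: "\<Phi> (norm ((X + Y) /\<^sub>R 2)) \<le> (\<Phi> (norm X) + \<Phi> (norm Y)) / 2"
  for X Y :: "'v::real_inner"
proof -
  let ?Z = "(X + Y) /\<^sub>R 2"
  have "A ?Z \<bullet> (X - ?Z) + A ?Z \<bullet> (Y - ?Z) = A ?Z \<bullet> (X + Y - 2 *\<^sub>R ?Z)"
    by (simp add: inner_diff_right inner_add_right)
  then show ?thesis
    using Phi_subgradient[of ?Z X] Phi_subgradient[of ?Z Y] by simp
qed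

end

subsection \<open>Uniform convexity\<close>

lemma powr_tangent_strict:
  fixes q r s :: real
  assumes "q > 1" "r > 0" "s \<ge> 0" "s \<noteq> r"
  shows "s powr q > r powr q + q * r powr (q - 1) * (s - r)"
proof -
  have d: "((\<lambda>x. x powr q) has_real_derivative q * x powr (q - 1)) (at x)" if "x > 0" for x
    using that by (rule has_real_derivative_powr)
  have c: "continuous_on S (\<lambda>x::real. x powr q)" if "S \<subseteq> {0..}" for S
    using assms(1) that by (intro continuous_on_powr') (auto intro!: continuous_intros)
  show ?thesis
  proof (cases "r < s")
    case True
    obtain z where z: "r < z" "z < s" "s powr q - r powr q = (s - r) * (q * z powr (q - 1))"
      using MVT2[OF True, of "\<lambda>x. x powr q" "\<lambda>x. q * x powr (q - 1)"] d assms by force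
    have "r powr (q - 1) < z powr (q - 1)"
      using assms z by (intro powr_less_mono2) auto
    then have "(s - r) * (q * r powr (q - 1)) < (s - r) * (q * z powr (q - 1))"
      using True assms by simp
    then show ?thesis using z by (simp add: algebra_simps)
  next
    case False
    then have "s < r" using assms by simp
    \<comment> \<open>As \<open>s\<close> may be 0, where the derivative formula is not at hand, the
      mean value theorem is used in the form that asks only for continuity at the end
      points.\<close>
    obtain z D where z: "s < z" "z < r" "((\<lambda>x. x powr q) has_real_derivative D) (at z)"
        "r powr q - s powr q = (r - s) * D"
    proof (rule MVT[OF \<open>s < r\<close>, THEN exE])
      show "continuous_on {s..r} (\<lambda>x. x powr q)" using assms by (intro c) auto
      show "(\<lambda>x. x powr q) differentiable (at x)" if "s < x" for x
        using d[of x] that assms by (auto simp: has_field_derivative_def intro: differentiableI)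
    qed blast
    have D: "D = q * z powr (q - 1)"
      using z(3) d[of z] z(1) assms by (intro DERIV_unique) auto
    have "z powr (q - 1) < r powr (q - 1)"
      using assms z by (intro powr_less_mono2) auto
    then have "(r - s) * (q * z powr (q - 1)) < (r - s) * (q * r powr (q - 1))"
      using \<open>s < r\<close> assms by simp
    then show ?thesis using z(4) D by (simp add: algebra_simps)
  qed
qed

text \<open>The power mean of order \<open>q\<close> of two nonnegative numbers.\<close>

definition pmean :: "real \<Rightarrow> real \<Rightarrow> real \<Rightarrow> real" where
  "pmean q s t = ((s powr q + t powr q) / 2) powr (1 / q)"

lemma pmean_powr: "q > 1 \<Longrightarrow> pmean q s t powr q = (s powr q + t powr q) / 2"
  by (simp add: pmean_def powr_powr)

lemma pmean_nonneg: "pmean q s t \<ge> 0"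
  by (simp add: pmean_def)

lemma pmean_scale:
  assumes "q > 1" "m \<ge> 0" "s \<ge> 0" "t \<ge> 0"
  shows "pmean q (m * s) (m * t) = m * pmean q s t"
proof -
  have "((m * s) powr q + (m * t) powr q) / 2 = m powr q * ((s powr q + t powr q) / 2)"
    using assms by (simp add: powr_mult algebra_simps add_divide_distrib)
  show ?thesis
    unfolding pmean_def \<open>((m * s) powr q + (m * t) powr q) / 2 = _\<close>
    using assms powr_mult[of "m powr q" "(s powr q + t powr q) / 2" "1 / q"] by (simp add: powr_powr)
qed

lemma mean_less_pmean:
  assumes "q > 1" "s \<ge> 0" "t \<ge> 0" "s \<noteq> t"
  shows "(s + t) / 2 < pmean q s t"
proof -
  define r where "r = (s + t) / 2"
  have r: "r > 0" "s \<noteq> r" "t \<noteq> r" using assms by (auto simp: r_def)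
  have "(s - r) + (t - r) = 0" by (simp add: r_def)
  then have "q * r powr (q - 1) * (s - r) + q * r powr (q - 1) * (t - r) = 0"
    by (simp add: distrib_left[symmetric])
  moreover have "R < (S + T) / 2" if "u + v = 0" "S > R + u" "T > R + v" for u v R S T :: real
    using that by simp
  ultimately have "r powr q < (s powr q + t powr q) / 2"
    using powr_tangent_strict[OF assms(1) r(1) assms(2) r(2)]
      powr_tangent_strict[OF assms(1) r(1) assms(3) r(3)] by blast
  then have "(r powr q) powr (1 / q) < pmean q s t"
    unfolding pmean_def using assms by (intro powr_less_mono2) auto
  then show ?thesis using assms r by (simp add: powr_powr r_def)
qed

text \<open>Vectors of equal norm are handled by the parallelogram identity, vectors of different
  norm by strict convexity of the scalar power.\<close>

lemma norm_midpoint_less_pmean: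
  fixes X Y :: "'v::real_inner"
  assumes "q > 1" "X \<noteq> Y"
  shows "norm ((X + Y) /\<^sub>R 2) < pmean q (norm X) (norm Y)"
proof (cases "norm X = norm Y")
  case True
  have "norm (X - Y) ^ 2 > 0" using assms by simp
  moreover have "norm (X + Y) ^ 2 + norm (X - Y) ^ 2 = 2 * norm X ^ 2 + 2 * norm Y ^ 2"
    by (simp add: power2_norm_eq_inner inner_diff inner_add algebra_simps)
  moreover have "(2 * norm X) ^ 2 = 2 * norm X ^ 2 + 2 * norm Y ^ 2"
    using True by (simp add: power_mult_distrib)
  ultimately have "norm (X + Y) ^ 2 < (2 * norm X) ^ 2"
    by linarith
  then have "norm (X + Y) < 2 * norm X"
    by (rule power_less_imp_less_base) simp
  then show ?thesis
    using True assms by (simp add: pmean_def powr_powr)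
next
  case False
  have "norm ((X + Y) /\<^sub>R 2) \<le> (norm X + norm Y) / 2"
    using norm_triangle_ineq[of X Y] by simp
  also have "\<dots> < pmean q (norm X) (norm Y)"
    using False assms by (intro mean_less_pmean) auto
  finally show ?thesis .
qed

text \<open>Compactness turns strict into uniform convexity. Both sides are homogeneous, so pairs
  whose larger norm is 1 suffice; those at distance at least \<open>\<epsilon>\<close> form a
  compact set on which the continuous ratio \<open>f\<close> stays below 1.\<close>

lemma norm_midpoint_uniform:
  assumes "q > 1" "\<epsilon> > 0"
  obtains \<kappa> where "0 < \<kappa>" "\<kappa> \<le> 1"
    "\<And>X Y :: 'v::euclidean_space. norm (X - Y) \<ge> \<epsilon> * max (norm X) (norm Y) \<Longrightarrow>
       norm ((X + Y) /\<^sub>R 2) \<le> (1 - \<kappa>) * pmean q (norm X) (norm Y)"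
proof -
  define S where "S = {z :: 'v \<times> 'v. max (norm (fst z)) (norm (snd z)) = 1 \<and> norm (fst z - snd z) \<ge> \<epsilon>}"
  define f where "f = (\<lambda>z :: 'v \<times> 'v. norm ((fst z + snd z) /\<^sub>R 2) / pmean q (norm (fst z)) (norm (snd z)))"
  have pos: "pmean q (norm (fst z)) (norm (snd z)) > 0" if "z \<in> S" for z
  proof -
    have "norm (fst z) = 1 \<or> norm (snd z) = 1"
      using that by (auto simp: S_def max_def split: if_splits)
    then have "norm (fst z) powr q + norm (snd z) powr q > 0"
      by (auto intro: add_pos_nonneg add_nonneg_pos)
    then show ?thesis by (simp add: pmean_def)
  qed
  have "bounded S"
  proof (rule boundedI)
    fix z assume "z \<in> S"
    then have "norm (fst z) \<le> 1" "norm (snd z) \<le> 1"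
      by (auto simp: S_def max_def split: if_splits)
    then show "norm z \<le> 2"
      using norm_Pair_le[of "fst z" "snd z"] by simp
  qed
  moreover have "closed S"
    unfolding S_def by (intro closed_Collect_conj closed_Collect_eq closed_Collect_le continuous_intros)
  ultimately have comp: "compact S" by (simp add: compact_eq_bounded_closed)
  have cont: "continuous_on S f"
    unfolding f_def
    using pos assms(1) unfolding pmean_def
    by (intro continuous_on_divide continuous_intros continuous_on_powr') (auto simp: less_imp_neq[symmetric])
  have less: "f z < 1" if "z \<in> S" for z
  proof -
    have "fst z \<noteq> snd z" using that assms by (auto simp: S_def)
    from norm_midpoint_less_pmean[OF assms(1) this] pos[OF that] show ?thesis
      by (simp add: f_def)
  qed
  obtain \<kappa> where \<kappa>: "0 < \<kappa>" "\<kappa> \<le> 1" "\<And>z. z \<in> S \<Longrightarrow> f z \<le> 1 - \<kappa>"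
  \<comment> \<open>The set can be empty when \<open>\<epsilon>\<close> is large; then 1 is taken
    for \<open>\<kappa>\<close>.\<close>
  proof (cases "S = {}")
    case False
    then obtain z where z: "z \<in> S" "\<And>y. y \<in> S \<Longrightarrow> f y \<le> f z"
      using continuous_attains_sup[OF comp _ cont] by auto
    have "f z \<ge> 0" by (simp add: f_def pmean_nonneg)
    then show thesis using that[of "1 - f z"] z less[OF z(1)] by simp
  qed (use that[of 1] in auto)
  show thesis
  proof (rule that[OF \<kappa>(1,2)])
    fix X Y :: 'v assume XY: "norm (X - Y) \<ge> \<epsilon> * max (norm X) (norm Y)"
    define m where "m = max (norm X) (norm Y)"
    show "norm ((X + Y) /\<^sub>R 2) \<le> (1 - \<kappa>) * pmean q (norm X) (norm Y)"
    proof (cases "m = 0")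
      case True
      then have "X = 0" "Y = 0"
        unfolding m_def by (metis max.cobounded1 max.cobounded2 norm_le_zero_iff)+
      then show ?thesis using \<kappa>(2) by (simp add: pmean_nonneg)
    next
      case False
      then have m: "m > 0"
        unfolding m_def by (metis max.coboundedI1 norm_ge_zero order_less_le)
      define z where "z = (X /\<^sub>R m, Y /\<^sub>R m)"
      have n: "norm (fst z) = norm X / m" "norm (snd z) = norm Y / m"
        using m by (auto simp: z_def field_simps)
      have "fst z - snd z = (X - Y) /\<^sub>R m" by (simp add: z_def scaleR_diff_right)
      then have n3: "norm (fst z - snd z) = norm (X - Y) / m"
        using m by (simp only: norm_scaleR) (simp add: divide_inverse mult.commute)
      have "max (norm X / m) (norm Y / m) = 1"
        using m by (auto simp: m_def max_def)
      then have zS: "z \<in> S"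
        using XY m unfolding S_def by (simp add: n n3 m_def[symmetric] pos_le_divide_eq)
      have X: "X = m *\<^sub>R fst z" "Y = m *\<^sub>R snd z" using m by (auto simp: z_def)
      have "norm ((X + Y) /\<^sub>R 2) = m * norm ((fst z + snd z) /\<^sub>R 2)"
        using m by (simp add: X scaleR_add_right[symmetric])
      also have "\<dots> \<le> m * ((1 - \<kappa>) * pmean q (norm (fst z)) (norm (snd z)))"
        using \<kappa>(3)[OF zS] pos[OF zS] m unfolding f_def by (simp add: pos_divide_le_eq)
      also have "\<dots> = (1 - \<kappa>) * pmean q (norm X) (norm Y)"
        using pmean_scale[of q m "norm (fst z)" "norm (snd z)"] m assms by (simp add: X)
      finally show ?thesis .
    qed
  qed
qed

context N_function
begin

text \<open>With \<open>q = 1 + a_minus a\<close> the function \<open>r \<mapsto> \<Phi> (r powr (1 / q))\<close> is convex; this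
  reduces the uniform convexity of \<open>\<Phi> \<circ> norm\<close> to that of a power of the norm.\<close>

lemma Phi_pmean:
  assumes "s \<ge> 0" "t \<ge> 0"
  shows "\<Phi> (pmean (1 + a_minus a) s t) \<le> (\<Phi> s + \<Phi> t) / 2"
proof -
  define q where "q = 1 + a_minus a"
  have q: "q > 1" using a_minus_pos by (simp add: q_def)
  define r where "r = pmean q s t"
  show ?thesis
  proof (cases "r = 0")
    case True
    then show ?thesis using Phi_nonneg by (simp add: r_def q_def)
  next
    case False
    then have r: "r > 0" using pmean_nonneg[of q s t] by (simp add: r_def order_less_le)
    \<comment> \<open>The lower bound \<open>a_minus a\<close> on the quotient in integrated
      form.\<close>
    have mono: "\<phi> x * x powr (- a_minus a) \<le> \<phi> y * y powr (- a_minus a)" if "0 < x" "x \<le> y" for x y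
    proof (rule DERIV_nonneg_imp_nondecreasing[OF that(2), of "\<lambda>x. \<phi> x * x powr (- a_minus a)"])
      fix z assume "x \<le> z"
      then have z: "z > 0" using that by simp
      have "((\<lambda>x. \<phi> x * x powr (- a_minus a)) has_real_derivative
          deriv \<phi> z * z powr (- a_minus a) + (- a_minus a * z powr (- a_minus a - 1)) * \<phi> z) (at z)"
        using z by (intro DERIV_mult phi_has_derivative has_real_derivative_powr)
      moreover have "deriv \<phi> z * z powr (- a_minus a) + (- a_minus a * z powr (- a_minus a - 1)) * \<phi> z
         = z powr (- a_minus a - 1) * (z * deriv \<phi> z - a_minus a * \<phi> z)"
        using z by (simp add: powr_diff field_simps)
      moreover have "\<dots> \<ge> 0"
        using phi_quotient_bounds(1)[OF z] by (intro mult_nonneg_nonneg) auto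
      ultimately show "\<exists>y. ((\<lambda>x. \<phi> x * x powr (- a_minus a)) has_real_derivative y) (at z) \<and> 0 \<le> y"
        by metis
    qed
    \<comment> \<open>The multiple \<open>c * x powr q\<close> has the same slope as
      \<open>\<Phi>\<close> at \<open>r\<close>, so by \<open>mono\<close> the difference
      \<open>h\<close> attains its minimum over \<open>x \<ge> 0\<close> there. This is the
      supporting line of \<open>\<Phi>\<close> in the variable \<open>x powr q\<close>; its terms
      average out because \<open>r powr q\<close> is the mean of \<open>s powr q\<close> and
      \<open>t powr q\<close>.\<close>
    define c where "c = \<phi> r * r powr (- a_minus a) / q"
    define h where "h = (\<lambda>x. \<Phi> x - c * x powr q)"
    have h': "(h has_real_derivative \<phi> x - c * (q * x powr (q - 1))) (at x)" if "x > 0" for x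
      unfolding h_def using that
      by (intro DERIV_diff Phi_has_derivative DERIV_cmult has_real_derivative_powr)
    have sgn: "\<phi> x - c * (q * x powr (q - 1))
        = x powr (a_minus a) * (\<phi> x * x powr (- a_minus a) - \<phi> r * r powr (- a_minus a))" if "x > 0" for x
    proof -
      have "c * q = \<phi> r * r powr (- a_minus a)" using q by (simp add: c_def)
      then have "c * (q * x powr (q - 1)) = \<phi> r * r powr (- a_minus a) * x powr (a_minus a)"
        by (simp add: q_def mult.assoc[symmetric])
      moreover have "x powr (a_minus a) * x powr (- a_minus a) = 1"
        using that by (simp add: powr_add[symmetric])
      ultimately show ?thesis by (simp add: algebra_simps)
    qed
    have hc: "continuous_on {x..y} h" if "x \<ge> 0" for x y
      unfolding h_def using that q
      by (intro continuous_on_diff Phi_continuous continuous_on_mult continuous_on_const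
          continuous_on_powr' continuous_on_id) auto
    have hr: "h r \<le> h x" if x: "x \<ge> 0" for x
    proof (cases "x \<le> r")
      case True
      show ?thesis
      proof (rule DERIV_nonpos_imp_decreasing_open[OF True _ hc[OF x]])
        fix y assume y: "x < y" "y < r"
        then have "y > 0" using x by simp
        then show "\<exists>z. (h has_real_derivative z) (at y) \<and> z \<le> 0"
          using h'[of y] sgn[of y] mono[of y r] y
          by (intro exI[of _ "\<phi> y - c * (q * y powr (q - 1))"]) (simp add: mult_nonneg_nonpos)
      qed
    next
      case False
      then have le: "r \<le> x" by simp
      show ?thesis
      proof (rule DERIV_nonneg_imp_increasing_open[OF le _ hc])
        fix y assume y: "r < y" "y < x"
        then have "y > 0" using r by simp
        then show "\<exists>z. (h has_real_derivative z) (at y) \<and> z \<ge> 0"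
          using h'[of y] sgn[of y] mono[of r y] y r
          by (intro exI[of _ "\<phi> y - c * (q * y powr (q - 1))"]) simp
      qed (use r in simp)
    qed
    have "r powr q = (s powr q + t powr q) / 2"
      unfolding r_def by (rule pmean_powr[OF q])
    then have "c * r powr q = (c * s powr q + c * t powr q) / 2"
      by (simp add: algebra_simps)
    then have "\<Phi> r \<le> (\<Phi> s + \<Phi> t) / 2"
      using hr[OF assms(1)] hr[OF assms(2)] unfolding h_def by argo
    then show ?thesis by (simp add: r_def q_def)
  qed
qed

text \<open>If \<open>X - Y\<close> is small against the larger norm, convexity alone gives the
  factor \<open>\<epsilon>\<close>. Otherwise the midpoint gains a factor
  \<open>1 - \<kappa>\<close> over the power mean, so the convexity deficit is at least
  \<open>\<kappa> / 2\<close> times \<open>\<Phi> (norm X) + \<Phi> (norm Y)\<close> and absorbs the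
  quasi-triangle bound; hence the choice of \<open>C\<close>.\<close>

lemma uniformly_convex:
  assumes "0 < \<epsilon>" "\<epsilon> \<le> 1"
  obtains C where "C \<ge> 0" "\<And>X Y :: 'v::euclidean_space.
    \<Phi> (norm (X - Y)) \<le> \<epsilon> * (\<Phi> (norm X) + \<Phi> (norm Y))
      + C * ((\<Phi> (norm X) + \<Phi> (norm Y)) / 2 - \<Phi> (norm ((X + Y) /\<^sub>R 2)))"
proof -
  define q where "q = 1 + a_minus a"
  have q: "q > 1" using a_minus_pos by (simp add: q_def)
  obtain \<kappa> where \<kappa>: "0 < \<kappa>" "\<kappa> \<le> 1"
    "\<And>X Y :: 'v. norm (X - Y) \<ge> \<epsilon> * max (norm X) (norm Y) \<Longrightarrow>
       norm ((X + Y) /\<^sub>R 2) \<le> (1 - \<kappa>) * pmean q (norm X) (norm Y)"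
    using norm_midpoint_uniform[OF q assms(1), where ?'v = 'v] by blast
  define C where "C = 2 * Kq / \<kappa>"
  have C: "C \<ge> 0" using Kq_ge_1 \<kappa> by (simp add: C_def)
  show thesis
  proof (rule that[OF C])
    fix X Y :: 'v
    define S where "S = \<Phi> (norm X) + \<Phi> (norm Y)"
    define D where "D = S / 2 - \<Phi> (norm ((X + Y) /\<^sub>R 2))"
    have S: "S \<ge> 0" by (simp add: S_def Phi_nonneg)
    have D: "D \<ge> 0" using Phi_midpoint_convex[of X Y] by (simp add: D_def S_def)
    have "\<Phi> (norm (X - Y)) \<le> \<epsilon> * S + C * D"
    proof (cases "norm (X - Y) \<ge> \<epsilon> * max (norm X) (norm Y)")
      case True
      have "\<Phi> (norm ((X + Y) /\<^sub>R 2)) \<le> \<Phi> ((1 - \<kappa>) * pmean q (norm X) (norm Y))"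
        using \<kappa>(3)[OF True] by (intro Phi_mono) auto
      also have "\<dots> \<le> (1 - \<kappa>) * \<Phi> (pmean q (norm X) (norm Y))"
        using \<kappa> by (intro Phi_scale_le_1) auto
      also have "\<dots> \<le> (1 - \<kappa>) * (S / 2)"
        using Phi_pmean[of "norm X" "norm Y"] \<kappa> by (intro mult_left_mono) (auto simp: q_def S_def)
      finally have "\<kappa> * S \<le> 2 * D" by (simp add: D_def algebra_simps)
      then have "Kq * S \<le> C * D"
        using \<kappa> Kq_ge_1 mult_left_mono[of "\<kappa> * S" "2 * D" Kq] by (simp add: C_def field_simps)
      moreover have "\<Phi> (norm (X - Y)) \<le> Kq * S"
        unfolding S_def by (rule Phi_norm_diff)
      moreover have "\<epsilon> * S \<ge> 0" using S assms by simp
      ultimately show ?thesis by linarith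
    next
      case False
      have "\<Phi> (norm (X - Y)) \<le> \<Phi> (\<epsilon> * max (norm X) (norm Y))"
        using False by (intro Phi_mono) auto
      also have "\<dots> \<le> \<epsilon> * \<Phi> (max (norm X) (norm Y))"
        using assms by (intro Phi_scale_le_1) auto
      also have "\<dots> \<le> \<epsilon> * S"
        using assms Phi_nonneg[of "norm X"] Phi_nonneg[of "norm Y"]
        by (intro mult_left_mono) (auto simp: S_def max_def)
      finally show ?thesis using C D by (simp add: add_increasing2)
    qed
    then show "\<Phi> (norm (X - Y)) \<le> \<epsilon> * (\<Phi> (norm X) + \<Phi> (norm Y))
      + C * ((\<Phi> (norm X) + \<Phi> (norm Y)) / 2 - \<Phi> (norm ((X + Y) /\<^sub>R 2)))"
      by (simp add: S_def D_def)
  qed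
qed

end

section \<open>Integration by parts and weak gradients\<close>

lemma continuous_compact_support_integrable:
  fixes f :: "'a::euclidean_space \<Rightarrow> 'b::{banach, second_countable_topology}"
  assumes "continuous_on UNIV f" "compact K" "\<And>x. x \<notin> K \<Longrightarrow> f x = 0"
  shows "integrable lborel f"
proof -
  have "(\<lambda>x. indicator K x *\<^sub>R f x) = f"
    using assms(3) by (auto simp: indicator_def fun_eq_iff)
  then show ?thesis
    using borel_integrable_compact[OF assms(2) continuous_on_subset[OF assms(1)]] by simp
qed

text \<open>By translation invariance every difference quotient in direction \<open>e\<close> has
  integral 0. The quotients converge to the partial derivative and are dominated because
  \<open>f\<close> is Lipschitz with compact support.\<close>

lemma integral_partial_derivative_0:
  assumes "C1_compact K f"
  shows "(\<integral>x. grad f x $ i \<partial>lborel) = 0"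
proof -
  define e :: "real^'a" where "e = axis i 1"
  have e: "norm e = 1" by (simp add: e_def)
  have d: "(f has_derivative (\<lambda>v. grad f x \<bullet> v)) (at x)" for x
    using assms by (simp add: C1_compact_def)
  have K: "compact K" "\<And>x. x \<notin> K \<Longrightarrow> f x = 0" and gc: "continuous_on UNIV (grad f)"
    using assms by (auto simp: C1_compact_def)
  have fc: "continuous_on UNIV f" by (rule C1_compact_continuous[OF assms])
  have fi: "integrable lborel f"
    by (rule continuous_compact_support_integrable[OF fc K])
  have shift: "integrable lborel (\<lambda>x. f (c + x))" "(\<integral>x. f (c + x) \<partial>lborel) = (\<integral>x. f x \<partial>lborel)" for c
    using integrable_distr_eq[of "(+) c" lborel borel f] integral_distr[of "(+) c" lborel borel f] fi
    by (auto simp: lborel_distr_plus borel_measurable_continuous_onI[OF fc])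
  have "\<exists>B>0. \<forall>x. norm (grad f x) \<le> B"
    by (rule continuous_compact_support_bounded[OF gc K(1)])
      (use C1_compact_grad_outside[OF assms] in auto)
  then obtain B where B: "B > 0" "\<And>x. norm (grad f x) \<le> B"
    by auto
  have lip: "\<bar>f x - f y\<bar> \<le> B * norm (x - y)" for x y
  proof -
    have "onorm (\<lambda>v. grad f z \<bullet> v) \<le> B" for z
    proof (rule onorm_bound)
      show "norm (grad f z \<bullet> v) \<le> B * norm v" for v
        using Cauchy_Schwarz_ineq2[of "grad f z" v] mult_right_mono[OF B(2)[of z] norm_ge_zero[of v]]
        by simp
    qed (use B in simp)
    then show ?thesis
      using differentiable_bound[OF convex_UNIV has_derivative_at_withinI[OF d]] by auto
  qed
  obtain R where R: "R > 0" "K \<subseteq> cball 0 R"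
    using compact_imp_bounded[OF K(1)] by (auto simp: bounded_pos subset_iff)
  define t where "t = (\<lambda>n. 1 / real (Suc n))"
  have t: "t n > 0" "t n \<le> 1" for n by (auto simp: t_def)
  define D where "D = (\<lambda>n x. (f (t n *\<^sub>R e + x) - f x) / t n)"
  have D0: "(\<integral>x. D n x \<partial>lborel) = 0" for n
    using shift[of "t n *\<^sub>R e"] fi by (simp add: D_def)
  have "(\<lambda>n. \<integral>x. D n x \<partial>lborel) \<longlonglongrightarrow> (\<integral>x. grad f x $ i \<partial>lborel)"
  \<comment> \<open>The radius exceeds that of the ball around the support by 1, an upper bound for
    the shifts \<open>t n\<close>.\<close>
  proof (rule integral_dominated_convergence[where w = "\<lambda>x. B * indicat_real (cball 0 (R + 1)) x"])
    show "(\<lambda>x. grad f x $ i) \<in> borel_measurable lborel"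
      using borel_measurable_continuous_onI[OF continuous_on_component[OF gc]] by simp
    show "D n \<in> borel_measurable lborel" for n
      unfolding D_def using borel_measurable_integrable[OF shift(1)] borel_measurable_integrable[OF fi]
      by measurable
    show "integrable lborel (\<lambda>x::real^'a. B * indicat_real (cball 0 (R + 1)) x)"
      using borel_integrable_compact[of "cball (0::real^'a) (R + 1)" "\<lambda>x. B"]
      by (simp add: mult.commute continuous_on_const)
    show "AE x in lborel. (\<lambda>n. D n x) \<longlonglongrightarrow> grad f x $ i"
    proof (intro AE_I2)
      fix x
      have "((\<lambda>h. f (x + h *\<^sub>R e)) has_derivative (\<lambda>h. grad f x \<bullet> (h *\<^sub>R e))) (at 0)"
        by (rule has_derivative_compose[of "\<lambda>h. x + h *\<^sub>R e" "\<lambda>h. h *\<^sub>R e"])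
          (use d[of x] in \<open>auto intro!: derivative_eq_intros\<close>)
      moreover have "(\<lambda>h. grad f x \<bullet> (h *\<^sub>R e)) = (*) (grad f x $ i)"
        by (auto simp: fun_eq_iff e_def inner_axis mult.commute)
      ultimately have "((\<lambda>h. f (x + h *\<^sub>R e)) has_real_derivative grad f x $ i) (at 0)"
        by (simp add: has_field_derivative_def)
      then have "((\<lambda>h. (f (x + h *\<^sub>R e) - f x) / h) \<longlongrightarrow> grad f x $ i) (at 0)"
        by (simp add: DERIV_def)
      moreover have "filterlim t (at 0) sequentially"
        unfolding t_def by real_asymp
      ultimately have "((\<lambda>n. (f (x + t n *\<^sub>R e) - f x) / t n) \<longlongrightarrow> grad f x $ i) sequentially"
        by (rule filterlim_compose)
      then show "(\<lambda>n. D n x) \<longlonglongrightarrow> grad f x $ i"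
        by (simp add: D_def add.commute)
    qed
    show "AE x in lborel. norm (D n x) \<le> B * indicat_real (cball 0 (R + 1)) x" for n
    proof (intro AE_I2)
      fix x
      show "norm (D n x) \<le> B * indicat_real (cball 0 (R + 1)) x"
      proof (cases "x \<in> cball 0 (R + 1)")
        case True
        then show ?thesis
          using lip[of "t n *\<^sub>R e + x" x] t[of n] e by (simp add: D_def divide_le_eq)
      next
        case False
        then have "norm x > R + 1" by simp
        moreover have "norm x \<le> norm (t n *\<^sub>R e + x) + norm (t n *\<^sub>R e)"
          by (metis add_diff_cancel_left' norm_triangle_ineq4 add.commute)
        ultimately have "x \<notin> K" "t n *\<^sub>R e + x \<notin> K"
          using R e t[of n] by (auto dest!: subsetD)
        then show ?thesis using K(2) False by (simp add: D_def)
      qed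
    qed
  qed
  then show ?thesis
    using D0 by (simp add: LIMSEQ_const_iff)
qed

lemma C1_compact_mult:
  assumes "C1_compact K f" "\<And>x. (g has_derivative (\<lambda>v. G x \<bullet> v)) (at x)" "continuous_on UNIV G"
  shows "C1_compact K (\<lambda>x. f x * g x)" "grad (\<lambda>x. f x * g x) = (\<lambda>x. f x *\<^sub>R G x + g x *\<^sub>R grad f x)"
proof -
  have "((\<lambda>x. f x * g x) has_derivative (\<lambda>v. (f x *\<^sub>R G x + g x *\<^sub>R grad f x) \<bullet> v)) (at x)" for x
    using has_derivative_mult[of f "\<lambda>v. grad f x \<bullet> v" x UNIV g "\<lambda>v. G x \<bullet> v"] assms(1) assms(2)[of x]
    by (simp add: C1_compact_def inner_add_left mult.commute)
  moreover have "continuous_on UNIV (\<lambda>x. f x *\<^sub>R G x + g x *\<^sub>R grad f x)"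
    using assms C1_compact_continuous[OF assms(1)] has_derivative_continuous_on[OF has_derivative_at_withinI[OF assms(2)]]
    by (intro continuous_intros) (auto simp: C1_compact_def)
  moreover have "compact K" "\<And>x. x \<notin> K \<Longrightarrow> f x * g x = 0"
    using assms(1) by (auto simp: C1_compact_def)
  ultimately show "C1_compact K (\<lambda>x. f x * g x)" "grad (\<lambda>x. f x * g x) = (\<lambda>x. f x *\<^sub>R G x + g x *\<^sub>R grad f x)"
    using C1_compactI[of K "\<lambda>x. f x * g x" "\<lambda>x. f x *\<^sub>R G x + g x *\<^sub>R grad f x"] by auto
qed

lemma integration_by_parts:
  assumes "C1_compact K f" "C1_compact L g"
  shows "(\<integral>x. f x * (grad g x $ i) \<partial>lborel) = - (\<integral>x. grad f x $ i * g x \<partial>lborel)"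
proof -
  have g: "\<And>x. (g has_derivative (\<lambda>v. grad g x \<bullet> v)) (at x)" "continuous_on UNIV (grad g)"
    using assms(2) by (auto simp: C1_compact_def)
  note m = C1_compact_mult[OF assms(1) g]
  have f: "compact K" "continuous_on UNIV f" "continuous_on UNIV (grad f)" "\<And>x. x \<notin> K \<Longrightarrow> f x = 0"
    using assms(1) C1_compact_continuous by (auto simp: C1_compact_def)
  have gc: "continuous_on UNIV g" using assms(2) by (rule C1_compact_continuous)
  have i1: "integrable lborel (\<lambda>x. f x * (grad g x $ i))"
    by (rule continuous_compact_support_integrable[OF _ f(1)]) (use f g in \<open>auto intro!: continuous_intros\<close>)
  have i2: "integrable lborel (\<lambda>x. grad f x $ i * g x)"
    by (rule continuous_compact_support_integrable[OF _ f(1)])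
      (use f gc C1_compact_grad_outside[OF assms(1)] in \<open>auto intro!: continuous_intros\<close>)
  have "0 = (\<integral>x. f x * (grad g x $ i) + grad f x $ i * g x \<partial>lborel)"
    using integral_partial_derivative_0[OF m(1), of i] by (simp add: m(2) mult.commute)
  also have "\<dots> = (\<integral>x. f x * (grad g x $ i) \<partial>lborel) + (\<integral>x. grad f x $ i * g x \<partial>lborel)"
    by (rule Bochner_Integration.integral_add[OF i1 i2])
  finally show ?thesis by linarith
qed

section \<open>Lebesgue measure on a domain and the fundamental lemma of the calculus of
  variations\<close>

lemma lebesgue_on_lborel:
  fixes f :: "'a::euclidean_space \<Rightarrow> 'b::{banach, second_countable_topology}"
  assumes "f \<in> borel_measurable borel" "\<And>x. x \<notin> \<Omega> \<Longrightarrow> f x = 0" "\<Omega> \<in> sets lebesgue"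
  shows "integrable (lebesgue_on \<Omega>) f \<longleftrightarrow> integrable lborel f"
    "integral\<^sup>L (lebesgue_on \<Omega>) f = integral\<^sup>L lborel f"
proof -
  have "(\<lambda>x. indicator \<Omega> x *\<^sub>R f x) = f"
    using assms(2) by (auto simp: indicator_def fun_eq_iff)
  then show "integrable (lebesgue_on \<Omega>) f \<longleftrightarrow> integrable lborel f"
    "integral\<^sup>L (lebesgue_on \<Omega>) f = integral\<^sup>L lborel f"
    using assms by (simp_all add: integrable_restrict_space integral_restrict_space
        integrable_completion integral_completion)
qed

text \<open>Boxes are an intersection-stable generator of the Borel sets, so vanishing integrals
  spread to all Borel sets by the Dynkin argument, and a function whose integral over every Borel
  set is 0 vanishes almost everywhere.\<close>

lemma integral_boxes_0_imp_AE_0: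
  fixes h :: "'a::euclidean_space \<Rightarrow> real"
  assumes h: "integrable lborel h" and box: "\<And>c d. (LINT x:box c d|lborel. h x) = 0"
  shows "AE x in lborel. h x = 0"
proof (rule density_unique_real[OF h])
  let ?G = "range (\<lambda>(c, d). box c d :: 'a set)"
  have si: "set_integrable lborel A h" if "A \<in> sets borel" for A
    using h that unfolding set_integrable_def by (intro integrable_mult_indicator) auto
  have sg: "sigma_sets UNIV ?G = sets borel"
    by (subst borel_eq_box) simp
  \<comment> \<open>The integral over the whole space is needed for complements; it is the limit
    over growing boxes.\<close>
  have U: "(\<integral>x. h x \<partial>lborel) = 0"
  proof -
    define A where "A = (\<lambda>n::nat. box (- real n *\<^sub>R One) (real n *\<^sub>R One) :: 'a set)"
    have "(\<lambda>n. \<integral>x. indicat_real (A n) x * h x \<partial>lborel) \<longlonglongrightarrow> (\<integral>x. h x \<partial>lborel)"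
    proof (rule integral_dominated_convergence[where w = "\<lambda>x. \<bar>h x\<bar>"])
      show "AE x in lborel. (\<lambda>n. indicat_real (A n) x * h x) \<longlonglongrightarrow> h x"
      proof (intro AE_I2)
        fix x :: 'a
        have "incseq A"
          unfolding incseq_def A_def by (auto simp: subset_box inner_simps)
        then have "(\<lambda>n. indicat_real (A n) x) \<longlonglongrightarrow> indicat_real (\<Union>n. A n) x"
          by (rule LIMSEQ_indicator_incseq)
        then have "(\<lambda>n. indicat_real (A n) x) \<longlonglongrightarrow> 1"
          by (simp add: A_def UN_box_eq_UNIV)
        from tendsto_mult[OF this tendsto_const] show "(\<lambda>n. indicat_real (A n) x * h x) \<longlonglongrightarrow> h x"
          by simp
      qed
      show "AE x in lborel. norm (indicat_real (A n) x * h x) \<le> \<bar>h x\<bar>" for n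
        by (intro AE_I2) (auto simp: indicator_def)
    qed (use h in \<open>auto simp: A_def\<close>)
    moreover have "(\<integral>x. indicat_real (A n) x * h x \<partial>lborel) = 0" for n
      using box unfolding set_lebesgue_integral_def A_def by simp
    ultimately show ?thesis by (simp add: LIMSEQ_const_iff)
  qed
  fix A :: "'a set" assume "A \<in> sets lborel"
  then have G: "Int_stable ?G" "?G \<subseteq> Pow UNIV" "A \<in> sigma_sets UNIV ?G"
    using sg by (auto simp: Int_stable_def box_Int_box)
  then have "(LINT x:A|lborel. h x) = 0"
  proof (induction rule: sigma_sets_induct_disjoint)
    case (compl A)
    then have A: "A \<in> sets borel" using sg by simp
    have "(LINT x:UNIV - A|lborel. h x) = (\<integral>x. h x - indicat_real A x * h x \<partial>lborel)"
      unfolding set_lebesgue_integral_def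
      by (intro Bochner_Integration.integral_cong) (auto simp: indicator_def)
    also have "\<dots> = (\<integral>x. h x \<partial>lborel) - (LINT x:A|lborel. h x)"
      using si[OF A] h by (simp add: set_lebesgue_integral_def set_integrable_def)
    finally show ?case using U compl by simp
  next
    case (union A)
    then have A: "A i \<in> sets borel" for i using sg by auto
    have "(LINT x:(\<Union>i. A i)|lborel. h x) = (\<Sum>i. (LINT x:A i|lborel. h x))"
      using A union(1) by (intro lebesgue_integral_countable_add si) (auto simp: disjoint_family_on_def)
    then show ?case using union by simp
  qed (use box in \<open>auto simp: set_lebesgue_integral_def\<close>)
  then show "(LINT x:A|lborel. h x) = (LINT x:A|lborel. 0)"
    by (simp add: set_lebesgue_integral_def)
qed simp

lemma locally_integrable_times_test:
  assumes "open \<Omega>" "locally_integrable \<Omega> h" "\<psi> \<in> borel_measurable borel"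
    "compact K" "K \<subseteq> \<Omega>" "\<And>x. x \<notin> K \<Longrightarrow> \<psi> x = 0" "\<And>x. \<bar>\<psi> x\<bar> \<le> B"
  shows "integrable (lebesgue_on \<Omega>) (\<lambda>x. h x * \<psi> x)"
    "(\<integral>x. h x * \<psi> x \<partial>lebesgue_on \<Omega>) = (\<integral>x. (indicat_real K x * h x) * \<psi> x \<partial>lebesgue)"
proof -
  have K: "K \<in> sets lebesgue" and O: "\<Omega> \<in> sets lebesgue"
    using assms lmeasurable_compact[of K] by auto
  have "integrable (lebesgue_on K) h"
    using assms by (simp add: locally_integrable_def)
  then have i: "integrable lebesgue (\<lambda>x. indicat_real K x * h x)"
    using K by (simp add: integrable_restrict_space)
  have j: "integrable lebesgue (\<lambda>x. (indicat_real K x * h x) * \<psi> x)"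
  proof (rule Bochner_Integration.integrable_bound)
    show "integrable lebesgue (\<lambda>x. B * (indicat_real K x * h x))"
      using i by simp
    show "(\<lambda>x. (indicat_real K x * h x) * \<psi> x) \<in> borel_measurable lebesgue"
      by (rule borel_measurable_times[OF borel_measurable_integrable[OF i] measurable_completion])
        (use assms(3) in simp)
    show "AE x in lebesgue. norm ((indicat_real K x * h x) * \<psi> x) \<le> norm (B * (indicat_real K x * h x))"
    proof (intro AE_I2)
      fix x
      have "\<bar>\<psi> x\<bar> \<le> \<bar>B\<bar>" using assms(7)[of x] by linarith
      then show "norm ((indicat_real K x * h x) * \<psi> x) \<le> norm (B * (indicat_real K x * h x))"
        by (simp add: abs_mult mult.commute mult_right_mono)
    qed
  qed
  have e: "(\<lambda>x. indicat_real \<Omega> x *\<^sub>R (h x * \<psi> x)) = (\<lambda>x. (indicat_real K x * h x) * \<psi> x)"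
    using assms(5,6) by (auto simp: indicator_def fun_eq_iff)
  show "integrable (lebesgue_on \<Omega>) (\<lambda>x. h x * \<psi> x)"
    "(\<integral>x. h x * \<psi> x \<partial>lebesgue_on \<Omega>) = (\<integral>x. (indicat_real K x * h x) * \<psi> x \<partial>lebesgue)"
    using j O by (simp_all add: integrable_restrict_space integral_restrict_space e[unfolded real_scaleR_def])
qed

text \<open>Bumps of increasing sharpness converge to the indicator of a box, so testing with them
  makes the integral of \<open>h\<close> over every box inside \<open>cbox a b\<close> vanish. The
  closed box is compact, which is what local integrability asks for.\<close>

lemma fundamental_lemma_cbox:
  fixes h :: "real^'n \<Rightarrow> real"
  assumes "open \<Omega>" "locally_integrable \<Omega> h" "cbox a b \<subseteq> \<Omega>"
    and zero: "\<And>\<psi>. \<psi> \<in> test_functions \<Omega> \<Longrightarrow> (\<integral>x. h x * \<psi> x \<partial>lebesgue_on \<Omega>) = 0"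
  shows "AE x in lebesgue. x \<in> cbox a b \<longrightarrow> h x = 0"
proof -
  define H where "H = (\<lambda>x. indicat_real (cbox a b) x * h x)"
  have "integrable (lebesgue_on (cbox a b)) h"
    using assms by (simp add: locally_integrable_def)
  then have Hi: "integrable lebesgue H"
    by (simp add: integrable_restrict_space H_def)
  \<comment> \<open>\<open>H\<close> lives on the closed box while the bumps fill open boxes; the
    boundary between the two is a null set.\<close>
  have null: "AE x in lebesgue. x \<notin> cbox a b - box a b"
  proof -
    have "cbox a b - box a b \<in> null_sets lebesgue"
      using negligible_frontier_interval[of a b] by (simp add: negligible_iff_null_sets)
    then show ?thesis by (rule AE_not_in)
  qed
  have box: "(\<integral>x. indicat_real (box c d) x * H x \<partial>lebesgue) = 0" for c d
  proof -
    obtain c' d' where cd: "box c d \<inter> box a b = box c' d'"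
      using box_Int_box by blast
    have "(\<integral>x. indicat_real (box c d) x * H x \<partial>lebesgue)
        = (\<integral>x. H x * indicat_real (box c' d') x \<partial>lebesgue)"
    proof (rule integral_cong_AE)
      show "(\<lambda>x. indicat_real (box c d) x * H x) \<in> borel_measurable lebesgue"
        "(\<lambda>x. H x * indicat_real (box c' d') x) \<in> borel_measurable lebesgue"
        by (intro borel_measurable_times borel_measurable_integrable[OF Hi] borel_measurable_indicator; simp)+
      show "AE x in lebesgue. indicat_real (box c d) x * H x = H x * indicat_real (box c' d') x"
        using null by eventually_elim (auto simp: H_def indicator_def cd[symmetric])
    qed
    also have "\<dots> = 0"
    proof (cases "box c' d' = {}")
      case False
      then have "cbox c' d' = closure (box c' d')" by simp
      also have "\<dots> \<subseteq> closure (cbox a b)"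
        using cd box_subset_cbox by (intro closure_mono) blast
      finally have sub: "cbox c' d' \<subseteq> cbox a b" by simp
      have "(\<lambda>n. \<integral>x. H x * bump n c' d' x \<partial>lebesgue) \<longlonglongrightarrow> (\<integral>x. H x * indicat_real (box c' d') x \<partial>lebesgue)"
      proof (rule integral_dominated_convergence[where w = "\<lambda>x. \<bar>H x\<bar>"])
        show "(\<lambda>x. H x * bump n c' d' x) \<in> borel_measurable lebesgue" for n
        proof (rule borel_measurable_times[OF borel_measurable_integrable[OF Hi] measurable_completion])
          have "continuous_on UNIV (bump n c' d')"
            using Ck_on_bump[of 0 n c' d'] by simp
          then show "bump n c' d' \<in> borel_measurable lborel"
            using borel_measurable_continuous_onI by simp
        qed
        show "(\<lambda>x. H x * indicat_real (box c' d') x) \<in> borel_measurable lebesgue"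
          by (intro borel_measurable_times borel_measurable_integrable[OF Hi] borel_measurable_indicator; simp)
        show "AE x in lebesgue. (\<lambda>n. H x * bump n c' d' x) \<longlonglongrightarrow> H x * indicat_real (box c' d') x"
          by (intro AE_I2 tendsto_mult tendsto_const bump_tendsto)
        show "AE x in lebesgue. norm (H x * bump n c' d' x) \<le> \<bar>H x\<bar>" for n
          using bump_bounds[of n c' d'] by (intro AE_I2) (simp add: abs_mult mult_left_le)
      qed (use Hi in auto)
      moreover have "(\<integral>x. H x * bump n c' d' x \<partial>lebesgue) = 0" for n
      proof -
        have t: "bump n c' d' \<in> test_functions \<Omega>"
          using sub assms(3) by (intro test_function_bump) auto
        have "continuous_on UNIV (bump n c' d')"
          using Ck_on_bump[of 0 n c' d'] by simp
        then have m: "bump n c' d' \<in> borel_measurable borel"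
          by (rule borel_measurable_continuous_onI)
        have z: "bump n c' d' x = 0" if "x \<notin> cbox a b" for x
          using that sub box_subset_cbox by (intro bump_eq_0) blast
        have "\<bar>bump n c' d' x\<bar> \<le> 1" for x
          using bump_bounds[of n c' d' x] by simp
        from locally_integrable_times_test(2)[OF assms(1,2) m compact_cbox assms(3) z this]
        show ?thesis
          using zero[OF t] by (simp add: H_def)
      qed
      ultimately show ?thesis by (simp add: LIMSEQ_const_iff)
    qed simp
    finally show ?thesis .
  qed
  \<comment> \<open>The box criterion is stated for \<open>lborel\<close>, so \<open>H\<close> is
    replaced by a Borel function equal to it almost everywhere.\<close>
  obtain H' where H': "H' \<in> borel_measurable lborel" "AE x in lborel. H x = H' x"
    using completion_ex_borel_measurable_real[of H lborel] Hi by auto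
  have ae: "AE x in lebesgue. H x = H' x"
    using H'(2) by (simp add: AE_completion)
  have H'm: "H' \<in> borel_measurable lebesgue"
    using H'(1) by (rule measurable_completion)
  have "integrable lebesgue H'"
    using integrable_cong_AE[OF borel_measurable_integrable[OF Hi] H'm ae] Hi by simp
  then have H'i: "integrable lborel H'"
    using integrable_completion[OF H'(1)] by simp
  have "AE x in lborel. H' x = 0"
  proof (rule integral_boxes_0_imp_AE_0[OF H'i])
    fix c d :: "real^'n"
    have m: "(\<lambda>x. indicat_real (box c d) x * H' x) \<in> borel_measurable lborel"
      using H'(1) by (intro borel_measurable_times) auto
    have "(LINT x:box c d|lborel. H' x) = (\<integral>x. indicat_real (box c d) x * H' x \<partial>lebesgue)"
      by (simp add: set_lebesgue_integral_def integral_completion[OF m])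
    also have "\<dots> = (\<integral>x. indicat_real (box c d) x * H x \<partial>lebesgue)"
    proof (rule integral_cong_AE)
      show "AE x in lebesgue. indicat_real (box c d) x * H' x = indicat_real (box c d) x * H x"
        using ae by eventually_elim simp
      show "(\<lambda>x. indicat_real (box c d) x * H' x) \<in> borel_measurable lebesgue"
        using m by (rule measurable_completion)
      show "(\<lambda>x. indicat_real (box c d) x * H x) \<in> borel_measurable lebesgue"
        by (intro borel_measurable_times borel_measurable_integrable[OF Hi] borel_measurable_indicator; simp)
    qed
    finally show "(LINT x:box c d|lborel. H' x) = 0" using box by simp
  qed
  then have "AE x in lebesgue. H' x = 0" by (simp add: AE_completion)
  with ae show ?thesis
    by eventually_elim (auto simp: H_def indicator_def)
qed

text \<open>An open set is a countable union of closed boxes, so the exceptional null sets of the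
  local statement can be united.\<close>

lemma fundamental_lemma:
  fixes h :: "real^'n \<Rightarrow> real"
  assumes "open \<Omega>" "locally_integrable \<Omega> h"
    and zero: "\<And>\<psi>. \<psi> \<in> test_functions \<Omega> \<Longrightarrow> (\<integral>x. h x * \<psi> x \<partial>lebesgue_on \<Omega>) = 0"
  shows "AE x in lebesgue_on \<Omega>. h x = 0"
proof -
  obtain D where D: "countable D" "D \<subseteq> Pow \<Omega>" "\<And>X. X \<in> D \<Longrightarrow> \<exists>a b. X = cbox a b" "\<Union>D = \<Omega>"
    using open_countable_Union_open_cbox[OF assms(1)] by metis
  have "AE x in lebesgue. \<forall>X\<in>D. x \<in> X \<longrightarrow> h x = 0"
  proof (rule AE_ball_countable[THEN iffD2, OF D(1)], rule ballI)
    fix X assume X: "X \<in> D"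
    obtain a b where "X = cbox a b" using D(3)[OF X] by auto
    then show "AE x in lebesgue. x \<in> X \<longrightarrow> h x = 0"
      using fundamental_lemma_cbox[OF assms(1,2) _ zero, of a b] X D(2) by auto
  qed
  then have "AE x in lebesgue. x \<in> \<Omega> \<longrightarrow> h x = 0"
    by eventually_elim (use D(4) in auto)
  then show ?thesis
    using assms(1) by (simp add: AE_restrict_space_iff)
qed

section \<open>Uniqueness of weak gradients and the Poincare inequality\<close>

lemma C1_compact_borel:
  assumes "C1_compact K f"
  shows "f \<in> borel_measurable borel" "grad f \<in> borel_measurable borel"
    "(\<lambda>x. grad f x $ i) \<in> borel_measurable borel"
proof -
  show "f \<in> borel_measurable borel"
    using C1_compact_continuous[OF assms] by (rule borel_measurable_continuous_onI)
  have c: "continuous_on UNIV (grad f)" using assms by (simp add: C1_compact_def)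
  show "grad f \<in> borel_measurable borel"
    using c by (rule borel_measurable_continuous_onI)
  show "(\<lambda>x. grad f x $ i) \<in> borel_measurable borel"
    by (rule borel_measurable_continuous_onI[OF continuous_on_component[OF c]])
qed

lemma test_function_bounded:
  assumes "\<psi> \<in> test_functions \<Omega>"
  obtains B where "\<And>x. \<bar>\<psi> x\<bar> \<le> B" "\<And>x. norm (grad \<psi> x) \<le> B"
proof -
  obtain K where K: "C1_compact K \<psi>" using assms by (rule test_function_C1)
  then have K': "compact K" "\<And>x. x \<notin> K \<Longrightarrow> \<psi> x = 0" "\<And>x. x \<notin> K \<Longrightarrow> grad \<psi> x = 0"
    "continuous_on UNIV \<psi>" "continuous_on UNIV (grad \<psi>)"
    using C1_compact_grad_outside[OF K] C1_compact_continuous[OF K] by (auto simp: C1_compact_def)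
  have "\<exists>B>0. \<forall>x. norm (\<psi> x) \<le> B"
    by (rule continuous_compact_support_bounded[OF K'(4,1)]) (use K' in auto)
  moreover have "\<exists>B>0. \<forall>x. norm (grad \<psi> x) \<le> B"
    by (rule continuous_compact_support_bounded[OF K'(5,1)]) (use K' in auto)
  ultimately obtain B C where "\<And>x. \<bar>\<psi> x\<bar> \<le> B" "\<And>x. norm (grad \<psi> x) \<le> C" by auto
  then show thesis by (intro that[of "max B C"]) (auto simp: le_max_iff_disj)
qed

lemma locally_integrable_times_test_function:
  assumes "open \<Omega>" "locally_integrable \<Omega> h" "\<psi> \<in> test_functions \<Omega>"
  shows "integrable (lebesgue_on \<Omega>) (\<lambda>x. h x * \<psi> x)"
    "integrable (lebesgue_on \<Omega>) (\<lambda>x. h x * grad \<psi> x $ i)"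
proof -
  obtain K where K: "C1_compact K \<psi>" "K \<subseteq> \<Omega>" using assms(3) by (rule test_function_C1)
  then have K': "compact K" "\<And>x. x \<notin> K \<Longrightarrow> \<psi> x = 0" "\<And>x. x \<notin> K \<Longrightarrow> grad \<psi> x $ i = 0"
    using C1_compact_grad_outside[OF K(1)] by (auto simp: C1_compact_def)
  obtain B where B: "\<And>x. \<bar>\<psi> x\<bar> \<le> B" "\<And>x. norm (grad \<psi> x) \<le> B"
    using assms(3) by (rule test_function_bounded) blast
  then have B': "\<bar>grad \<psi> x $ i\<bar> \<le> B" for x
    using component_le_norm_cart order_trans by blast
  show "integrable (lebesgue_on \<Omega>) (\<lambda>x. h x * \<psi> x)"
    by (rule locally_integrable_times_test(1)
        [OF assms(1,2) C1_compact_borel(1)[OF K(1)] K'(1) K(2) K'(2) B(1)])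
  show "integrable (lebesgue_on \<Omega>) (\<lambda>x. h x * grad \<psi> x $ i)"
    by (rule locally_integrable_times_test(1)
        [OF assms(1,2) C1_compact_borel(3)[OF K(1)] K'(1) K(2) K'(3) B'])
qed

lemma is_weak_gradient_diff:
  fixes u v :: "real^'n \<Rightarrow> real"
  assumes "open \<Omega>" "is_weak_gradient \<Omega> u g" "is_weak_gradient \<Omega> v h"
  shows "is_weak_gradient \<Omega> (\<lambda>x. u x - v x) (\<lambda>x. g x - h x)"
  unfolding is_weak_gradient_def
proof (intro conjI allI ballI)
  have l: "locally_integrable \<Omega> u" "locally_integrable \<Omega> v"
    "\<And>i. locally_integrable \<Omega> (\<lambda>x. g x $ i)" "\<And>i. locally_integrable \<Omega> (\<lambda>x. h x $ i)"
    using assms by (auto simp: is_weak_gradient_def)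
  show "locally_integrable \<Omega> (\<lambda>x. u x - v x)" "locally_integrable \<Omega> (\<lambda>x. (g x - h x) $ i)" for i
    using l by (auto simp: locally_integrable_def)
  fix i \<psi> assume t: "\<psi> \<in> test_functions \<Omega>"
  note int = locally_integrable_times_test_function[OF assms(1) _ t]
  have "(\<integral>x. u x * grad \<psi> x $ i \<partial>lebesgue_on \<Omega>) = - (\<integral>x. g x $ i * \<psi> x \<partial>lebesgue_on \<Omega>)"
    "(\<integral>x. v x * grad \<psi> x $ i \<partial>lebesgue_on \<Omega>) = - (\<integral>x. h x $ i * \<psi> x \<partial>lebesgue_on \<Omega>)"
    using assms(2,3) t by (auto simp: is_weak_gradient_def grad_def)
  then have "(\<integral>x. (u x - v x) * grad \<psi> x $ i \<partial>lebesgue_on \<Omega>)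
      = - (\<integral>x. (g x - h x) $ i * \<psi> x \<partial>lebesgue_on \<Omega>)"
    using int(1)[OF l(3)] int(1)[OF l(4)] int(2)[OF l(1)] int(2)[OF l(2)] by (simp add: left_diff_distrib)
  then show "(\<integral>x. (u x - v x) * frechet_derivative \<psi> (at x) (axis i 1) \<partial>lebesgue_on \<Omega>)
      = - (\<integral>x. (g x - h x) $ i * \<psi> x \<partial>lebesgue_on \<Omega>)"
    by (simp add: grad_def)
qed

text \<open>The difference of the gradients is a weak gradient of a function that is zero almost
  everywhere, so the fundamental lemma applies to each component.\<close>

lemma weak_gradient_unique:
  fixes u v :: "real^'n \<Rightarrow> real"
  assumes "open \<Omega>" "is_weak_gradient \<Omega> u g" "is_weak_gradient \<Omega> v h"
    "AE x in lebesgue_on \<Omega>. u x = v x"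
  shows "AE x in lebesgue_on \<Omega>. g x = h x"
proof -
  have D: "is_weak_gradient \<Omega> (\<lambda>x. u x - v x) (\<lambda>x. g x - h x)"
    by (rule is_weak_gradient_diff[OF assms(1-3)])
  have "AE x in lebesgue_on \<Omega>. (g x - h x) $ i = 0" for i
  proof (rule fundamental_lemma[OF assms(1)])
    show "locally_integrable \<Omega> (\<lambda>x. (g x - h x) $ i)"
      using D by (simp add: is_weak_gradient_def)
    fix \<psi> assume t: "\<psi> \<in> test_functions \<Omega>"
    have "(\<integral>x. (u x - v x) * grad \<psi> x $ i \<partial>lebesgue_on \<Omega>) = 0"
      by (rule integral_eq_zero_AE) (use assms(4) in eventually_elim, simp)
    then show "(\<integral>x. (g x - h x) $ i * \<psi> x \<partial>lebesgue_on \<Omega>) = 0"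
      using D t by (simp add: is_weak_gradient_def grad_def)
  qed
  then have "AE x in lebesgue_on \<Omega>. \<forall>i\<in>UNIV. (g x - h x) $ i = 0"
    by (intro AE_finite_allI) auto
  then show ?thesis
    by eventually_elim (simp add: vec_eq_iff)
qed

lemma is_weak_gradient_weak_gradient:
  "is_weak_gradient \<Omega> u g \<Longrightarrow> is_weak_gradient \<Omega> u (weak_gradient \<Omega> u)"
  unfolding weak_gradient_def by (rule someI[where P = "is_weak_gradient \<Omega> u"])

lemma weak_gradient_eq:
  assumes "open \<Omega>" "is_weak_gradient \<Omega> u g"
  shows "AE x in lebesgue_on \<Omega>. weak_gradient \<Omega> u x = g x"
  by (rule weak_gradient_unique[OF assms(1) is_weak_gradient_weak_gradient[OF assms(2)] assms(2)]) simp

text \<open>The derivative of \<open>x $ i * \<Phi> (\<psi> x)\<close> in direction \<open>i\<close>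
  has integral 0, which expresses the integral of \<open>\<Phi> (\<psi> x)\<close> by that of
  \<open>- x $ i * \<phi> (\<psi> x) * grad \<psi> x $ i\<close>. On the bounded domain the
  coordinate is at most \<open>R\<close>, and Young's inequality with \<open>1 / (2 * R)\<close>
  lets half of the left-hand side be absorbed.\<close>

lemma (in N_function) poincare_C1:
  assumes "C1_compact K \<psi>" "K \<subseteq> \<Omega>" "\<And>x. x \<in> \<Omega> \<Longrightarrow> norm x \<le> R" "R > 0"
    and C: "\<And>s t. 0 \<le> s \<Longrightarrow> 0 \<le> t \<Longrightarrow> \<phi> s * t \<le> 1 / (2 * R) * \<Phi> s + C * \<Phi> t"
  shows "(\<integral>x. \<Phi> (\<psi> x) \<partial>lborel) \<le> 2 * R * C * (\<integral>x. \<Phi> (norm (grad \<psi> x)) \<partial>lborel)"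
    "integrable lborel (\<lambda>x. \<Phi> (\<psi> x))" "integrable lborel (\<lambda>x. \<Phi> (norm (grad \<psi> x)))"
proof -
  \<comment> \<open>Any single coordinate will do; one exists because the index type is
    nonempty.\<close>
  fix i :: 'a
  have K: "compact K" "\<And>x. x \<notin> K \<Longrightarrow> \<psi> x = 0" "continuous_on UNIV (grad \<psi>)"
    "\<And>x. x \<notin> K \<Longrightarrow> grad \<psi> x = 0"
    using assms(1) C1_compact_grad_outside[OF assms(1)] by (auto simp: C1_compact_def)
  have c: "continuous_on UNIV \<psi>" by (rule C1_compact_continuous[OF assms(1)])
  have cF: "continuous_on UNIV (\<lambda>x. \<Phi> (\<psi> x))" "continuous_on UNIV (\<lambda>x. \<Phi> (norm (grad \<psi> x)))"
    "continuous_on UNIV (\<lambda>x. \<phi> (\<psi> x))"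
    using c K(3) continuous_on_compose2[OF Phi_continuous[of UNIV]] continuous_on_compose2[OF phi_continuous]
    by (auto intro!: continuous_on_norm)
  show i1: "integrable lborel (\<lambda>x. \<Phi> (\<psi> x))" and i2: "integrable lborel (\<lambda>x. \<Phi> (norm (grad \<psi> x)))"
    by (rule continuous_compact_support_integrable[OF _ K(1)]; use cF K in simp)+
  have d: "((\<lambda>x. \<Phi> (\<psi> x)) has_derivative (\<lambda>v. (\<phi> (\<psi> x) *\<^sub>R grad \<psi> x) \<bullet> v)) (at x)" for x
    using has_derivative_compose_real[where h = \<Phi> and f = \<psi>, OF Phi_has_derivative]
      assms(1) by (auto simp: C1_compact_def)
  have "continuous_on UNIV (\<lambda>x. \<phi> (\<psi> x) *\<^sub>R grad \<psi> x)"
    using cF K by (intro continuous_intros) auto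
  then have F: "C1_compact K (\<lambda>x. \<Phi> (\<psi> x))" "grad (\<lambda>x. \<Phi> (\<psi> x)) = (\<lambda>x. \<phi> (\<psi> x) *\<^sub>R grad \<psi> x)"
    using C1_compactI[of K "\<lambda>x. \<Phi> (\<psi> x)" "\<lambda>x. \<phi> (\<psi> x) *\<^sub>R grad \<psi> x"] K d by auto
  have dx: "((\<lambda>x::real^'a. x $ i) has_derivative (\<lambda>v. axis i 1 \<bullet> v)) (at x)" for x
    using bounded_linear_imp_has_derivative[OF bounded_linear_vec_nth[of i]] by (simp add: inner_axis')
  note m = C1_compact_mult[OF F(1) dx continuous_on_const]
  have i3: "integrable lborel (\<lambda>x. x $ i * (\<phi> (\<psi> x) * grad \<psi> x $ i))"
    by (rule continuous_compact_support_integrable[OF _ K(1)]) (use cF K in \<open>auto intro!: continuous_intros\<close>)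
  have "0 = (\<integral>x. \<Phi> (\<psi> x) + x $ i * (\<phi> (\<psi> x) * grad \<psi> x $ i) \<partial>lborel)"
    using integral_partial_derivative_0[OF m(1), of i] by (simp add: m(2) F(2) mult.assoc)
  then have "(\<integral>x. \<Phi> (\<psi> x) \<partial>lborel) = (\<integral>x. - (x $ i * (\<phi> (\<psi> x) * grad \<psi> x $ i)) \<partial>lborel)"
    using i1 i3 by simp
  also have "\<dots> \<le> (\<integral>x. 1 / 2 * \<Phi> (\<psi> x) + R * C * \<Phi> (norm (grad \<psi> x)) \<partial>lborel)"
  proof (rule integral_mono)
    fix x
    show "- (x $ i * (\<phi> (\<psi> x) * grad \<psi> x $ i)) \<le> 1 / 2 * \<Phi> (\<psi> x) + R * C * \<Phi> (norm (grad \<psi> x))"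
    proof (cases "x \<in> K")
      case True
      then have "\<bar>x $ i\<bar> \<le> R"
        using assms(2,3) component_le_norm_cart[of x i] by force
      have p: "\<bar>\<phi> (\<psi> x)\<bar> = \<phi> \<bar>\<psi> x\<bar>"
        using phi_nonneg[of "\<bar>\<psi> x\<bar>"] phi_minus[of "\<psi> x"] by (cases "\<psi> x \<ge> 0") auto
      have "- (x $ i * (\<phi> (\<psi> x) * grad \<psi> x $ i)) \<le> \<bar>x $ i * (\<phi> (\<psi> x) * grad \<psi> x $ i)\<bar>"
        by linarith
      also have "\<dots> = \<bar>x $ i\<bar> * (\<phi> \<bar>\<psi> x\<bar> * \<bar>grad \<psi> x $ i\<bar>)"
        by (simp add: abs_mult p)
      also have "\<dots> \<le> R * (\<phi> \<bar>\<psi> x\<bar> * norm (grad \<psi> x))"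
        using \<open>\<bar>x $ i\<bar> \<le> R\<close> phi_nonneg[of "\<bar>\<psi> x\<bar>"] component_le_norm_cart[of "grad \<psi> x" i]
        by (intro mult_mono mult_left_mono mult_nonneg_nonneg) auto
      also have "\<dots> \<le> R * (1 / (2 * R) * \<Phi> \<bar>\<psi> x\<bar> + C * \<Phi> (norm (grad \<psi> x)))"
        using assms(4) by (intro mult_left_mono C) auto
      also have "\<dots> = 1 / 2 * \<Phi> (\<psi> x) + R * C * \<Phi> (norm (grad \<psi> x))"
        using assms(4) by (simp add: Phi_abs field_simps)
      finally show ?thesis .
    qed (use K in simp)
  qed (use i1 i2 i3 in auto)
  also have "\<dots> = 1 / 2 * (\<integral>x. \<Phi> (\<psi> x) \<partial>lborel) + R * C * (\<integral>x. \<Phi> (norm (grad \<psi> x)) \<partial>lborel)"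
    using i1 i2 by simp
  finally show "(\<integral>x. \<Phi> (\<psi> x) \<partial>lborel) \<le> 2 * R * C * (\<integral>x. \<Phi> (norm (grad \<psi> x)) \<partial>lborel)"
    by simp
qed

section \<open>The modular and the space of test function limits\<close>

locale orlicz_domain = N_function a for a +
  fixes \<Omega> :: "(real^'n) set"
  assumes open_dom: "open \<Omega>" and bounded_dom: "bounded \<Omega>"
begin

abbreviation M where "M \<equiv> lebesgue_on \<Omega>"

lemma dom_sets [simp]: "\<Omega> \<in> sets lebesgue"
  using open_dom by simp

sublocale finite_measure M
  by (rule finite_measure_lebesgue_on) (use open_dom bounded_dom in \<open>simp add: lmeasurable_open\<close>)

lemma measurable_M: "f \<in> borel_measurable borel \<Longrightarrow> f \<in> borel_measurable M"
  by (rule measurable_restrict_space1) (simp add: measurable_completion)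

lemma Phi_measurable [measurable]: "\<Phi> \<in> borel_measurable borel"
  using Phi_continuous by (rule borel_measurable_continuous_onI)

text \<open>Taken in \<open>ennreal\<close> and for vector values, so that estimates presuppose no
  integrability and cover functions and gradients alike.\<close>

definition modular :: "(real^'n \<Rightarrow> 'b::real_normed_vector) \<Rightarrow> ennreal" where
  "modular f = (\<integral>\<^sup>+x. ennreal (\<Phi> (norm (f x))) \<partial>M)"

lemma modular_mono: "AE x in M. norm (f x) \<le> norm (g x) \<Longrightarrow> modular f \<le> modular g"
  unfolding modular_def
  by (rule nn_integral_mono_AE, erule eventually_mono) (auto intro!: ennreal_leI Phi_mono)

lemma modular_cong: "AE x in M. f x = g x \<Longrightarrow> modular f = modular g"
  unfolding modular_def by (rule nn_integral_cong_AE, erule eventually_mono) simp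

lemma modular_norm: "modular (\<lambda>x. norm (f x)) = modular f"
  by (simp add: modular_def)

lemma modular_real: "modular f = (\<integral>\<^sup>+x. ennreal (\<Phi> (f x)) \<partial>M)" for f :: "real^'n \<Rightarrow> real"
  by (simp add: modular_def Phi_abs)

lemma modular_minus_commute: "modular (\<lambda>x. f x - g x) = modular (\<lambda>x. g x - f x)"
  by (simp add: modular_def norm_minus_commute)

lemma modular_add:
  fixes f g :: "real^'n \<Rightarrow> 'b::euclidean_space"
  assumes [measurable]: "f \<in> borel_measurable M" "g \<in> borel_measurable M"
  shows "modular (\<lambda>x. f x + g x) \<le> ennreal Kq * (modular f + modular g)"
proof -
  have "modular (\<lambda>x. f x + g x)
      \<le> (\<integral>\<^sup>+x. ennreal Kq * (ennreal (\<Phi> (norm (f x))) + ennreal (\<Phi> (norm (g x)))) \<partial>M)"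
    unfolding modular_def
  proof (rule nn_integral_mono)
    fix x
    have "ennreal (\<Phi> (norm (f x + g x))) \<le> ennreal (Kq * (\<Phi> (norm (f x)) + \<Phi> (norm (g x))))"
      by (intro ennreal_leI Phi_norm_add)
    also have "\<dots> = ennreal Kq * (ennreal (\<Phi> (norm (f x))) + ennreal (\<Phi> (norm (g x))))"
      using Kq_ge_1 Phi_nonneg by (simp add: ennreal_mult)
    finally show "ennreal (\<Phi> (norm (f x + g x))) \<le> \<dots>" .
  qed
  also have "\<dots> = ennreal Kq * (modular f + modular g)"
    unfolding modular_def by (subst nn_integral_cmult) (auto simp: nn_integral_add)
  finally show ?thesis .
qed

lemma modular_add_le:
  fixes f g :: "real^'n \<Rightarrow> 'b::euclidean_space"
  assumes "f \<in> borel_measurable M" "g \<in> borel_measurable M"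
    "modular f \<le> ennreal r" "modular g \<le> ennreal s" "0 \<le> r" "0 \<le> s"
  shows "modular (\<lambda>x. f x + g x) \<le> ennreal (Kq * (r + s))"
proof -
  have "modular (\<lambda>x. f x + g x) \<le> ennreal Kq * (ennreal r + ennreal s)"
    using modular_add[OF assms(1,2)] assms(3,4) by (meson add_mono mult_left_mono order_trans zero_le)
  also have "\<dots> = ennreal (Kq * (r + s))"
    using Kq_ge_1 assms by (simp add: ennreal_mult)
  finally show ?thesis .
qed

lemma modular_triangle_le:
  fixes f g h :: "real^'n \<Rightarrow> 'b::euclidean_space"
  assumes "f \<in> borel_measurable M" "g \<in> borel_measurable M" "h \<in> borel_measurable M"
    "modular (\<lambda>x. f x - g x) \<le> ennreal r" "modular (\<lambda>x. g x - h x) \<le> ennreal s" "0 \<le> r" "0 \<le> s"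
  shows "modular (\<lambda>x. f x - h x) \<le> ennreal (Kq * (r + s))"
  using modular_add_le[of "\<lambda>x. f x - g x" "\<lambda>x. g x - h x" r s] assms by simp

lemma modular_scale:
  fixes f :: "real^'n \<Rightarrow> 'b::euclidean_space"
  assumes [measurable]: "f \<in> borel_measurable M"
  shows "modular (\<lambda>x. c *\<^sub>R f x) \<le> ennreal (max 1 (\<bar>c\<bar> powr p)) * modular f"
proof -
  have "modular (\<lambda>x. c *\<^sub>R f x) \<le> (\<integral>\<^sup>+x. ennreal (max 1 (\<bar>c\<bar> powr p)) * ennreal (\<Phi> (norm (f x))) \<partial>M)"
    unfolding modular_def
    by (intro nn_integral_mono) (auto simp: ennreal_mult[symmetric] Phi_nonneg intro!: ennreal_leI Phi_scale)
  also have "\<dots> = ennreal (max 1 (\<bar>c\<bar> powr p)) * modular f"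
    unfolding modular_def by (rule nn_integral_cmult) measurable
  finally show ?thesis .
qed

lemma modular_finite_add:
  fixes f g :: "real^'n \<Rightarrow> 'b::euclidean_space"
  assumes "f \<in> borel_measurable M" "g \<in> borel_measurable M" "modular f < \<infinity>" "modular g < \<infinity>"
  shows "modular (\<lambda>x. f x + g x) < \<infinity>"
  using modular_add[OF assms(1,2)] assms(3,4)
  by (auto simp: ennreal_mult_less_top intro: le_less_trans)

lemma modular_finite_scale:
  fixes f :: "real^'n \<Rightarrow> 'b::euclidean_space"
  assumes "f \<in> borel_measurable M" "modular f < \<infinity>"
  shows "modular (\<lambda>x. c *\<^sub>R f x) < \<infinity>"
  using modular_scale[OF assms(1), of c] assms(2)
  by (auto simp: ennreal_mult_less_top intro: le_less_trans)

lemma modular_integrable: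
  fixes f :: "real^'n \<Rightarrow> 'b::euclidean_space"
  assumes [measurable]: "f \<in> borel_measurable M" and fin: "modular f < \<infinity>"
  shows "integrable M (\<lambda>x. \<Phi> (norm (f x)))" "ennreal (\<integral>x. \<Phi> (norm (f x)) \<partial>M) = modular f"
    "integrable M f"
proof -
  show i: "integrable M (\<lambda>x. \<Phi> (norm (f x)))"
    using fin by (intro integrableI_nonneg) (auto simp: Phi_nonneg modular_def)
  then show "ennreal (\<integral>x. \<Phi> (norm (f x)) \<partial>M) = modular f"
    unfolding modular_def by (intro nn_integral_eq_integral[symmetric]) (auto simp: Phi_nonneg)
  show "integrable M f"
  proof (rule Bochner_Integration.integrable_bound)
    show "integrable M (\<lambda>x. 1 + 1 / \<Phi> 1 * \<Phi> (norm (f x)))"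
      using i by simp
    show "AE x in M. norm (f x) \<le> norm (1 + 1 / \<Phi> 1 * \<Phi> (norm (f x)))"
    proof (intro AE_I2)
      fix x
      show "norm (f x) \<le> norm (1 + 1 / \<Phi> 1 * \<Phi> (norm (f x)))"
        using abs_le_Phi[of 1 "norm (f x)"] by simp
    qed
  qed measurable
qed

lemma modular_L1:
  fixes f :: "real^'n \<Rightarrow> 'b::euclidean_space"
  assumes "f \<in> borel_measurable M" "modular f \<le> ennreal r" "0 \<le> r" "\<epsilon> > 0"
  shows "(\<integral>x. norm (f x) \<partial>M) \<le> \<epsilon> * measure M (space M) + \<epsilon> / \<Phi> \<epsilon> * r"
proof -
  have fin: "modular f < \<infinity>"
    using assms(2) by (auto intro: le_less_trans)
  note i = modular_integrable[OF assms(1) fin]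
  have "(\<integral>x. norm (f x) \<partial>M) \<le> (\<integral>x. \<epsilon> + \<epsilon> / \<Phi> \<epsilon> * \<Phi> (norm (f x)) \<partial>M)"
    using i abs_le_Phi[OF assms(4), of "norm (f _)"] by (intro integral_mono) auto
  also have "\<dots> = \<epsilon> * measure M (space M) + \<epsilon> / \<Phi> \<epsilon> * (\<integral>x. \<Phi> (norm (f x)) \<partial>M)"
    using i by simp
  finally have "(\<integral>x. norm (f x) \<partial>M) \<le> \<epsilon> * measure M (space M) + \<epsilon> / \<Phi> \<epsilon> * (\<integral>x. \<Phi> (norm (f x)) \<partial>M)" .
  moreover have "(\<integral>x. \<Phi> (norm (f x)) \<partial>M) \<le> r"
    using i(2) assms(2,3) by (metis ennreal_le_iff)
  then have "\<epsilon> / \<Phi> \<epsilon> * (\<integral>x. \<Phi> (norm (f x)) \<partial>M) \<le> \<epsilon> / \<Phi> \<epsilon> * r"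
    using assms(4) Phi_nonneg[of \<epsilon>] by (intro mult_left_mono) auto
  ultimately show ?thesis by linarith
qed

text \<open>\<open>\<epsilon>\<close> makes the term of \<open>modular_L1\<close> with the measure
  of the domain small, and \<open>d\<close> then compensates the factor
  \<open>\<epsilon> / \<Phi> \<epsilon>\<close>. Modular convergence thereby implies L1
  convergence.\<close>

lemma modular_small_L1:
  assumes "e > 0"
  obtains d where "d > 0" "\<And>f :: real^'n \<Rightarrow> 'b::euclidean_space.
    f \<in> borel_measurable M \<Longrightarrow> modular f \<le> ennreal d \<Longrightarrow> (\<integral>x. norm (f x) \<partial>M) < e"
proof -
  define m where "m = measure M (space M)"
  define \<epsilon> where "\<epsilon> = e / (2 * (m + 1))"
  have m: "m \<ge> 0" by (simp add: m_def)
  have \<epsilon>: "\<epsilon> > 0" using assms m by (simp add: \<epsilon>_def)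
  define d where "d = \<Phi> \<epsilon> / \<epsilon> * (e / 4)"
  have d: "d > 0" using \<epsilon> assms Phi_pos[of \<epsilon>] by (simp add: d_def)
  have "\<epsilon> * m \<le> e / 2"
    using m assms by (simp add: \<epsilon>_def field_simps)
  moreover have "\<epsilon> / \<Phi> \<epsilon> * d = e / 4"
    using \<epsilon> Phi_pos[of \<epsilon>] by (simp add: d_def)
  ultimately have "\<epsilon> * m + \<epsilon> / \<Phi> \<epsilon> * d < e" using assms by linarith
  show thesis
  proof (rule that[OF d])
    fix f :: "real^'n \<Rightarrow> 'b" assume "f \<in> borel_measurable M" "modular f \<le> ennreal d"
    from modular_L1[OF this _ \<epsilon>] d have "(\<integral>x. norm (f x) \<partial>M) \<le> \<epsilon> * m + \<epsilon> / \<Phi> \<epsilon> * d"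
      by (simp add: m_def)
    then show "(\<integral>x. norm (f x) \<partial>M) < e"
      using \<open>\<epsilon> * m + \<epsilon> / \<Phi> \<epsilon> * d < e\<close> by simp
  qed
qed

lemma modular_small:
  assumes "(\<lambda>n. modular (f n)) \<longlonglongrightarrow> 0" "e > 0"
  shows "\<forall>\<^sub>F n in sequentially. modular (f n) \<le> ennreal e"
proof -
  have "\<forall>\<^sub>F n in sequentially. modular (f n) < ennreal e"
    using assms by (intro order_tendstoD(2)) auto
  then show ?thesis by eventually_elim simp
qed

lemma modular_tendsto_L1:
  fixes f :: "nat \<Rightarrow> real^'n \<Rightarrow> 'b::euclidean_space"
  assumes "\<And>n. f n \<in> borel_measurable M" "(\<lambda>n. modular (f n)) \<longlonglongrightarrow> 0"
  shows "(\<lambda>n. \<integral>x. norm (f n x) \<partial>M) \<longlonglongrightarrow> 0"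
proof (rule LIMSEQ_I)
  fix e :: real assume "e > 0"
  then obtain d where d: "d > 0" "\<And>f :: real^'n \<Rightarrow> 'b.
      f \<in> borel_measurable M \<Longrightarrow> modular f \<le> ennreal d \<Longrightarrow> (\<integral>x. norm (f x) \<partial>M) < e"
    using modular_small_L1[where ?'b = 'b] by metis
  have "\<forall>\<^sub>F n in sequentially. norm ((\<integral>x. norm (f n x) \<partial>M) - 0) < e"
    using modular_small[OF assms(2) d(1)] by eventually_elim (use d(2) assms(1) in simp)
  then show "\<exists>N. \<forall>n\<ge>N. norm ((\<integral>x. norm (f n x) \<partial>M) - 0) < e"
    by (simp add: eventually_sequentially)
qed

lemma modular_tendsto_0:
  assumes "\<And>n. modular (f n) \<le> ennreal (r n)" "r \<longlonglongrightarrow> 0"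
  shows "(\<lambda>n. modular (f n)) \<longlonglongrightarrow> 0"
proof (rule tendsto_sandwich[of "\<lambda>_. 0" _ _ "\<lambda>n. ennreal (r n)"])
  show "(\<lambda>n. ennreal (r n)) \<longlonglongrightarrow> 0"
    using tendsto_ennrealI[OF assms(2)] by simp
qed (use assms(1) in auto)

lemma modular_AE_subseq:
  fixes f :: "nat \<Rightarrow> real^'n \<Rightarrow> 'b::euclidean_space"
  assumes "\<And>n. f n \<in> borel_measurable M" "(\<lambda>n. modular (f n)) \<longlonglongrightarrow> 0"
  obtains r where "strict_mono r" "AE x in M. (\<lambda>n. f (r n) x) \<longlonglongrightarrow> 0"
proof -
  \<comment> \<open>A finite modular, hence integrability, is guaranteed only from \<open>N\<close>
    on; the subsequence is taken after that index.\<close>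
  obtain N where N: "\<And>n. n \<ge> N \<Longrightarrow> modular (f n) \<le> ennreal 1"
    using modular_small[OF assms(2), of 1] by (auto simp: eventually_sequentially)
  have i: "integrable M (f (n + N))" for n
    using N[of "n + N"] by (intro modular_integrable(3) assms(1)) (auto intro: le_less_trans)
  have "(\<lambda>n. \<integral>x. norm (f (n + N) x) \<partial>M) \<longlonglongrightarrow> 0"
    using modular_tendsto_L1[OF assms] by (rule LIMSEQ_ignore_initial_segment)
  from tendsto_L1_AE_subseq[OF i this] obtain r where r: "strict_mono r" "AE x in M. (\<lambda>n. f (r n + N) x) \<longlonglongrightarrow> 0"
    by auto
  show thesis
    by (rule that[of "\<lambda>n. r n + N"]) (use r in \<open>auto simp: strict_mono_def\<close>)
qed

lemma modular_dominated:
  fixes f :: "nat \<Rightarrow> real^'n \<Rightarrow> 'b::euclidean_space"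
  assumes [measurable]: "\<And>n. f n \<in> borel_measurable M" "w \<in> borel_measurable M"
    and conv: "AE x in M. (\<lambda>n. f n x) \<longlonglongrightarrow> 0"
    and bound: "\<And>n. AE x in M. norm (f n x) \<le> w x"
    and fin: "modular (w :: real^'n \<Rightarrow> real) < \<infinity>"
  shows "(\<lambda>n. modular (f n)) \<longlonglongrightarrow> 0"
proof -
  have "(\<lambda>n. \<integral>\<^sup>+x. ennreal (\<Phi> (norm (f n x))) \<partial>M) \<longlonglongrightarrow> (\<integral>\<^sup>+x. 0 \<partial>M)"
  proof (rule nn_integral_dominated_convergence)
    show "AE x in M. ennreal (\<Phi> (norm (f n x))) \<le> ennreal (\<Phi> (w x))" for n
      using bound[of n] by eventually_elim (auto intro!: ennreal_leI Phi_mono)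
    show "(\<integral>\<^sup>+x. ennreal (\<Phi> (w x)) \<partial>M) < \<infinity>"
      using fin by (simp add: modular_real)
    show "AE x in M. (\<lambda>n. ennreal (\<Phi> (norm (f n x)))) \<longlonglongrightarrow> 0"
      using conv
    proof eventually_elim
      fix x assume "(\<lambda>n. f n x) \<longlonglongrightarrow> 0"
      then have "(\<lambda>n. \<Phi> (norm (f n x))) \<longlonglongrightarrow> \<Phi> 0"
        by (intro tendsto_Phi tendsto_norm_zero)
      then show "(\<lambda>n. ennreal (\<Phi> (norm (f n x)))) \<longlonglongrightarrow> 0"
        using tendsto_ennrealI by fastforce
    qed
  qed measurable
  then show ?thesis by (simp add: modular_def)
qed

lemma modular_fatou:
  fixes f :: "nat \<Rightarrow> real^'n \<Rightarrow> 'b::euclidean_space"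
  assumes [measurable]: "\<And>n. f n \<in> borel_measurable M"
    and conv: "AE x in M. (\<lambda>n. f n x) \<longlonglongrightarrow> g x"
    and le: "\<forall>\<^sub>F n in sequentially. modular (f n) \<le> B"
  shows "modular g \<le> B"
proof -
  have "modular g = (\<integral>\<^sup>+x. liminf (\<lambda>n. ennreal (\<Phi> (norm (f n x)))) \<partial>M)"
    unfolding modular_def
  proof (rule nn_integral_cong_AE, use conv in eventually_elim)
    fix x assume "(\<lambda>n. f n x) \<longlonglongrightarrow> g x"
    then have "(\<lambda>n. \<Phi> (norm (f n x))) \<longlonglongrightarrow> \<Phi> (norm (g x))"
      by (intro tendsto_Phi tendsto_norm)
    then show "ennreal (\<Phi> (norm (g x))) = liminf (\<lambda>n. ennreal (\<Phi> (norm (f n x))))"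
      by (intro lim_imp_Liminf[symmetric] tendsto_ennrealI) auto
  qed
  also have "\<dots> \<le> liminf (\<lambda>n. modular (f n))"
    unfolding modular_def by (rule nn_integral_liminf) measurable
  also have "\<dots> \<le> limsup (\<lambda>n. modular (f n))"
    by (rule Liminf_le_Limsup) simp
  also have "\<dots> \<le> B"
    using le by (rule Limsup_bounded)
  finally show ?thesis .
qed

section \<open>Test functions on the domain and their Poincare inequality\<close>

lemma test_measurable:
  assumes "\<psi> \<in> test_functions \<Omega>"
  shows "\<psi> \<in> borel_measurable M" "grad \<psi> \<in> borel_measurable M"
proof -
  obtain K where "C1_compact K \<psi>"
    using assms by (rule test_function_C1)
  then show "\<psi> \<in> borel_measurable M" "grad \<psi> \<in> borel_measurable M"
    using C1_compact_borel measurable_M by blast+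
qed

definition dom_radius where
  "dom_radius = (SOME R. R > 0 \<and> (\<forall>x\<in>\<Omega>. norm x \<le> R))"

lemma dom_radius: "dom_radius > 0" "x \<in> \<Omega> \<Longrightarrow> norm x \<le> dom_radius"
proof -
  have "\<exists>R. R > 0 \<and> (\<forall>x\<in>\<Omega>. norm x \<le> R)"
    using bounded_dom by (simp add: bounded_pos)
  then have "dom_radius > 0 \<and> (\<forall>x\<in>\<Omega>. norm x \<le> dom_radius)"
    unfolding dom_radius_def by (rule someI_ex)
  then show "dom_radius > 0" "x \<in> \<Omega> \<Longrightarrow> norm x \<le> dom_radius" by auto
qed

lemma poincare_test:
  obtains C where "C \<ge> 0"
    "\<And>\<psi>. \<psi> \<in> test_functions \<Omega> \<Longrightarrow> modular \<psi> \<le> ennreal C * modular (grad \<psi>)"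
    "\<And>\<psi>. \<psi> \<in> test_functions \<Omega> \<Longrightarrow> modular \<psi> < \<infinity> \<and> modular (grad \<psi>) < \<infinity>"
proof -
  let ?R = dom_radius
  obtain C where C: "C > 0" "\<And>s t. 0 \<le> s \<Longrightarrow> 0 \<le> t \<Longrightarrow> \<phi> s * t \<le> 1 / (2 * ?R) * \<Phi> s + C * \<Phi> t"
    using young[of "1 / (2 * ?R)"] dom_radius(1) by auto
  have *: "modular \<psi> = ennreal (\<integral>x. \<Phi> (\<psi> x) \<partial>lborel)"
    "modular (grad \<psi>) = ennreal (\<integral>x. \<Phi> (norm (grad \<psi> x)) \<partial>lborel)"
    "(\<integral>x. \<Phi> (\<psi> x) \<partial>lborel) \<le> 2 * ?R * C * (\<integral>x. \<Phi> (norm (grad \<psi> x)) \<partial>lborel)"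
    if t: "\<psi> \<in> test_functions \<Omega>" for \<psi>
  proof -
    obtain K where K: "C1_compact K \<psi>" "K \<subseteq> \<Omega>" using t by (rule test_function_C1)
    note P = poincare_C1[OF K dom_radius(2) dom_radius(1) C(2)]
    have m: "(\<lambda>x. \<Phi> (\<psi> x)) \<in> borel_measurable borel" "(\<lambda>x. \<Phi> (norm (grad \<psi> x))) \<in> borel_measurable borel"
      using P(2,3) by (auto dest: borel_measurable_integrable)
    have z: "\<Phi> (\<psi> x) = 0" "\<Phi> (norm (grad \<psi> x)) = 0" if "x \<notin> \<Omega>" for x
    proof -
      have "x \<notin> K" using that K(2) by auto
      then show "\<Phi> (\<psi> x) = 0" "\<Phi> (norm (grad \<psi> x)) = 0"
        using C1_compact_grad_outside[OF K(1), of x] K(1) by (simp_all add: C1_compact_def)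
    qed
    note L1 = lebesgue_on_lborel[OF m(1) z(1) dom_sets] and L2 = lebesgue_on_lborel[OF m(2) z(2) dom_sets]
    show "modular \<psi> = ennreal (\<integral>x. \<Phi> (\<psi> x) \<partial>lborel)"
      unfolding modular_real
      using L1 P(2) by (subst nn_integral_eq_integral) (auto simp: Phi_nonneg)
    show "modular (grad \<psi>) = ennreal (\<integral>x. \<Phi> (norm (grad \<psi> x)) \<partial>lborel)"
      unfolding modular_def
      using L2 P(3) by (subst nn_integral_eq_integral) (auto simp: Phi_nonneg)
    show "(\<integral>x. \<Phi> (\<psi> x) \<partial>lborel) \<le> 2 * ?R * C * (\<integral>x. \<Phi> (norm (grad \<psi> x)) \<partial>lborel)"
      by (rule P(1))
  qed
  show thesis
  proof (rule that[of "2 * ?R * C"])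
    show ge: "0 \<le> 2 * ?R * C" using C dom_radius(1) by simp
    fix \<psi> assume t: "\<psi> \<in> test_functions \<Omega>"
    have "0 \<le> (\<integral>x. \<Phi> (norm (grad \<psi> x)) \<partial>lborel)" by (simp add: Phi_nonneg)
    then show "modular \<psi> \<le> ennreal (2 * ?R * C) * modular (grad \<psi>)"
      using *[OF t] ge by (simp add: ennreal_mult[symmetric] ennreal_leI)
    show "modular \<psi> < \<infinity> \<and> modular (grad \<psi>) < \<infinity>"
      using *[OF t] by simp
  qed
qed

text \<open>Membership of \<open>u\<close> in the closure of the test functions, together with the limit \<open>g\<close> of
  the gradients. Because of the growth condition on \<open>\<Phi>\<close>, modular and norm convergence agree.\<close>

definition W0 :: "(real^'n \<Rightarrow> real) \<Rightarrow> (real^'n \<Rightarrow> real^'n) \<Rightarrow> bool" where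
  "W0 u g \<longleftrightarrow> u \<in> borel_measurable M \<and> g \<in> borel_measurable M \<and>
     (\<forall>\<epsilon>>0. \<exists>\<psi>\<in>test_functions \<Omega>.
        modular (\<lambda>x. u x - \<psi> x) \<le> ennreal \<epsilon> \<and> modular (\<lambda>x. g x - grad \<psi> x) \<le> ennreal \<epsilon>)"

lemma W0_measurable: "W0 u g \<Longrightarrow> u \<in> borel_measurable M" "W0 u g \<Longrightarrow> g \<in> borel_measurable M"
  by (simp_all add: W0_def)

lemma W0_test: "\<psi> \<in> test_functions \<Omega> \<Longrightarrow> W0 \<psi> (grad \<psi>)"
  unfolding W0_def using test_measurable by (auto simp: modular_def intro!: bexI[of _ \<psi>])

text \<open>Approximating by members of \<open>W0\<close> is enough, as each of them is in turn
  approximated by a test function.\<close>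

lemma W0_closed:
  assumes "u \<in> borel_measurable M" "g \<in> borel_measurable M"
    and "\<And>\<epsilon>. \<epsilon> > 0 \<Longrightarrow> \<exists>v h. W0 v h \<and> modular (\<lambda>x. u x - v x) \<le> ennreal \<epsilon> \<and>
            modular (\<lambda>x. g x - h x) \<le> ennreal \<epsilon>"
  shows "W0 u g"
  unfolding W0_def
proof (intro conjI allI impI assms(1,2))
  fix \<epsilon> :: real assume \<epsilon>: "\<epsilon> > 0"
  \<comment> \<open>Two errors \<open>e\<close> combine through the quasi-triangle inequality to
    \<open>Kq * (e + e)\<close>.\<close>
  define e where "e = \<epsilon> / (2 * Kq)"
  have e: "e > 0" "Kq * (e + e) = \<epsilon>" using \<epsilon> Kq_ge_1 by (auto simp: e_def)
  obtain v h where v: "W0 v h" "modular (\<lambda>x. u x - v x) \<le> ennreal e" "modular (\<lambda>x. g x - h x) \<le> ennreal e"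
    using assms(3)[OF e(1)] by auto
  obtain \<psi> where \<psi>: "\<psi> \<in> test_functions \<Omega>" "modular (\<lambda>x. v x - \<psi> x) \<le> ennreal e"
    "modular (\<lambda>x. h x - grad \<psi> x) \<le> ennreal e"
    using v(1) e(1) unfolding W0_def by blast
  show "\<exists>\<psi>\<in>test_functions \<Omega>. modular (\<lambda>x. u x - \<psi> x) \<le> ennreal \<epsilon> \<and> modular (\<lambda>x. g x - grad \<psi> x) \<le> ennreal \<epsilon>"
    using modular_triangle_le[OF assms(1) W0_measurable(1)[OF v(1)] test_measurable(1)[OF \<psi>(1)] v(2) \<psi>(2)]
      modular_triangle_le[OF assms(2) W0_measurable(2)[OF v(1)] test_measurable(2)[OF \<psi>(1)] v(3) \<psi>(3)]
      e \<psi>(1) by (auto intro!: bexI[of _ \<psi>])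
qed

lemma W0_limit:
  assumes "u \<in> borel_measurable M" "g \<in> borel_measurable M" "\<And>n. W0 (v n) (h n)"
    "(\<lambda>n. modular (\<lambda>x. v n x - u x)) \<longlonglongrightarrow> 0" "(\<lambda>n. modular (\<lambda>x. h n x - g x)) \<longlonglongrightarrow> 0"
  shows "W0 u g"
proof (rule W0_closed[OF assms(1,2)])
  fix \<epsilon> :: real assume \<epsilon>: "\<epsilon> > 0"
  have "\<forall>\<^sub>F n in sequentially. modular (\<lambda>x. v n x - u x) \<le> ennreal \<epsilon> \<and> modular (\<lambda>x. h n x - g x) \<le> ennreal \<epsilon>"
    using modular_small[OF assms(4) \<epsilon>] modular_small[OF assms(5) \<epsilon>] by eventually_elim simp
  then obtain n where "modular (\<lambda>x. v n x - u x) \<le> ennreal \<epsilon>" "modular (\<lambda>x. h n x - g x) \<le> ennreal \<epsilon>"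
    by (auto simp: eventually_sequentially)
  then show "\<exists>v h. W0 v h \<and> modular (\<lambda>x. u x - v x) \<le> ennreal \<epsilon> \<and> modular (\<lambda>x. g x - h x) \<le> ennreal \<epsilon>"
    using assms(3) modular_minus_commute[of u] modular_minus_commute[of g] by metis
qed

lemma W0_seq:
  assumes "W0 u g"
  obtains \<psi> where "\<And>n. \<psi> n \<in> test_functions \<Omega>" "(\<lambda>n. modular (\<lambda>x. \<psi> n x - u x)) \<longlonglongrightarrow> 0"
    "(\<lambda>n. modular (\<lambda>x. grad (\<psi> n) x - g x)) \<longlonglongrightarrow> 0"
proof -
  have "\<forall>n. \<exists>\<psi>. \<psi> \<in> test_functions \<Omega> \<and> modular (\<lambda>x. u x - \<psi> x) \<le> ennreal (1 / real (Suc n)) \<and>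
      modular (\<lambda>x. g x - grad \<psi> x) \<le> ennreal (1 / real (Suc n))"
  proof
    fix n
    have "1 / real (Suc n) > 0" by simp
    then show "\<exists>\<psi>. \<psi> \<in> test_functions \<Omega> \<and> modular (\<lambda>x. u x - \<psi> x) \<le> ennreal (1 / real (Suc n)) \<and>
      modular (\<lambda>x. g x - grad \<psi> x) \<le> ennreal (1 / real (Suc n))"
      using assms unfolding W0_def by blast
  qed
  from choice[OF this] obtain \<psi> where "\<forall>n. \<psi> n \<in> test_functions \<Omega> \<and>
      modular (\<lambda>x. u x - \<psi> n x) \<le> ennreal (1 / real (Suc n)) \<and>
      modular (\<lambda>x. g x - grad (\<psi> n) x) \<le> ennreal (1 / real (Suc n))"
    by blast
  then have \<psi>: "\<And>n. \<psi> n \<in> test_functions \<Omega>"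
    "\<And>n. modular (\<lambda>x. u x - \<psi> n x) \<le> ennreal (1 / real (Suc n))"
    "\<And>n. modular (\<lambda>x. g x - grad (\<psi> n) x) \<le> ennreal (1 / real (Suc n))"
    by blast+
  have l: "(\<lambda>n. 1 / real (Suc n)) \<longlonglongrightarrow> 0" by real_asymp
  show thesis
  proof (rule that[OF \<psi>(1)])
    show "(\<lambda>n. modular (\<lambda>x. \<psi> n x - u x)) \<longlonglongrightarrow> 0"
      by (rule modular_tendsto_0[OF _ l]) (subst modular_minus_commute, rule \<psi>(2))
    show "(\<lambda>n. modular (\<lambda>x. grad (\<psi> n) x - g x)) \<longlonglongrightarrow> 0"
      by (rule modular_tendsto_0[OF _ l]) (subst modular_minus_commute, rule \<psi>(3))
  qed
qed

lemma W0_finite: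
  assumes "W0 u g"
  shows "modular u < \<infinity>" "modular g < \<infinity>"
proof -
  obtain \<psi> where \<psi>: "\<psi> \<in> test_functions \<Omega>" "modular (\<lambda>x. u x - \<psi> x) \<le> ennreal 1"
    "modular (\<lambda>x. g x - grad \<psi> x) \<le> ennreal 1"
    using assms unfolding W0_def by (meson zero_less_one)
  have "modular \<psi> < \<infinity>" "modular (grad \<psi>) < \<infinity>"
    by (rule poincare_test, use \<psi>(1) in blast)+
  moreover have "modular (\<lambda>x. u x - \<psi> x) < \<infinity>" "modular (\<lambda>x. g x - grad \<psi> x) < \<infinity>"
    using \<psi>(2,3) by (auto intro: le_less_trans)
  ultimately show "modular u < \<infinity>" "modular g < \<infinity>"
    using modular_finite_add[of "\<lambda>x. u x - \<psi> x" \<psi>] modular_finite_add[of "\<lambda>x. g x - grad \<psi> x" "grad \<psi>"]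
      W0_measurable[OF assms] test_measurable[OF \<psi>(1)] by simp_all
qed

lemma W0_cong:
  assumes "W0 u g" "AE x in M. u x = u' x" "AE x in M. g x = g' x"
    "u' \<in> borel_measurable M" "g' \<in> borel_measurable M"
  shows "W0 u' g'"
proof (rule W0_closed[OF assms(4,5)])
  fix \<epsilon> :: real assume "\<epsilon> > 0"
  have "modular (\<lambda>x. u' x - u x) = modular (\<lambda>x. 0 :: real)" "modular (\<lambda>x. g' x - g x) = modular (\<lambda>x. 0 :: real^'n)"
    by (rule modular_cong, use assms(2,3) in eventually_elim, simp)+
  then show "\<exists>v h. W0 v h \<and> modular (\<lambda>x. u' x - v x) \<le> ennreal \<epsilon> \<and> modular (\<lambda>x. g' x - h x) \<le> ennreal \<epsilon>"
    using assms(1) by (auto simp: modular_def intro!: exI[of _ u] exI[of _ g])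
qed

lemma W0_add:
  assumes "W0 u g" "W0 v h"
  shows "W0 (\<lambda>x. u x + v x) (\<lambda>x. g x + h x)"
proof (rule W0_closed)
  fix \<epsilon> :: real assume \<epsilon>: "\<epsilon> > 0"
  define e where "e = \<epsilon> / (2 * Kq)"
  have e: "e > 0" "Kq * (e + e) = \<epsilon>" using \<epsilon> Kq_ge_1 by (auto simp: e_def)
  obtain \<psi> where \<psi>: "\<psi> \<in> test_functions \<Omega>" "modular (\<lambda>x. u x - \<psi> x) \<le> ennreal e"
    "modular (\<lambda>x. g x - grad \<psi> x) \<le> ennreal e"
    using assms(1) e(1) unfolding W0_def by blast
  obtain \<eta> where \<eta>: "\<eta> \<in> test_functions \<Omega>" "modular (\<lambda>x. v x - \<eta> x) \<le> ennreal e"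
    "modular (\<lambda>x. h x - grad \<eta> x) \<le> ennreal e"
    using assms(2) e(1) unfolding W0_def by blast
  obtain K L where "C1_compact K \<psi>" "C1_compact L \<eta>"
    using test_function_C1 \<psi>(1) \<eta>(1) by metis
  then have gr: "grad (\<lambda>x. \<psi> x + \<eta> x) x = grad \<psi> x + grad \<eta> x" for x
    by (rule grad_add)
  note m = test_measurable[OF \<psi>(1)] test_measurable[OF \<eta>(1)] W0_measurable[OF assms(1)] W0_measurable[OF assms(2)]
  have "modular (\<lambda>x. (u x - \<psi> x) + (v x - \<eta> x)) \<le> ennreal \<epsilon>"
    using modular_add_le[OF _ _ \<psi>(2) \<eta>(2)] e m by simp
  moreover have "modular (\<lambda>x. (g x - grad \<psi> x) + (h x - grad \<eta> x)) \<le> ennreal \<epsilon>"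
    using modular_add_le[OF _ _ \<psi>(3) \<eta>(3)] e m by simp
  ultimately have "modular (\<lambda>x. u x + v x - (\<psi> x + \<eta> x)) \<le> ennreal \<epsilon>"
    "modular (\<lambda>x. g x + h x - grad (\<lambda>x. \<psi> x + \<eta> x) x) \<le> ennreal \<epsilon>"
    by (simp_all only: gr add_diff_add)
  then show "\<exists>w k. W0 w k \<and> modular (\<lambda>x. u x + v x - w x) \<le> ennreal \<epsilon> \<and> modular (\<lambda>x. g x + h x - k x) \<le> ennreal \<epsilon>"
    using W0_test[OF test_function_add[OF \<psi>(1) \<eta>(1)]] by blast
qed (use W0_measurable[OF assms(1)] W0_measurable[OF assms(2)] in auto)

lemma W0_scale:
  assumes "W0 u g"
  shows "W0 (\<lambda>x. c * u x) (\<lambda>x. c *\<^sub>R g x)"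
proof (rule W0_closed)
  fix \<epsilon> :: real assume \<epsilon>: "\<epsilon> > 0"
  define L where "L = max 1 (\<bar>c\<bar> powr p)"
  have L: "L \<ge> 1" by (simp add: L_def)
  define e where "e = \<epsilon> / L"
  have e: "e > 0" "L * e = \<epsilon>" using \<epsilon> L by (auto simp: e_def)
  obtain \<psi> where \<psi>: "\<psi> \<in> test_functions \<Omega>" "modular (\<lambda>x. u x - \<psi> x) \<le> ennreal e"
    "modular (\<lambda>x. g x - grad \<psi> x) \<le> ennreal e"
    using assms(1) e(1) unfolding W0_def by blast
  obtain K where "C1_compact K \<psi>"
    using test_function_C1 \<psi>(1) by metis
  then have gr: "grad (\<lambda>x. c * \<psi> x) x = c *\<^sub>R grad \<psi> x" for x
    by (rule grad_scale)
  note m = test_measurable[OF \<psi>(1)] W0_measurable[OF assms(1)]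
  have s: "X \<le> ennreal \<epsilon>" if "X \<le> ennreal L * Y" "Y \<le> ennreal e" for X Y
  proof -
    have "ennreal L * Y \<le> ennreal L * ennreal e" using that(2) by (rule mult_left_mono) simp
    also have "\<dots> = ennreal \<epsilon>" using e L by (simp add: ennreal_mult[symmetric])
    finally show ?thesis using that(1) by simp
  qed
  have "modular (\<lambda>x. c *\<^sub>R (u x - \<psi> x)) \<le> ennreal \<epsilon>"
    using modular_scale[of "\<lambda>x. u x - \<psi> x" c] \<psi>(2) m unfolding L_def[symmetric] by (intro s) auto
  moreover have "modular (\<lambda>x. c *\<^sub>R (g x - grad \<psi> x)) \<le> ennreal \<epsilon>"
    using modular_scale[of "\<lambda>x. g x - grad \<psi> x" c] \<psi>(3) m unfolding L_def[symmetric] by (intro s) auto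
  ultimately have "modular (\<lambda>x. c * u x - c * \<psi> x) \<le> ennreal \<epsilon>"
    "modular (\<lambda>x. c *\<^sub>R g x - grad (\<lambda>x. c * \<psi> x) x) \<le> ennreal \<epsilon>"
    by (simp_all add: gr algebra_simps)
  then show "\<exists>w k. W0 w k \<and> modular (\<lambda>x. c * u x - w x) \<le> ennreal \<epsilon> \<and> modular (\<lambda>x. c *\<^sub>R g x - k x) \<le> ennreal \<epsilon>"
    using W0_test[OF test_function_scale[OF \<psi>(1)]] by blast
qed (use W0_measurable[OF assms(1)] in auto)

lemma W0_diff:
  assumes "W0 u g" "W0 v h"
  shows "W0 (\<lambda>x. u x - v x) (\<lambda>x. g x - h x)"
  using W0_add[OF assms(1) W0_scale[OF assms(2), of "-1"]] by simp

text \<open>The inequality for test functions passes to limits at the price of one factor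
  \<open>Kq\<close> for the gradient and one for the function, which explains
  \<open>D\<close>.\<close>

lemma poincare:
  obtains C where "C \<ge> 0" "\<And>u g. W0 u g \<Longrightarrow> modular u \<le> ennreal C * modular g"
proof -
  obtain C where C: "C \<ge> 0" "\<And>\<psi>. \<psi> \<in> test_functions \<Omega> \<Longrightarrow> modular \<psi> \<le> ennreal C * modular (grad \<psi>)"
    using poincare_test by metis
  define D where "D = Kq * C * Kq"
  have D: "D \<ge> 0" using C Kq_ge_1 by (simp add: D_def)
  show thesis
  proof (rule that[OF D])
    fix u g assume W: "W0 u g"
    obtain G where G: "modular g = ennreal G" "G \<ge> 0"
      using W0_finite(2)[OF W] by (cases "modular g") auto
    show "modular u \<le> ennreal D * modular g"
    proof (rule ennreal_le_epsilon)
      fix e :: real assume e: "e > 0"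
      \<comment> \<open>The approximation errors \<open>Kq * d\<close> and \<open>D * d\<close> add
        up to \<open>e\<close>.\<close>
      define d where "d = e / (Kq + D)"
      have KD: "Kq + D > 0" using D Kq_ge_1 by simp
      then have d: "d > 0" "(Kq + D) * d = e" using e by (simp_all add: d_def)
      obtain \<psi> where \<psi>: "\<psi> \<in> test_functions \<Omega>" "modular (\<lambda>x. u x - \<psi> x) \<le> ennreal d"
        "modular (\<lambda>x. g x - grad \<psi> x) \<le> ennreal d"
        using W d(1) unfolding W0_def by blast
      note m = test_measurable[OF \<psi>(1)] W0_measurable[OF W]
      have "modular (\<lambda>x. (grad \<psi> x - g x) + g x) \<le> ennreal (Kq * (d + G))"
        using \<psi>(3) G d m by (intro modular_add_le) (auto simp: modular_minus_commute[of "grad \<psi>"])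
      then have "modular (grad \<psi>) \<le> ennreal (Kq * (d + G))" by simp
      then have "ennreal C * modular (grad \<psi>) \<le> ennreal C * ennreal (Kq * (d + G))"
        by (rule mult_left_mono) simp
      also have "\<dots> = ennreal (C * (Kq * (d + G)))"
        using C by (simp add: ennreal_mult')
      finally have "modular \<psi> \<le> ennreal (C * (Kq * (d + G)))"
        using C(2)[OF \<psi>(1)] by simp
      then have "modular (\<lambda>x. (u x - \<psi> x) + \<psi> x) \<le> ennreal (Kq * (d + C * (Kq * (d + G))))"
        using \<psi>(2) m C d G Kq_ge_1 by (intro modular_add_le) auto
      also have "Kq * (d + C * (Kq * (d + G))) = D * G + e"
        unfolding d(2)[symmetric] by (simp add: D_def algebra_simps)
      also have "ennreal (D * G + e) = ennreal D * modular g + ennreal e"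
        using D G e by (simp add: ennreal_mult)
      finally show "modular u \<le> ennreal D * modular g + ennreal e" by simp
    qed
  qed
qed

end

context orlicz_domain
begin

subsection \<open>Weak gradients of limits\<close>

lemma integrable_locally:
  assumes "integrable M f"
  shows "locally_integrable \<Omega> f"
  unfolding locally_integrable_def
proof (intro allI impI)
  fix K assume K: "compact K \<and> K \<subseteq> \<Omega>"
  then have Ks: "K \<in> sets lebesgue" using lmeasurable_compact[of K] by auto
  have "integrable lebesgue (\<lambda>x. indicat_real \<Omega> x *\<^sub>R f x)"
    using assms by (simp add: integrable_restrict_space)
  from integrable_mult_indicator[OF Ks this]
  have "integrable lebesgue (\<lambda>x. indicat_real K x *\<^sub>R (indicat_real \<Omega> x *\<^sub>R f x))" .
  moreover have "(\<lambda>x. indicat_real K x *\<^sub>R (indicat_real \<Omega> x *\<^sub>R f x)) = (\<lambda>x. indicat_real K x *\<^sub>R f x)"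
    using K by (auto simp: indicator_def fun_eq_iff)
  ultimately show "integrable (lebesgue_on K) f"
    using Ks by (simp add: integrable_restrict_space)
qed

lemma L1_tendsto_times_bounded:
  fixes f :: "nat \<Rightarrow> real^'n \<Rightarrow> real"
  assumes "\<And>n. integrable M (f n)" "integrable M g" "(\<lambda>n. \<integral>x. norm (f n x - g x) \<partial>M) \<longlonglongrightarrow> 0"
    and w: "w \<in> borel_measurable M" "\<And>x. \<bar>w x\<bar> \<le> B"
  shows "(\<lambda>n. \<integral>x. f n x * w x \<partial>M) \<longlonglongrightarrow> (\<integral>x. g x * w x \<partial>M)"
proof -
  have i: "integrable M (\<lambda>x. h x * w x)" if "integrable M h" for h
  proof (rule Bochner_Integration.integrable_bound)
    show "integrable M (\<lambda>x. B * h x)" using that by simp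
    show "AE x in M. norm (h x * w x) \<le> norm (B * h x)"
    proof (intro AE_I2)
      fix x
      have "\<bar>w x\<bar> \<le> \<bar>B\<bar>" using w(2)[of x] by linarith
      then have "\<bar>w x\<bar> * \<bar>h x\<bar> \<le> \<bar>B\<bar> * \<bar>h x\<bar>" by (rule mult_right_mono) simp
      then show "norm (h x * w x) \<le> norm (B * h x)"
        by (simp add: abs_mult mult.commute)
    qed
  qed (use that w in auto)
  show ?thesis
  proof (rule Lim_null_comparison[THEN LIM_zero_cancel])
    show "\<forall>\<^sub>F n in sequentially. norm ((\<integral>x. f n x * w x \<partial>M) - (\<integral>x. g x * w x \<partial>M))
        \<le> B * (\<integral>x. norm (f n x - g x) \<partial>M)"
    proof (rule always_eventually, rule allI)
      fix n
      have "norm ((\<integral>x. f n x * w x \<partial>M) - (\<integral>x. g x * w x \<partial>M)) = norm (\<integral>x. (f n x - g x) * w x \<partial>M)"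
        using i[OF assms(1)] i[OF assms(2)] by (simp add: left_diff_distrib)
      also have "\<dots> \<le> (\<integral>x. norm ((f n x - g x) * w x) \<partial>M)"
        by (rule integral_norm_bound)
      also have "\<dots> \<le> (\<integral>x. B * norm (f n x - g x) \<partial>M)"
      proof (rule integral_mono)
        show "norm ((f n x - g x) * w x) \<le> B * norm (f n x - g x)" for x
          using mult_right_mono[OF w(2)[of x], of "\<bar>f n x - g x\<bar>"] by (simp add: abs_mult mult.commute)
      qed (use assms(1,2) i in auto)
      also have "\<dots> = B * (\<integral>x. norm (f n x - g x) \<partial>M)" by simp
      finally show "norm ((\<integral>x. f n x * w x \<partial>M) - (\<integral>x. g x * w x \<partial>M))
        \<le> B * (\<integral>x. norm (f n x - g x) \<partial>M)" .
    qed
    show "(\<lambda>n. B * (\<integral>x. norm (f n x - g x) \<partial>M)) \<longlonglongrightarrow> 0"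
      using tendsto_mult_left[OF assms(3), of B] by simp
  qed
qed

lemma test_integration_by_parts:
  assumes "\<psi> \<in> test_functions \<Omega>" "\<eta> \<in> test_functions \<Omega>"
  shows "(\<integral>x. \<psi> x * (grad \<eta> x $ i) \<partial>M) = - (\<integral>x. grad \<psi> x $ i * \<eta> x \<partial>M)"
proof -
  obtain K where K: "C1_compact K \<psi>" "K \<subseteq> \<Omega>" using assms(1) by (rule test_function_C1)
  obtain L where L: "C1_compact L \<eta>" "L \<subseteq> \<Omega>" using assms(2) by (rule test_function_C1)
  have z: "\<psi> x = 0" "\<eta> x = 0" if "x \<notin> \<Omega>" for x
    using that K L by (auto simp: C1_compact_def)
  have m: "(\<lambda>x. \<psi> x * (grad \<eta> x $ i)) \<in> borel_measurable borel"
    "(\<lambda>x. grad \<psi> x $ i * \<eta> x) \<in> borel_measurable borel"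
    by (intro borel_measurable_times C1_compact_borel[OF K(1)] C1_compact_borel[OF L(1)])+
  show ?thesis
    using integration_by_parts[OF K(1) L(1), of i]
      lebesgue_on_lborel(2)[OF m(1) _ dom_sets] lebesgue_on_lborel(2)[OF m(2) _ dom_sets] z by simp
qed

lemma W0_integrable:
  assumes "W0 u g"
  shows "integrable M u" "integrable M g" "integrable M (\<lambda>x. g x $ i)"
proof -
  show "integrable M u" "integrable M g"
    using modular_integrable(3) W0_measurable[OF assms] W0_finite[OF assms] by blast+
  then show "integrable M (\<lambda>x. g x $ i)"
    using integrable_bounded_linear[OF bounded_linear_vec_nth] by blast
qed

text \<open>Integration by parts holds for the approximating test functions. Both sides pass to the
  limit, since modular convergence gives L1 convergence and the test function \<open>\<eta>\<close>
  and its gradient are bounded.\<close>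

lemma W0_is_weak_gradient:
  assumes W: "W0 u g"
  shows "is_weak_gradient \<Omega> u g"
  unfolding is_weak_gradient_def
proof (intro conjI allI ballI)
  show "locally_integrable \<Omega> u"
    by (rule integrable_locally[OF W0_integrable(1)[OF W]])
  fix i
  show "locally_integrable \<Omega> (\<lambda>x. g x $ i)"
    by (rule integrable_locally[OF W0_integrable(3)[OF W]])
  fix \<eta> assume t: "\<eta> \<in> test_functions \<Omega>"
  obtain \<psi> where \<psi>: "\<And>n. \<psi> n \<in> test_functions \<Omega>" "(\<lambda>n. modular (\<lambda>x. \<psi> n x - u x)) \<longlonglongrightarrow> 0"
    "(\<lambda>n. modular (\<lambda>x. grad (\<psi> n) x - g x)) \<longlonglongrightarrow> 0"
    using W by (rule W0_seq) blast
  obtain L where L: "C1_compact L \<eta>" "L \<subseteq> \<Omega>" using t by (rule test_function_C1)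
  obtain B where B: "\<And>x. \<bar>\<eta> x\<bar> \<le> B" "\<And>x. norm (grad \<eta> x) \<le> B"
    using t by (rule test_function_bounded) blast
  then have B': "\<bar>grad \<eta> x $ i\<bar> \<le> B" for x
    using component_le_norm_cart order_trans by blast
  note m = test_measurable[OF t] test_measurable[OF \<psi>(1)] W0_measurable[OF W]
  have lim1: "(\<lambda>n. \<integral>x. \<psi> n x * (grad \<eta> x $ i) \<partial>M) \<longlonglongrightarrow> (\<integral>x. u x * (grad \<eta> x $ i) \<partial>M)"
    using modular_tendsto_L1[OF _ \<psi>(2)] m
    by (intro L1_tendsto_times_bounded[OF W0_integrable(1)[OF W0_test[OF \<psi>(1)]] W0_integrable(1)[OF W] _ _ B'])
      (auto intro!: measurable_M C1_compact_borel(3)[OF L(1)])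
  have lim2: "(\<lambda>n. \<integral>x. grad (\<psi> n) x $ i * \<eta> x \<partial>M) \<longlonglongrightarrow> (\<integral>x. g x $ i * \<eta> x \<partial>M)"
  proof (intro L1_tendsto_times_bounded[OF W0_integrable(3)[OF W0_test[OF \<psi>(1)]] W0_integrable(3)[OF W] _ m(1) B(1)])
    have L: "(\<lambda>n. \<integral>x. norm (grad (\<psi> n) x - g x) \<partial>M) \<longlonglongrightarrow> 0"
      by (rule modular_tendsto_L1[OF _ \<psi>(3)]) (use m in auto)
    show "(\<lambda>n. \<integral>x. norm (grad (\<psi> n) x $ i - g x $ i) \<partial>M) \<longlonglongrightarrow> 0"
    proof (rule tendsto_sandwich[OF _ _ tendsto_const L])
      show "\<forall>\<^sub>F n in sequentially. 0 \<le> (\<integral>x. norm (grad (\<psi> n) x $ i - g x $ i) \<partial>M)"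
        by simp
      show "\<forall>\<^sub>F n in sequentially. (\<integral>x. norm (grad (\<psi> n) x $ i - g x $ i) \<partial>M)
          \<le> (\<integral>x. norm (grad (\<psi> n) x - g x) \<partial>M)"
      proof (rule always_eventually, rule allI, rule integral_mono)
        fix n x
        show "norm (grad (\<psi> n) x $ i - g x $ i) \<le> norm (grad (\<psi> n) x - g x)"
          using component_le_norm_cart[of "grad (\<psi> n) x - g x" i] by simp
      qed (use W0_integrable[OF W0_test[OF \<psi>(1)]] W0_integrable[OF W] in auto)
    qed
  qed
  have "(\<lambda>n. \<integral>x. \<psi> n x * (grad \<eta> x $ i) \<partial>M) = (\<lambda>n. - (\<integral>x. grad (\<psi> n) x $ i * \<eta> x \<partial>M))"
    using test_integration_by_parts[OF \<psi>(1) t] by (intro ext)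
  then have "(\<integral>x. u x * (grad \<eta> x $ i) \<partial>M) = - (\<integral>x. g x $ i * \<eta> x \<partial>M)"
    using LIMSEQ_unique[OF lim1] tendsto_minus[OF lim2] by simp
  then show "(\<integral>x. u x * frechet_derivative \<eta> (at x) (axis i 1) \<partial>M) = - (\<integral>x. g x $ i * \<eta> x \<partial>M)"
    by (simp add: grad_def)
qed

text \<open>Rests on completeness of Lebesgue measure. It is what makes the arbitrarily chosen
  \<open>weak_gradient\<close> measurable, as that is known only up to null sets.\<close>

lemma measurable_AE_cong:
  fixes f g :: "real^'n \<Rightarrow> 'b::euclidean_space"
  assumes "f \<in> borel_measurable M" "AE x in M. f x = g x"
  shows "g \<in> borel_measurable M"
proof -
  have "(\<lambda>x. indicat_real \<Omega> x *\<^sub>R f x) \<in> borel_measurable lebesgue"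
    using assms(1) by (simp add: borel_measurable_restrict_space_iff)
  moreover have "AE x in lebesgue. indicat_real \<Omega> x *\<^sub>R f x = indicat_real \<Omega> x *\<^sub>R g x"
    using assms(2) by (simp add: AE_restrict_space_iff) (erule eventually_mono, auto simp: indicator_def)
  ultimately have "(\<lambda>x. indicat_real \<Omega> x *\<^sub>R g x) \<in> borel_measurable lebesgue"
    by (rule borel_measurable_AE)
  then show ?thesis by (simp add: borel_measurable_restrict_space_iff)
qed

lemma W0_weak_gradient:
  assumes "W0 u g"
  shows "AE x in M. weak_gradient \<Omega> u x = g x" "weak_gradient \<Omega> u \<in> borel_measurable M"
    "W0 u (weak_gradient \<Omega> u)"
proof -
  show ae: "AE x in M. weak_gradient \<Omega> u x = g x"
    by (rule weak_gradient_eq[OF open_dom W0_is_weak_gradient[OF assms]])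
  show m: "weak_gradient \<Omega> u \<in> borel_measurable M"
    using W0_measurable(2)[OF assms] by (rule measurable_AE_cong) (use ae in eventually_elim, simp)
  show "W0 u (weak_gradient \<Omega> u)"
    by (rule W0_cong[OF assms _ _ W0_measurable(1)[OF assms] m]) (use ae in \<open>auto elim: eventually_mono\<close>)
qed

subsection \<open>Comparison with the Luxemburg norm\<close>

text \<open>Dividing by \<open>\<epsilon>\<close> costs at most the factor
  \<open>(1 / \<epsilon>) powr p\<close>, so a modular of at most \<open>\<epsilon> powr p\<close>
  makes \<open>\<epsilon>\<close> itself admissible in the infimum.\<close>

lemma luxemburg_norm_le:
  assumes "w \<in> borel_measurable M" "0 < \<epsilon>" "\<epsilon> \<le> 1" "modular w \<le> ennreal (\<epsilon> powr p)"
  shows "luxemburg_norm \<Phi> \<Omega> w \<le> \<epsilon>"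
  unfolding luxemburg_norm_def
proof (rule cInf_lower)
  have "modular (\<lambda>x. (1 / \<epsilon>) *\<^sub>R w x) \<le> ennreal (max 1 (\<bar>1 / \<epsilon>\<bar> powr p)) * modular w"
    by (rule modular_scale[OF assms(1)])
  also have "max 1 (\<bar>1 / \<epsilon>\<bar> powr p) = (1 / \<epsilon>) powr p"
    using assms p_gt_1 by (simp add: ge_one_powr_ge_zero)
  also have "ennreal ((1 / \<epsilon>) powr p) * modular w \<le> ennreal ((1 / \<epsilon>) powr p) * ennreal (\<epsilon> powr p)"
    using assms(4) by (rule mult_left_mono) simp
  also have "\<dots> = 1"
    using assms by (simp add: ennreal_mult[symmetric] powr_mult[symmetric])
  finally show "\<epsilon> \<in> {l. 0 < l \<and> (\<integral>\<^sup>+x. ennreal (\<Phi> (w x / l)) \<partial>M) \<le> 1}"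
    using assms by (simp add: modular_real divide_inverse mult.commute)
qed (auto intro!: bdd_belowI[of _ 0])

lemma orlicz_modular:
  assumes "w \<in> orlicz \<Phi> \<Omega>"
  shows "w \<in> borel_measurable M" "modular w < \<infinity>"
proof -
  show m: "w \<in> borel_measurable M" using assms by (simp add: orlicz_def)
  obtain l where l: "l > 0" "(\<integral>\<^sup>+x. ennreal (\<Phi> (w x / l)) \<partial>M) < \<infinity>"
    using assms by (auto simp: orlicz_def)
  then have "modular (\<lambda>x. w x / l) < \<infinity>" by (simp add: modular_real)
  from modular_finite_scale[OF _ this, of l] m l(1) show "modular w < \<infinity>" by simp
qed

lemma modular_orlicz:
  "w \<in> borel_measurable M \<Longrightarrow> modular w < \<infinity> \<Longrightarrow> w \<in> orlicz \<Phi> \<Omega>"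
  by (auto simp: orlicz_def modular_real intro!: exI[of _ 1])

text \<open>The infimum of the empty set of reals would carry no information. By convexity every
  scale \<open>k \<ge> 1\<close> not below the modular is admissible.\<close>

lemma luxemburg_nonempty:
  assumes m [measurable]: "w \<in> borel_measurable M" and fin: "modular w < \<infinity>"
  shows "{l. l > 0 \<and> (\<integral>\<^sup>+x. ennreal (\<Phi> (w x / l)) \<partial>M) \<le> 1} \<noteq> {}"
proof -
  obtain G where G: "modular w = ennreal G" "G \<ge> 0" using fin by (cases "modular w") auto
  define k where "k = max 1 G"
  have k: "k \<ge> 1" "G \<le> k" by (auto simp: k_def)
  have "(\<integral>\<^sup>+x. ennreal (\<Phi> (w x / k)) \<partial>M) \<le> (\<integral>\<^sup>+x. ennreal (1 / k) * ennreal (\<Phi> (w x)) \<partial>M)"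
  proof (rule nn_integral_mono)
    fix x
    show "ennreal (\<Phi> (w x / k)) \<le> ennreal (1 / k) * ennreal (\<Phi> (w x))"
      using Phi_scale_le_1[of "1 / k" "w x"] k by (simp add: ennreal_mult[symmetric] Phi_nonneg ennreal_leI)
  qed
  also have "\<dots> = ennreal (1 / k) * modular w"
    unfolding modular_real using m by (intro nn_integral_cmult) measurable
  also have "\<dots> \<le> 1"
    using G k by (simp add: ennreal_mult[symmetric])
  finally show ?thesis using k(1) by (auto intro!: exI[of _ k])
qed

lemma luxemburg_norm_nonneg:
  assumes "w \<in> borel_measurable M" "modular w < \<infinity>"
  shows "luxemburg_norm \<Phi> \<Omega> w \<ge> 0"
  unfolding luxemburg_norm_def by (rule cInf_greatest[OF luxemburg_nonempty[OF assms]]) auto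

text \<open>Some admissible \<open>l < \<epsilon> \<le> 1\<close> exists, and
  \<open>\<Phi> (l * t) \<le> l * \<Phi> t\<close> bounds the modular by \<open>l\<close>.\<close>

lemma luxemburg_norm_less:
  assumes m [measurable]: "w \<in> borel_measurable M" and fin: "modular w < \<infinity>"
    and less: "luxemburg_norm \<Phi> \<Omega> w < \<epsilon>" "\<epsilon> \<le> 1"
  shows "modular w \<le> ennreal \<epsilon>"
proof -
  let ?S = "{l. l > 0 \<and> (\<integral>\<^sup>+x. ennreal (\<Phi> (w x / l)) \<partial>M) \<le> 1}"
  have scale: "modular w \<le> ennreal l" if "0 < l" "l \<le> 1" "(\<integral>\<^sup>+x. ennreal (\<Phi> (w x / l)) \<partial>M) \<le> 1" for l
  proof -
    have "modular w \<le> (\<integral>\<^sup>+x. ennreal l * ennreal (\<Phi> (w x / l)) \<partial>M)"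
      unfolding modular_real
    proof (rule nn_integral_mono)
      fix x
      show "ennreal (\<Phi> (w x)) \<le> ennreal l * ennreal (\<Phi> (w x / l))"
        using Phi_scale_le_1[of l "w x / l"] that by (simp add: ennreal_mult[symmetric] Phi_nonneg ennreal_leI)
    qed
    also have "\<dots> = ennreal l * (\<integral>\<^sup>+x. ennreal (\<Phi> (w x / l)) \<partial>M)"
      using m by (intro nn_integral_cmult) measurable
    also have "\<dots> \<le> ennreal l * 1" using that(3) by (rule mult_left_mono) simp
    finally show ?thesis by simp
  qed
  have "?S \<noteq> {}" by (rule luxemburg_nonempty[OF m fin])
  then obtain l where "l \<in> ?S" "l < \<epsilon>"
    using less(1) unfolding luxemburg_norm_def by (rule cInf_lessD[THEN bexE])
  then have "modular w \<le> ennreal l" using less(2) by (intro scale) auto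
  also have "\<dots> \<le> ennreal \<epsilon>" using \<open>l < \<epsilon>\<close> by (intro ennreal_leI) simp
  finally show ?thesis .
qed

lemma W0_imp_orlicz_sobolev0:
  assumes W: "W0 u g"
  shows "u \<in> orlicz_sobolev0 \<Phi> \<Omega>"
proof -
  note wg = W0_weak_gradient[OF W]
  have comp: "(\<lambda>x. weak_gradient \<Omega> u x $ i) \<in> orlicz \<Phi> \<Omega>" for i
  proof (rule modular_orlicz)
    show "(\<lambda>x. weak_gradient \<Omega> u x $ i) \<in> borel_measurable M"
      using W0_integrable(3)[OF wg(3)] by auto
    have "modular (\<lambda>x. weak_gradient \<Omega> u x $ i) \<le> modular (weak_gradient \<Omega> u)"
      by (rule modular_mono) (simp add: component_le_norm_cart)
    then show "modular (\<lambda>x. weak_gradient \<Omega> u x $ i) < \<infinity>"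
      using W0_finite(2)[OF wg(3)] by (rule le_less_trans)
  qed
  have "\<exists>\<psi>\<in>test_functions \<Omega>. orlicz_sobolev_norm \<Phi> \<Omega> (\<lambda>x. u x - \<psi> x) < \<epsilon>" if \<epsilon>: "\<epsilon> > 0" for \<epsilon>
  proof -
    \<comment> \<open>The cap at 1 is what \<open>luxemburg_norm_le\<close> asks for; the third
      keeps the sum of the two norms strictly below \<open>\<epsilon>\<close>.\<close>
    define e where "e = min (\<epsilon> / 3) 1"
    have e: "0 < e" "e \<le> 1" "e + e < \<epsilon>" using \<epsilon> by (auto simp: e_def min_def)
    have "e powr p > 0" using e(1) by simp
    then obtain \<psi> where \<psi>: "\<psi> \<in> test_functions \<Omega>" "modular (\<lambda>x. u x - \<psi> x) \<le> ennreal (e powr p)"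
      "modular (\<lambda>x. g x - grad \<psi> x) \<le> ennreal (e powr p)"
      using W unfolding W0_def by blast
    have D: "W0 (\<lambda>x. u x - \<psi> x) (\<lambda>x. g x - grad \<psi> x)"
      by (rule W0_diff[OF W W0_test[OF \<psi>(1)]])
    note wD = W0_weak_gradient[OF D]
    have "modular (\<lambda>x. norm (weak_gradient \<Omega> (\<lambda>x. u x - \<psi> x) x)) = modular (\<lambda>x. g x - grad \<psi> x)"
      unfolding modular_norm by (rule modular_cong[OF wD(1)])
    then have "luxemburg_norm \<Phi> \<Omega> (\<lambda>x. norm (weak_gradient \<Omega> (\<lambda>x. u x - \<psi> x) x)) \<le> e"
      using wD(2) \<psi>(3) e by (intro luxemburg_norm_le) auto
    moreover have "luxemburg_norm \<Phi> \<Omega> (\<lambda>x. u x - \<psi> x) \<le> e"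
      using W0_measurable(1)[OF D] \<psi>(2) e by (intro luxemburg_norm_le) auto
    ultimately show ?thesis
      using \<psi>(1) e(3) by (intro bexI[of _ \<psi>]) (auto simp: orlicz_sobolev_norm_def)
  qed
  then show ?thesis
    using comp W0_is_weak_gradient[OF W] modular_orlicz[OF W0_measurable(1)[OF W] W0_finite(1)[OF W]]
    by (auto simp: orlicz_sobolev0_def orlicz_sobolev_def)
qed

lemma modular_components_finite:
  fixes g :: "real^'n \<Rightarrow> real^'n"
  assumes "\<And>i. (\<lambda>x. g x $ i) \<in> borel_measurable M" "\<And>i. modular (\<lambda>x. g x $ i) < \<infinity>"
  shows "g \<in> borel_measurable M" "modular g < \<infinity>"
proof -
  show m: "g \<in> borel_measurable M"
  proof (rule borel_measurable_euclidean_space[THEN iffD2], rule ballI)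
    fix b :: "real^'n" assume "b \<in> Basis"
    then obtain i where "b = axis i 1" by (auto simp: Basis_vec_def)
    then show "(\<lambda>x. g x \<bullet> b) \<in> borel_measurable M"
      using assms(1)[of i] by (simp add: inner_axis)
  qed
  have "modular (\<lambda>x. \<Sum>i\<in>I. \<bar>g x $ i\<bar>) < \<infinity>" if "finite I" for I
    using that
  proof induction
    case empty
    show ?case by (simp add: modular_def)
  next
    case (insert j I)
    have "modular (\<lambda>x. \<bar>g x $ j\<bar>) < \<infinity>"
      using assms(2)[of j] modular_norm[of "\<lambda>x. g x $ j"] by simp
    from modular_finite_add[OF _ _ this insert.IH] show ?case
      using insert assms(1) by simp
  qed
  then have "modular (\<lambda>x. \<Sum>i\<in>UNIV. \<bar>g x $ i\<bar>) < \<infinity>" by simp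
  moreover have "modular g \<le> modular (\<lambda>x. \<Sum>i\<in>UNIV. \<bar>g x $ i\<bar>)"
  proof (rule modular_mono, rule AE_I2)
    fix x
    show "norm (g x) \<le> norm (\<Sum>i\<in>UNIV. \<bar>g x $ i\<bar>)"
      using norm_le_l1_cart[of "g x"] by (simp add: sum_nonneg)
  qed
  ultimately show "modular g < \<infinity>" by (metis le_less_trans)
qed

text \<open>Converse to \<open>W0_imp_orlicz_sobolev0\<close>, with the chosen gradient as second
  component: each of the two nonnegative norms is below the bound on their sum, and small norm means
  small modular. The test class of \<open>weak_solution\<close> is thereby described by
  \<open>W0\<close>.\<close>

lemma orlicz_sobolev0_imp_W0:
  assumes u: "u \<in> orlicz_sobolev0 \<Phi> \<Omega>"
  shows "W0 u (weak_gradient \<Omega> u)"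
proof -
  let ?g = "weak_gradient \<Omega> u"
  have o: "u \<in> orlicz \<Phi> \<Omega>" "\<And>i. (\<lambda>x. ?g x $ i) \<in> orlicz \<Phi> \<Omega>" and wg: "is_weak_gradient \<Omega> u ?g"
    using u is_weak_gradient_weak_gradient by (auto simp: orlicz_sobolev0_def orlicz_sobolev_def)
  note uo = orlicz_modular[OF o(1)]
  note go = modular_components_finite[OF orlicz_modular[OF o(2)]]
  show ?thesis
    unfolding W0_def
  proof (intro conjI allI impI uo(1) go(1))
    fix \<epsilon> :: real assume \<epsilon>: "\<epsilon> > 0"
    define e where "e = min \<epsilon> 1"
    have e: "0 < e" "e \<le> 1" "e \<le> \<epsilon>" using \<epsilon> by (auto simp: e_def)
    obtain \<psi> where \<psi>: "\<psi> \<in> test_functions \<Omega>" "orlicz_sobolev_norm \<Phi> \<Omega> (\<lambda>x. u x - \<psi> x) < e"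
      using u e(1) by (auto simp: orlicz_sobolev0_def)
    let ?w = "weak_gradient \<Omega> (\<lambda>x. u x - \<psi> x)"
    have ae: "AE x in M. ?w x = ?g x - grad \<psi> x"
      by (rule weak_gradient_eq[OF open_dom is_weak_gradient_diff[OF open_dom wg W0_is_weak_gradient[OF W0_test[OF \<psi>(1)]]]])
    note m = test_measurable[OF \<psi>(1)]
    have wm: "?w \<in> borel_measurable M"
      by (rule measurable_AE_cong[of "\<lambda>x. ?g x - grad \<psi> x"])
        (use m go ae in \<open>auto elim: eventually_mono\<close>)
    have mo: "modular ?w = modular (\<lambda>x. ?g x - grad \<psi> x)"
      by (rule modular_cong[OF ae])
    have f: "modular \<psi> < \<infinity>" "modular (grad \<psi>) < \<infinity>"
      using W0_finite[OF W0_test[OF \<psi>(1)]] by auto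
    have f1: "modular (\<lambda>x. u x - \<psi> x) < \<infinity>"
      using modular_finite_add[OF _ _ uo(2) modular_finite_scale[OF m(1) f(1), of "-1"]] uo(1) m by simp
    have f2: "modular (\<lambda>x. ?g x - grad \<psi> x) < \<infinity>"
      using modular_finite_add[OF _ _ go(2) modular_finite_scale[OF m(2) f(2), of "-1"]] go(1) m by simp
    have "luxemburg_norm \<Phi> \<Omega> (\<lambda>x. u x - \<psi> x) + luxemburg_norm \<Phi> \<Omega> (\<lambda>x. norm (?w x)) < e"
      using \<psi>(2) by (simp add: orlicz_sobolev_norm_def)
    moreover have "luxemburg_norm \<Phi> \<Omega> (\<lambda>x. u x - \<psi> x) \<ge> 0" "luxemburg_norm \<Phi> \<Omega> (\<lambda>x. norm (?w x)) \<ge> 0"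
      using luxemburg_norm_nonneg f1 f2 mo wm uo(1) m by (auto simp: modular_norm)
    ultimately have le: "luxemburg_norm \<Phi> \<Omega> (\<lambda>x. u x - \<psi> x) < e" "luxemburg_norm \<Phi> \<Omega> (\<lambda>x. norm (?w x)) < e"
      by linarith+
    have "modular (\<lambda>x. u x - \<psi> x) \<le> ennreal e"
      by (rule luxemburg_norm_less[OF _ f1 le(1) e(2)]) (use uo(1) m in simp)
    moreover have "modular (\<lambda>x. norm (?w x)) \<le> ennreal e"
      by (rule luxemburg_norm_less[OF _ _ le(2) e(2)]) (use wm f2 mo in \<open>simp_all add: modular_norm\<close>)
    moreover have "ennreal e \<le> ennreal \<epsilon>" using e by (intro ennreal_leI)
    ultimately show "\<exists>\<psi>\<in>test_functions \<Omega>. modular (\<lambda>x. u x - \<psi> x) \<le> ennreal \<epsilon> \<and> modular (\<lambda>x. ?g x - grad \<psi> x) \<le> ennreal \<epsilon>"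
      using \<psi>(1) mo by (intro bexI[of _ \<psi>]) (auto simp: modular_norm)
  qed
qed

subsection \<open>Completeness\<close>

text \<open>Only the gradients are assumed Cauchy; the functions follow by the Poincare inequality
  for differences. Through L1, limits are obtained almost everywhere along a subsequence, and
  Fatou's lemma upgrades them to modular limits.\<close>

lemma W0_Cauchy:
  fixes u :: "nat \<Rightarrow> real^'n \<Rightarrow> real" and g :: "nat \<Rightarrow> real^'n \<Rightarrow> real^'n"
  assumes W: "\<And>n. W0 (u n) (g n)"
    and Cauchy: "\<And>e. e > 0 \<Longrightarrow> \<exists>N. \<forall>i\<ge>N. \<forall>j\<ge>N. modular (\<lambda>x. g i x - g j x) \<le> ennreal e"
  obtains v h r where "W0 v h" "strict_mono r" "AE x in M. (\<lambda>n. u (r n) x) \<longlonglongrightarrow> v x"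
    "AE x in M. (\<lambda>n. g (r n) x) \<longlonglongrightarrow> h x"
proof -
  obtain C where C: "C \<ge> 0" "\<And>u g. W0 u g \<Longrightarrow> modular u \<le> ennreal C * modular g"
    by (rule poincare) blast
  have Cauchy_u: "\<exists>N. \<forall>i\<ge>N. \<forall>j\<ge>N. modular (\<lambda>x. u i x - u j x) \<le> ennreal e" if e: "e > 0" for e
  proof -
    have "e / (C + 1) > 0" using e C by simp
    then obtain N where N: "\<forall>i\<ge>N. \<forall>j\<ge>N. modular (\<lambda>x. g i x - g j x) \<le> ennreal (e / (C + 1))"
      using Cauchy by blast
    have "modular (\<lambda>x. u i x - u j x) \<le> ennreal e" if "i \<ge> N" "j \<ge> N" for i j
    proof -
      have "modular (\<lambda>x. u i x - u j x) \<le> ennreal C * modular (\<lambda>x. g i x - g j x)"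
        by (rule C(2)[OF W0_diff[OF W W]])
      also have "\<dots> \<le> ennreal C * ennreal (e / (C + 1))"
        using N that by (intro mult_left_mono) auto
      also have "\<dots> = ennreal (C * (e / (C + 1)))" by (simp only: ennreal_mult'[OF C(1)])
      also have "\<dots> \<le> ennreal e"
        using C e by (intro ennreal_leI) (simp add: field_simps)
      finally show ?thesis .
    qed
    then show ?thesis by blast
  qed
  have L1: "\<exists>N. \<forall>i\<ge>N. \<forall>j\<ge>N. (\<integral>x. norm (f i x - f j x) \<partial>M) < e"
    if e: "e > 0" and fm: "\<And>n. f n \<in> borel_measurable M"
      and fC: "\<And>e. e > 0 \<Longrightarrow> \<exists>N. \<forall>i\<ge>N. \<forall>j\<ge>N. modular (\<lambda>x. f i x - f j x) \<le> ennreal e"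
    for e and f :: "nat \<Rightarrow> real^'n \<Rightarrow> 'b::euclidean_space"
  proof -
    obtain d where d: "d > 0" "\<And>f :: real^'n \<Rightarrow> 'b.
        f \<in> borel_measurable M \<Longrightarrow> modular f \<le> ennreal d \<Longrightarrow> (\<integral>x. norm (f x) \<partial>M) < e"
      using e by (rule modular_small_L1) blast
    obtain N where "\<forall>i\<ge>N. \<forall>j\<ge>N. modular (\<lambda>x. f i x - f j x) \<le> ennreal d"
      using fC[OF d(1)] by blast
    then show ?thesis
      using fm by (intro exI[of _ N] allI impI d(2)) auto
  qed
  obtain r1 where r1: "strict_mono r1" "AE x in M. Cauchy (\<lambda>i. g (r1 i) x)"
  proof (rule cauchy_L1_AE_cauchy_subseq[of M g])
    show "integrable M (g n)" for n by (rule W0_integrable(2)[OF W])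
    show "\<exists>N. \<forall>i\<ge>N. \<forall>j\<ge>N. (\<integral>x. norm (g i x - g j x) \<partial>M) < e" if "e > 0" for e
      using that W0_measurable(2)[OF W] Cauchy by (rule L1)
  qed blast
  have Cu: "\<exists>N. \<forall>i\<ge>N. \<forall>j\<ge>N. modular (\<lambda>x. u (r1 i) x - u (r1 j) x) \<le> ennreal e" if e: "e > 0" for e
    using Cauchy_u[OF e] seq_suble[OF r1(1)] by (meson order_trans)
  obtain r2 where r2: "strict_mono r2" "AE x in M. Cauchy (\<lambda>i. u (r1 (r2 i)) x)"
  proof (rule cauchy_L1_AE_cauchy_subseq[of M "\<lambda>i. u (r1 i)"])
    show "integrable M (u (r1 n))" for n by (rule W0_integrable(1)[OF W])
    show "\<exists>N. \<forall>i\<ge>N. \<forall>j\<ge>N. (\<integral>x. norm (u (r1 i) x - u (r1 j) x) \<partial>M) < e" if "e > 0" for e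
      using that W0_measurable(1)[OF W] Cu by (rule L1)
  qed blast
  define r where "r = r1 \<circ> r2"
  have r: "strict_mono r" unfolding r_def using r1(1) r2(1) by (rule strict_mono_o)
  define v where "v = (\<lambda>x. lim (\<lambda>n. u (r n) x))"
  define h where "h = (\<lambda>x. lim (\<lambda>n. g (r n) x))"
  have vm: "v \<in> borel_measurable M" and hm: "h \<in> borel_measurable M"
    unfolding v_def h_def using W0_measurable[OF W] by (auto intro!: borel_measurable_lim_metric)
  have vae: "AE x in M. (\<lambda>n. u (r n) x) \<longlonglongrightarrow> v x"
    using r2(2)
  proof eventually_elim
    fix x assume "Cauchy (\<lambda>i. u (r1 (r2 i)) x)"
    then have "convergent (\<lambda>n. u (r n) x)" by (simp add: r_def Cauchy_convergent_iff)
    then show "(\<lambda>n. u (r n) x) \<longlonglongrightarrow> v x" by (simp add: v_def convergent_LIMSEQ_iff)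
  qed
  have hae: "AE x in M. (\<lambda>n. g (r n) x) \<longlonglongrightarrow> h x"
    using r1(2)
  proof eventually_elim
    fix x assume "Cauchy (\<lambda>i. g (r1 i) x)"
    from Cauchy_subseq_Cauchy[OF this r2(1)] have "convergent (\<lambda>n. g (r n) x)"
      by (simp add: r_def Cauchy_convergent_iff o_def)
    then show "(\<lambda>n. g (r n) x) \<longlonglongrightarrow> h x" by (simp add: h_def convergent_LIMSEQ_iff)
  qed
  \<comment> \<open>Keep \<open>i\<close> fixed and let the other index run along \<open>r\<close>:
    the Cauchy bound survives in the limit by Fatou.\<close>
  have lim: "\<exists>N. \<forall>i\<ge>N. modular (\<lambda>x. f i x - k x) \<le> ennreal e"
    if fm: "\<And>n. f n \<in> borel_measurable M" and fk: "AE x in M. (\<lambda>n. f (r n) x) \<longlonglongrightarrow> k x" and "e > 0"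
      and fC: "\<exists>N. \<forall>i\<ge>N. \<forall>j\<ge>N. modular (\<lambda>x. f i x - f j x) \<le> ennreal e"
    for f :: "nat \<Rightarrow> real^'n \<Rightarrow> 'b::euclidean_space" and k e
  proof -
    obtain N where N: "\<forall>i\<ge>N. \<forall>j\<ge>N. modular (\<lambda>x. f i x - f j x) \<le> ennreal e"
      using fC by blast
    have "modular (\<lambda>x. f i x - k x) \<le> ennreal e" if i: "i \<ge> N" for i
    proof (rule modular_fatou[where f = "\<lambda>n x. f i x - f (r n) x"])
      show "(\<lambda>x. f i x - f (r n) x) \<in> borel_measurable M" for n using fm by simp
      show "AE x in M. (\<lambda>n. f i x - f (r n) x) \<longlonglongrightarrow> f i x - k x"
        using fk by eventually_elim (intro tendsto_intros)
      show "\<forall>\<^sub>F n in sequentially. modular (\<lambda>x. f i x - f (r n) x) \<le> ennreal e"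
        using eventually_ge_at_top[of N]
      proof eventually_elim
        fix n assume "N \<le> n"
        then have "N \<le> r n" using seq_suble[OF r, of n] by simp
        then show "modular (\<lambda>x. f i x - f (r n) x) \<le> ennreal e" using N i by blast
      qed
    qed
    then show ?thesis by blast
  qed
  have "W0 v h"
  proof (rule W0_closed[OF vm hm])
    fix e :: real assume e: "e > 0"
    obtain N1 where N1: "\<forall>i\<ge>N1. modular (\<lambda>x. u i x - v x) \<le> ennreal e"
      using lim[OF W0_measurable(1)[OF W] vae e Cauchy_u[OF e]] by blast
    obtain N2 where N2: "\<forall>i\<ge>N2. modular (\<lambda>x. g i x - h x) \<le> ennreal e"
      using lim[OF W0_measurable(2)[OF W] hae e Cauchy[OF e]] by blast
    show "\<exists>u' g'. W0 u' g' \<and> modular (\<lambda>x. v x - u' x) \<le> ennreal e \<and> modular (\<lambda>x. h x - g' x) \<le> ennreal e"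
      using W[of "max N1 N2"] N1 N2 modular_minus_commute[of v] modular_minus_commute[of h]
      by (metis max.cobounded1 max.cobounded2)
  qed
  then show thesis using that r vae hae by blast
qed

subsection \<open>Truncation\<close>

lemma modular_add_tendsto:
  fixes f g :: "nat \<Rightarrow> real^'n \<Rightarrow> 'b::euclidean_space"
  assumes "\<And>n. f n \<in> borel_measurable M" "\<And>n. g n \<in> borel_measurable M"
    "(\<lambda>n. modular (f n)) \<longlonglongrightarrow> 0" "(\<lambda>n. modular (g n)) \<longlonglongrightarrow> 0"
  shows "(\<lambda>n. modular (\<lambda>x. f n x + g n x)) \<longlonglongrightarrow> 0"
proof (rule tendsto_sandwich[of "\<lambda>_. 0"])
  have "(\<lambda>n. modular (f n) + modular (g n)) \<longlonglongrightarrow> 0"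
    using tendsto_add[OF assms(3,4)] by simp
  from ennreal_tendsto_cmult[OF _ this, of "ennreal Kq"]
  show "(\<lambda>n. ennreal Kq * (modular (f n) + modular (g n))) \<longlonglongrightarrow> 0" by simp
  show "\<forall>\<^sub>F n in sequentially. modular (\<lambda>x. f n x + g n x) \<le> ennreal Kq * (modular (f n) + modular (g n))"
    by (intro always_eventually allI modular_add assms)
qed auto

lemma modular_tendsto_mono:
  assumes "\<And>n. AE x in M. norm (f n x) \<le> norm (g n x)" "(\<lambda>n. modular (g n)) \<longlonglongrightarrow> 0"
  shows "(\<lambda>n. modular (f n)) \<longlonglongrightarrow> 0"
  by (rule tendsto_sandwich[of "\<lambda>_. 0" _ _ "\<lambda>n. modular (g n)"])
    (use modular_mono[OF assms(1)] assms(2) in auto)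

text \<open>For test functions \<open>\<psi>\<close> near \<open>u\<close>, the gradient of
  \<open>h \<circ> \<psi>\<close> differs from the claimed one by two parts: one is controlled by
  \<open>\<bar>h'\<bar> \<le> 1\<close> and the convergence of gradients; the other,
  \<open>(h' (\<psi> x) - h' (u x)) *\<^sub>R g x\<close>, needs pointwise convergence of the
  \<open>\<psi>\<close>, hence a subsequence, and is dominated by
  \<open>2 * norm (g x)\<close>.\<close>

lemma W0_compose:
  assumes W: "W0 u g" and smooth: "\<And>k. Ck_on k UNIV h" and h0: "h 0 = 0"
    and h': "\<And>s. (h has_real_derivative h' s) (at s)" "continuous_on UNIV h'" "\<And>s. \<bar>h' s\<bar> \<le> 1"
  shows "W0 (\<lambda>x. h (u x)) (\<lambda>x. h' (u x) *\<^sub>R g x)"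
proof -
  obtain \<psi> where \<psi>: "\<And>n. \<psi> n \<in> test_functions \<Omega>" "(\<lambda>n. modular (\<lambda>x. \<psi> n x - u x)) \<longlonglongrightarrow> 0"
    "(\<lambda>n. modular (\<lambda>x. grad (\<psi> n) x - g x)) \<longlonglongrightarrow> 0"
    using W by (rule W0_seq) blast
  note m = test_measurable[OF \<psi>(1)] W0_measurable[OF W]
  have [measurable]: "h \<in> borel_measurable borel" "h' \<in> borel_measurable borel"
    using smooth[of 0] h'(2) by (auto intro: borel_measurable_continuous_onI)
  note [measurable] = m
  have "\<And>n. (\<lambda>x. \<psi> n x - u x) \<in> borel_measurable M" using m by simp
  then obtain r where r: "strict_mono r" "AE x in M. (\<lambda>n. \<psi> (r n) x - u x) \<longlonglongrightarrow> 0"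
    using \<psi>(2) by (rule modular_AE_subseq)
  have lip: "\<bar>h s - h t\<bar> \<le> \<bar>s - t\<bar>" for s t
    using field_differentiable_bound[of UNIV h h' 1 s t] h'(1,3) by (auto intro: has_field_derivative_at_within)
  have gr: "grad (\<lambda>x. h (\<psi> n x)) x = h' (\<psi> n x) *\<^sub>R grad (\<psi> n) x" for n x
  proof -
    obtain K where "C1_compact K (\<psi> n)" using \<psi>(1)[of n] by (rule test_function_C1)
    then show ?thesis using h'(1) by (rule grad_compose)
  qed
  show ?thesis
  proof (rule W0_limit)
    show "W0 (\<lambda>x. h (\<psi> (r n) x)) (\<lambda>x. h' (\<psi> (r n) x) *\<^sub>R grad (\<psi> (r n)) x)" for n
      using W0_test[OF test_function_compose[OF \<psi>(1)[of "r n"] smooth h0]] by (simp add: gr[abs_def])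
    show "(\<lambda>n. modular (\<lambda>x. h (\<psi> (r n) x) - h (u x))) \<longlonglongrightarrow> 0"
      by (rule modular_tendsto_mono[OF _ LIMSEQ_subseq_LIMSEQ[OF \<psi>(2) r(1), unfolded o_def]])
        (simp add: lip)
    have "(\<lambda>n. modular (\<lambda>x. h' (\<psi> (r n) x) *\<^sub>R (grad (\<psi> (r n)) x - g x))) \<longlonglongrightarrow> 0"
      by (rule modular_tendsto_mono[OF _ LIMSEQ_subseq_LIMSEQ[OF \<psi>(3) r(1), unfolded o_def]])
        (simp add: h'(3) mult_left_le_one_le)
    moreover have "(\<lambda>n. modular (\<lambda>x. (h' (\<psi> (r n) x) - h' (u x)) *\<^sub>R g x)) \<longlonglongrightarrow> 0"
    proof (rule modular_dominated)
      show "modular (\<lambda>x. 2 * norm (g x)) < \<infinity>"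
        using modular_finite_scale[of "\<lambda>x. norm (g x)" 2] W0_finite(2)[OF W] m by (simp add: modular_norm)
      show "AE x in M. norm ((h' (\<psi> (r n) x) - h' (u x)) *\<^sub>R g x) \<le> 2 * norm (g x)" for n
      proof (intro AE_I2)
        fix x
        have "\<bar>h' (\<psi> (r n) x) - h' (u x)\<bar> \<le> 2"
          using h'(3)[of "\<psi> (r n) x"] h'(3)[of "u x"] by linarith
        then show "norm ((h' (\<psi> (r n) x) - h' (u x)) *\<^sub>R g x) \<le> 2 * norm (g x)"
          by (simp add: mult_right_mono)
      qed
      show "AE x in M. (\<lambda>n. (h' (\<psi> (r n) x) - h' (u x)) *\<^sub>R g x) \<longlonglongrightarrow> 0"
        using r(2)
      proof eventually_elim
        fix x assume "(\<lambda>n. \<psi> (r n) x - u x) \<longlonglongrightarrow> 0"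
        then have "(\<lambda>n. \<psi> (r n) x) \<longlonglongrightarrow> u x" by (rule LIM_zero_cancel)
        moreover have "isCont h' (u x)" using h'(2) by (simp add: continuous_on_eq_continuous_at)
        ultimately have "(\<lambda>n. h' (\<psi> (r n) x)) \<longlonglongrightarrow> h' (u x)" by (rule isCont_tendsto_compose[rotated])
        then have "(\<lambda>n. (h' (\<psi> (r n) x) - h' (u x)) *\<^sub>R g x) \<longlonglongrightarrow> (h' (u x) - h' (u x)) *\<^sub>R g x"
          by (intro tendsto_intros)
        then show "(\<lambda>n. (h' (\<psi> (r n) x) - h' (u x)) *\<^sub>R g x) \<longlonglongrightarrow> 0" by simp
      qed
    qed measurable
    ultimately have "(\<lambda>n. modular (\<lambda>x. h' (\<psi> (r n) x) *\<^sub>R (grad (\<psi> (r n)) x - g x)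
        + (h' (\<psi> (r n) x) - h' (u x)) *\<^sub>R g x)) \<longlonglongrightarrow> 0"
      by (rule modular_add_tendsto[rotated 2]) measurable
    then show "(\<lambda>n. modular (\<lambda>x. h' (\<psi> (r n) x) *\<^sub>R grad (\<psi> (r n)) x - h' (u x) *\<^sub>R g x)) \<longlonglongrightarrow> 0"
      by (simp add: algebra_simps)
  qed measurable
qed

text \<open>The derivative of \<open>y * flat 0 y\<close>.\<close>

definition trunc' :: "real \<Rightarrow> real" where
  "trunc' y = flat 0 y + y * flat 2 y"

lemma trunc'_bounds: "0 \<le> trunc' y" "trunc' y \<le> 1"
proof -
  show "0 \<le> trunc' y" by (auto simp: trunc'_def flat_def)
  show "trunc' y \<le> 1"
  proof (cases "y > 0")
    case True
    have "exp (- 1 / y) * (1 + 1 / y) \<le> exp (- 1 / y) * exp (1 / y)"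
      by (intro mult_left_mono exp_ge_add_one_self) simp
    then show ?thesis
      using True by (simp add: trunc'_def flat_def power2_eq_square exp_minus field_simps)
  qed (simp add: trunc'_def flat_def)
qed

text \<open>The smooth functions \<open>s * flat 0 (real (Suc n) * s)\<close> vanish for
  \<open>s \<le> 0\<close> and tend to the positive part. Their derivatives are
  \<open>trunc'\<close> at a rescaled argument, bounded by 1 for all \<open>n\<close> and zero for
  \<open>s \<le> 0\<close>. Dominated convergence gives both limits, with gradient 0 also where
  \<open>u = 0\<close>.\<close>

lemma W0_pos:
  assumes W: "W0 u g"
  shows "W0 (\<lambda>x. max 0 (u x)) (\<lambda>x. if u x > 0 then g x else 0)"
proof -
  define h where "h = (\<lambda>n s. s * flat 0 (real (Suc n) * s))"
  define h' where "h' = (\<lambda>n s. trunc' (real (Suc n) * s))"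
  have flat_cont: "continuous_on UNIV (flat m)" for m using Ck_on_flat[of 0 m] by simp
  have cc: "continuous_on UNIV (\<lambda>s. flat m (c * s))" for m and c :: real
    by (rule continuous_on_compose2[OF flat_cont]) (auto intro!: continuous_intros)
  have smooth: "Ck_on k UNIV (h n)" for k n
    unfolding h_def
  proof (intro Ck_on_mult open_UNIV)
    show "Ck_on k UNIV (\<lambda>s. s :: real)" by (rule Ck_on_linear) auto
    show "Ck_on k UNIV (\<lambda>s. flat 0 (real (Suc n) * s))"
      by (rule Ck_on_compose[where h = "flat 0" and T = UNIV and f = "\<lambda>s. real (Suc n) * s"])
        (auto intro: Ck_on_flat Ck_on_linear bounded_linear_mult_right simp del: of_nat_Suc)
  qed
  have hd: "(h n has_real_derivative h' n s) (at s)" for n s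
  proof -
    have "((\<lambda>s. flat 0 (real (Suc n) * s)) has_real_derivative flat 2 (real (Suc n) * s) * real (Suc n)) (at s)"
      by (rule DERIV_chain2[where f = "flat 0" and g = "\<lambda>s. real (Suc n) * s"])
        (use flat_has_derivative[of 0 "real (Suc n) * s"] in
          \<open>auto intro!: derivative_eq_intros simp: numeral_2_eq_2 simp del: of_nat_Suc\<close>)
    from DERIV_mult[OF DERIV_ident this] show ?thesis
      by (simp add: h_def h'_def trunc'_def mult.assoc mult.commute mult.left_commute add.commute del: of_nat_Suc)
  qed
  have hc: "continuous_on UNIV (h' n)" for n
    unfolding h'_def trunc'_def by (intro continuous_intros cc)
  have hb: "\<bar>h' n s\<bar> \<le> 1" for n s
    using trunc'_bounds[of "real (Suc n) * s"] by (simp add: h'_def)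
  have Wn: "W0 (\<lambda>x. h n (u x)) (\<lambda>x. h' n (u x) *\<^sub>R g x)" for n
    by (rule W0_compose[OF W smooth _ hd hc hb]) (simp add: h_def)
  note m = W0_measurable[OF W] W0_measurable[OF Wn]
  note [measurable] = m
  have habs: "\<bar>h n s\<bar> \<le> \<bar>s\<bar>" for n s
    using flat0_bounds(1,2)[of "real (Suc n) * s"] by (simp add: h_def abs_mult mult_left_le del: of_nat_Suc)
  have hlim: "(\<lambda>n. h n s) \<longlonglongrightarrow> max 0 s" for s
  proof (cases "s > 0")
    case True
    have "(\<lambda>n. flat 0 (real (Suc n) * s)) \<longlonglongrightarrow> 1"
      using LIMSEQ_Suc[OF flat0_scaled_tendsto[OF True, of 0]] by simp
    from tendsto_mult_left[OF this, of s] show ?thesis using True by (simp add: h_def)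
  next
    case False
    then have "h n s = 0" for n by (simp add: h_def flat0_bounds mult_nonneg_nonpos)
    then show ?thesis using False by simp
  qed
  have h'lim: "(\<lambda>n. h' n s) \<longlonglongrightarrow> (if s > 0 then 1 else 0)" for s
  proof (cases "s > 0")
    case True
    have "(\<lambda>n. exp (- 1 / (real (Suc n) * s)) * (1 + 1 / (real (Suc n) * s))) \<longlonglongrightarrow> 1"
      using True by real_asymp
    moreover have "h' n s = exp (- 1 / (real (Suc n) * s)) * (1 + 1 / (real (Suc n) * s))" for n
    proof -
      have "real (Suc n) * s > 0" using True by simp
      then show ?thesis
        by (simp add: h'_def trunc'_def flat_def power2_eq_square distrib_left del: of_nat_Suc)
    qed
    ultimately show ?thesis using True by simp
  next
    case False
    then have "real (Suc n) * s \<le> 0" for n by (simp add: mult_nonneg_nonpos)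
    then have "h' n s = 0" for n unfolding h'_def trunc'_def flat_def by (simp add: not_less[symmetric])
    then show ?thesis using False by simp
  qed
  show ?thesis
  proof (rule W0_limit[OF _ _ Wn])
    show "(\<lambda>n. modular (\<lambda>x. h n (u x) - max 0 (u x))) \<longlonglongrightarrow> 0"
    proof (rule modular_dominated)
      show "modular (\<lambda>x. 2 * norm (u x)) < \<infinity>"
        using modular_finite_scale[of "\<lambda>x. norm (u x)" 2] W0_finite(1)[OF W] m modular_norm[of u] by simp
      show "AE x in M. norm (h n (u x) - max 0 (u x)) \<le> 2 * norm (u x)" for n
      proof (intro AE_I2)
        fix x
        show "norm (h n (u x) - max 0 (u x)) \<le> 2 * norm (u x)"
          using habs[of n "u x"] by (simp add: max_def) linarith
      qed
      show "AE x in M. (\<lambda>n. h n (u x) - max 0 (u x)) \<longlonglongrightarrow> 0"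
        using hlim by (intro AE_I2 LIM_zero)
    qed measurable
    show "(\<lambda>n. modular (\<lambda>x. h' n (u x) *\<^sub>R g x - (if u x > 0 then g x else 0))) \<longlonglongrightarrow> 0"
    proof (rule modular_dominated)
      show "modular (\<lambda>x. 2 * norm (g x)) < \<infinity>"
        using modular_finite_scale[of "\<lambda>x. norm (g x)" 2] W0_finite(2)[OF W] m by (simp add: modular_norm)
      show "AE x in M. norm (h' n (u x) *\<^sub>R g x - (if u x > 0 then g x else 0)) \<le> 2 * norm (g x)" for n
      proof (intro AE_I2)
        fix x
        have "norm (h' n (u x) *\<^sub>R g x) \<le> norm (g x)"
          using hb[of n "u x"] by (simp add: mult_left_le_one_le)
        moreover have "norm (if u x > 0 then g x else 0) \<le> norm (g x)" by simp
        ultimately show "norm (h' n (u x) *\<^sub>R g x - (if u x > 0 then g x else 0)) \<le> 2 * norm (g x)"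
          using norm_triangle_ineq4[of "h' n (u x) *\<^sub>R g x" "if u x > 0 then g x else 0"] by linarith
      qed
      show "AE x in M. (\<lambda>n. h' n (u x) *\<^sub>R g x - (if u x > 0 then g x else 0)) \<longlonglongrightarrow> 0"
      proof (intro AE_I2 LIM_zero)
        fix x
        show "(\<lambda>n. h' n (u x) *\<^sub>R g x) \<longlonglongrightarrow> (if u x > 0 then g x else 0)"
          using tendsto_scaleR[OF h'lim[of "u x"] tendsto_const[of "g x"]] by (auto split: if_splits)
      qed
    qed measurable
  qed measurable
qed

end

section \<open>The variational problem\<close>

text \<open>Supporting line at \<open>z\<close> of a convex function: the power minus the line has
  derivative \<open>(1 - \<delta>) * (x powr (- \<delta>) - z powr (- \<delta>))\<close>, which
  changes sign at \<open>z\<close>.\<close>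

lemma powr_neg_subgradient:
  fixes \<delta> s z :: real
  assumes "\<delta> > 1" "s > 0" "z > 0"
  shows "z powr (1 - \<delta>) - (\<delta> - 1) * z powr (- \<delta>) * (s - z) \<le> s powr (1 - \<delta>)"
proof -
  define h where "h = (\<lambda>x. x powr (1 - \<delta>) + (\<delta> - 1) * z powr (- \<delta>) * x)"
  have d: "(h has_real_derivative (1 - \<delta>) * (x powr (- \<delta>) - z powr (- \<delta>))) (at x)" if "x > 0" for x
  proof -
    have "(h has_real_derivative (1 - \<delta>) * x powr (1 - \<delta> - 1) + (\<delta> - 1) * z powr (- \<delta>) * 1) (at x)"
      unfolding h_def using that
      by (intro DERIV_add has_real_derivative_powr DERIV_cmult DERIV_ident)
    then show ?thesis by (simp add: algebra_simps)
  qed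
  have mono: "y powr (- \<delta>) \<le> x powr (- \<delta>)" if "0 < x" "x \<le> y" for x y
    using that assms(1) by (intro powr_mono2') auto
  have "h z \<le> h s"
  proof (cases "z \<le> s")
    case True
    show ?thesis
    proof (rule DERIV_nonneg_imp_nondecreasing[OF True])
      fix x assume "z \<le> x"
      then show "\<exists>y. (h has_real_derivative y) (at x) \<and> 0 \<le> y"
        using d[of x] mono[of z x] assms
        by (intro exI[of _ "(1 - \<delta>) * (x powr (- \<delta>) - z powr (- \<delta>))"]) (auto intro: mult_nonpos_nonpos)
    qed
  next
    case False
    then have le: "s \<le> z" by simp
    show ?thesis
    proof (rule DERIV_nonpos_imp_nonincreasing[OF le])
      fix x assume x: "s \<le> x" "x \<le> z"
      then show "\<exists>y. (h has_real_derivative y) (at x) \<and> y \<le> 0"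
        using d[of x] mono[of x z] assms
        by (intro exI[of _ "(1 - \<delta>) * (x powr (- \<delta>) - z powr (- \<delta>))"]) (auto intro: mult_nonpos_nonneg)
    qed
  qed
  then show ?thesis by (simp add: h_def algebra_simps)
qed

locale singular_problem = orlicz_domain a \<Omega> for a and \<Omega> :: "(real^'n) set" +
  fixes b :: "real^'n \<Rightarrow> real" and \<delta> :: real
  assumes b_measurable [measurable]: "b \<in> borel_measurable M"
    and b_pos: "AE x in M. b x > 0"
    and delta_gt_1: "\<delta> > 1"
begin

text \<open>The value \<open>\<infinity>\<close> on \<open>s \<le> 0\<close> builds the positivity constraint into the functional.\<close>

definition G :: "real \<Rightarrow> ennreal" where
  "G s = (if s > 0 then ennreal (s powr (1 - \<delta>)) else \<infinity>)"

definition E :: "(real^'n \<Rightarrow> real) \<Rightarrow> ennreal" where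
  "E u = (\<integral>\<^sup>+x. ennreal (b x) * G (u x) \<partial>M)"

abbreviation \<gamma> where "\<gamma> \<equiv> 1 / (\<delta> - 1)"

definition J :: "(real^'n \<Rightarrow> real) \<Rightarrow> (real^'n \<Rightarrow> real^'n) \<Rightarrow> ennreal" where
  "J u g = modular g + ennreal \<gamma> * E u"

lemma gamma_pos: "\<gamma> > 0"
  using delta_gt_1 by simp

lemma G_measurable [measurable]: "G \<in> borel_measurable borel"
  unfolding G_def by measurable

lemma G_antimono: "s \<le> t \<Longrightarrow> G t \<le> G s"
  using delta_gt_1 by (auto simp: G_def intro!: ennreal_leI powr_mono2')

lemma G_midpoint: "G ((s + t) / 2) \<le> ennreal (1 / 2) * (G s + G t)"
proof (cases "s > 0 \<and> t > 0")
  case True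
  define z where "z = (s + t) / 2"
  have z: "z > 0" using True by (simp add: z_def)
  have "(s - z) + (t - z) = 0" by (simp add: z_def)
  then have "(\<delta> - 1) * z powr (- \<delta>) * (s - z) + (\<delta> - 1) * z powr (- \<delta>) * (t - z) = 0"
    by (simp add: distrib_left[symmetric])
  moreover have "R \<le> 1 / 2 * (S + T)" if "v + w = 0" "R - v \<le> S" "R - w \<le> T" for R S T v w :: real
    using that by simp
  ultimately have "z powr (1 - \<delta>) \<le> 1 / 2 * (s powr (1 - \<delta>) + t powr (1 - \<delta>))"
    using powr_neg_subgradient[OF delta_gt_1 _ z, of s] powr_neg_subgradient[OF delta_gt_1 _ z, of t] True
    by blast
  then have "ennreal (z powr (1 - \<delta>)) \<le> ennreal (1 / 2 * (s powr (1 - \<delta>) + t powr (1 - \<delta>)))"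
    by (rule ennreal_leI)
  also have "\<dots> = ennreal (1 / 2) * (ennreal (s powr (1 - \<delta>)) + ennreal (t powr (1 - \<delta>)))"
    by (subst ennreal_mult) auto
  finally show ?thesis using True z by (simp add: G_def z_def)
next
  case False
  then have eq: "G s + G t = \<infinity>" by (auto simp: G_def)
  show ?thesis unfolding eq ennreal_mult_top by simp
qed

text \<open>For the nonincreasing \<open>G\<close>, continuity from the right amounts to lower
  semicontinuity. The critical point is 0, where the power has to blow up, as it does for
  \<open>\<delta> > 1\<close>.\<close>

lemma G_right_limit: "(\<lambda>k. G (s + 1 / real (Suc k))) \<longlonglongrightarrow> G s"
proof -
  have l: "(\<lambda>k. s + 1 / real (Suc k)) \<longlonglongrightarrow> s" by real_asymp
  consider "s > 0" | "s < 0" | "s = 0" by linarith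
  then show ?thesis
  proof cases
    case 1
    have "(\<lambda>k. (s + 1 / real (Suc k)) powr (1 - \<delta>)) \<longlonglongrightarrow> s powr (1 - \<delta>)"
      by (rule tendsto_powr[OF l tendsto_const]) (use 1 in simp)
    then have "(\<lambda>k. ennreal ((s + 1 / real (Suc k)) powr (1 - \<delta>))) \<longlonglongrightarrow> ennreal (s powr (1 - \<delta>))"
      by (rule tendsto_ennrealI)
    moreover have "s + 1 / real (Suc k) > 0" for k using 1 by (simp add: add_pos_pos)
    ultimately show ?thesis using 1 by (simp add: G_def)
  next
    case 2
    have "\<forall>\<^sub>F k in sequentially. s + 1 / real (Suc k) < 0"
      using order_tendstoD(2)[OF l 2] .
    then have "\<forall>\<^sub>F k in sequentially. G (s + 1 / real (Suc k)) = G s"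
      by eventually_elim (use 2 in \<open>simp add: G_def\<close>)
    then show ?thesis by (rule tendsto_eventually)
  next
    case 3
    have "filterlim (\<lambda>k. real (Suc k) powr (\<delta> - 1)) at_top sequentially"
      using delta_gt_1 by real_asymp
    moreover have "real (Suc k) powr (\<delta> - 1) = (1 / real (Suc k)) powr (1 - \<delta>)" for k
      using powr_minus[of "1 / real (Suc k)" "\<delta> - 1"] by (simp add: powr_divide)
    ultimately have "(\<lambda>k. ennreal ((1 / real (Suc k)) powr (1 - \<delta>))) \<longlonglongrightarrow> \<infinity>"
      by (simp add: ennreal_tendsto_top_eq_at_top)
    then show ?thesis using 3 by (simp add: G_def)
  qed
qed

text \<open>As \<open>b > 0\<close> almost everywhere, an infinite value of \<open>G\<close> on a
  set of positive measure would make the energy infinite; finite energy therefore restores the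
  real-valued integrand.\<close>

lemma E_finite:
  assumes [measurable]: "u \<in> borel_measurable M" and fin: "E u < \<infinity>"
  shows "AE x in M. u x > 0" "integrable M (\<lambda>x. b x * u x powr (1 - \<delta>))"
    "E u = ennreal (\<integral>x. b x * u x powr (1 - \<delta>) \<partial>M)"
proof -
  have "AE x in M. ennreal (b x) * G (u x) \<noteq> \<infinity>"
    using fin unfolding E_def by (intro nn_integral_PInf_AE) auto
  with b_pos show pos: "AE x in M. u x > 0"
    by eventually_elim (auto simp: G_def ennreal_mult_top split: if_splits)
  have eq: "E u = (\<integral>\<^sup>+x. ennreal (b x * u x powr (1 - \<delta>)) \<partial>M)"
    unfolding E_def
    by (rule nn_integral_cong_AE, use pos b_pos in eventually_elim) (simp add: G_def ennreal_mult)
  have nn: "AE x in M. 0 \<le> b x * u x powr (1 - \<delta>)"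
    using b_pos by eventually_elim simp
  show i: "integrable M (\<lambda>x. b x * u x powr (1 - \<delta>))"
    by (rule integrableI_nonneg[OF _ nn]) (use eq fin in auto)
  show "E u = ennreal (\<integral>x. b x * u x powr (1 - \<delta>) \<partial>M)"
    unfolding eq by (rule nn_integral_eq_integral[OF i nn])
qed

lemma E_antimono: "AE x in M. u x \<le> v x \<Longrightarrow> E v \<le> E u"
  unfolding E_def by (rule nn_integral_mono_AE, erule eventually_mono) (auto intro!: mult_left_mono G_antimono)

lemma E_midpoint:
  assumes [measurable]: "u \<in> borel_measurable M" "v \<in> borel_measurable M"
  shows "E (\<lambda>x. (u x + v x) / 2) \<le> ennreal (1 / 2) * (E u + E v)"
proof -
  have "E (\<lambda>x. (u x + v x) / 2)
      \<le> (\<integral>\<^sup>+x. ennreal (1 / 2) * (ennreal (b x) * G (u x) + ennreal (b x) * G (v x)) \<partial>M)"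
    unfolding E_def
  proof (rule nn_integral_mono)
    fix x
    have "ennreal (b x) * G ((u x + v x) / 2) \<le> ennreal (b x) * (ennreal (1 / 2) * (G (u x) + G (v x)))"
      by (intro mult_left_mono G_midpoint) simp
    then show "ennreal (b x) * G ((u x + v x) / 2)
      \<le> ennreal (1 / 2) * (ennreal (b x) * G (u x) + ennreal (b x) * G (v x))"
      by (simp add: distrib_left mult.assoc mult.left_commute)
  qed
  also have "\<dots> = ennreal (1 / 2) * (E u + E v)"
    unfolding E_def by (subst nn_integral_cmult) (auto simp: nn_integral_add)
  finally show ?thesis .
qed

text \<open>A single application of Fatou to the sum of both integrands. Almost everywhere
  convergence of the gradients makes the first one converge, and the second is lower
  semicontinuous.\<close>

lemma J_lsc:
  assumes W: "\<And>n. W0 (u n) (g n)" "W0 v h"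
    and u: "AE x in M. (\<lambda>n. u n x) \<longlonglongrightarrow> v x" and g: "AE x in M. (\<lambda>n. g n x) \<longlonglongrightarrow> h x"
  shows "J v h \<le> liminf (\<lambda>n. J (u n) (g n))"
proof -
  note [measurable] = W0_measurable[OF W(1)] W0_measurable[OF W(2)]
  have J: "J w k = (\<integral>\<^sup>+x. ennreal (\<Phi> (norm (k x))) + ennreal \<gamma> * (ennreal (b x) * G (w x)) \<partial>M)"
    if [measurable]: "w \<in> borel_measurable M" "k \<in> borel_measurable M" for w k
  proof -
    have "ennreal \<gamma> * E w = (\<integral>\<^sup>+x. ennreal \<gamma> * (ennreal (b x) * G (w x)) \<partial>M)"
      unfolding E_def by (rule nn_integral_cmult[symmetric]) measurable
    then show ?thesis
      unfolding J_def modular_def by (subst nn_integral_add) auto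
  qed
  let ?F = "\<lambda>n x. ennreal (\<Phi> (norm (g n x))) + ennreal \<gamma> * (ennreal (b x) * G (u n x))"
  have "J v h \<le> (\<integral>\<^sup>+x. liminf (\<lambda>n. ?F n x) \<partial>M)"
    unfolding J[OF W0_measurable[OF W(2)]]
  proof (rule nn_integral_mono_AE, use u g in eventually_elim)
    fix x assume ux: "(\<lambda>n. u n x) \<longlonglongrightarrow> v x" and gx: "(\<lambda>n. g n x) \<longlonglongrightarrow> h x"
    let ?c = "ennreal \<gamma> * ennreal (b x)"
    have Phi: "(\<lambda>n. ennreal (\<Phi> (norm (g n x)))) \<longlonglongrightarrow> ennreal (\<Phi> (norm (h x)))"
      by (intro tendsto_ennrealI tendsto_Phi tendsto_norm gx)
    \<comment> \<open>Eventually \<open>u n x\<close> lies below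
      \<open>v x + 1 / real (Suc k)\<close>, so \<open>G (u n x)\<close> is at least the value of
      \<open>G\<close> there; right-continuity of \<open>G\<close> removes \<open>k\<close>
      afterwards.\<close>
    have le: "ennreal (\<Phi> (norm (h x))) + ?c * G (v x + 1 / real (Suc k)) \<le> liminf (\<lambda>n. ?F n x)" for k
    proof -
      have "v x < v x + 1 / real (Suc k)" by simp
      then have "\<forall>\<^sub>F n in sequentially. u n x < v x + 1 / real (Suc k)"
        using order_tendstoD(2)[OF ux] by blast
      then have ev: "\<forall>\<^sub>F n in sequentially.
          ennreal (\<Phi> (norm (g n x))) + ?c * G (v x + 1 / real (Suc k)) \<le> ?F n x"
        by eventually_elim
          (auto simp: mult.assoc[symmetric] simp del: of_nat_Suc intro!: add_left_mono mult_left_mono G_antimono)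
      have "(\<lambda>n. ennreal (\<Phi> (norm (g n x))) + ?c * G (v x + 1 / real (Suc k)))
          \<longlonglongrightarrow> ennreal (\<Phi> (norm (h x))) + ?c * G (v x + 1 / real (Suc k))"
        by (intro tendsto_add Phi tendsto_const)
      then have "ennreal (\<Phi> (norm (h x))) + ?c * G (v x + 1 / real (Suc k))
          = liminf (\<lambda>n. ennreal (\<Phi> (norm (g n x))) + ?c * G (v x + 1 / real (Suc k)))"
        by (intro lim_imp_Liminf[symmetric]) auto
      also have "\<dots> \<le> liminf (\<lambda>n. ?F n x)"
        by (rule Liminf_mono[OF ev])
      finally show ?thesis .
    qed
    have "(\<lambda>k. ?c * G (v x + 1 / real (Suc k))) \<longlonglongrightarrow> ?c * G (v x)"
      by (rule ennreal_tendsto_cmult[OF _ G_right_limit]) (simp add: ennreal_mult_less_top)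
    then have "(\<lambda>k. ennreal (\<Phi> (norm (h x))) + ?c * G (v x + 1 / real (Suc k)))
        \<longlonglongrightarrow> ennreal (\<Phi> (norm (h x))) + ?c * G (v x)"
      by (intro tendsto_add tendsto_const)
    then have "ennreal (\<Phi> (norm (h x))) + ?c * G (v x) \<le> liminf (\<lambda>n. ?F n x)"
      by (rule LIMSEQ_le_const2) (use le in auto)
    then show "ennreal (\<Phi> (norm (h x))) + ennreal \<gamma> * (ennreal (b x) * G (v x)) \<le> liminf (\<lambda>n. ?F n x)"
      by (simp add: mult.assoc)
  qed
  also have "\<dots> \<le> liminf (\<lambda>n. integral\<^sup>N M (?F n))"
    by (rule nn_integral_liminf) measurable
  also have "(\<lambda>n. integral\<^sup>N M (?F n)) = (\<lambda>n. J (u n) (g n))"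
    using J[OF W0_measurable[OF W(1)]] by (intro ext) simp
  finally show ?thesis .
qed

section \<open>Existence of a minimiser by uniform convexity\<close>

lemma W0_midpoint:
  assumes "W0 u g" "W0 v h"
  shows "W0 (\<lambda>x. (u x + v x) / 2) (\<lambda>x. (g x + h x) /\<^sub>R 2)"
proof -
  have eq: "(\<lambda>x. (u x + v x) / 2) = (\<lambda>x. inverse 2 * (u x + v x))"
    by (rule ext) simp
  show ?thesis unfolding eq by (rule W0_scale[OF W0_add[OF assms]])
qed

text \<open>Integrated uniform convexity: the bound \<open>B\<close> on the modulars limits the
  \<open>\<epsilon>\<close> term, and the constant \<open>C\<close> belonging to that
  \<open>\<epsilon>\<close> decides how small the midpoint deficit \<open>d\<close> must be.\<close>

lemma modular_uniformly_convex:
  assumes e: "0 < e"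
  obtains d where "d > 0" "\<And>g h :: real^'n \<Rightarrow> real^'n. g \<in> borel_measurable M \<Longrightarrow> h \<in> borel_measurable M \<Longrightarrow>
    modular g + modular h \<le> ennreal B \<Longrightarrow>
    modular g + modular h \<le> 2 * modular (\<lambda>x. (g x + h x) /\<^sub>R 2) + ennreal d \<Longrightarrow>
    modular (\<lambda>x. g x - h x) \<le> ennreal e"
proof -
  \<comment> \<open>Raised to at least 1 so that it can be divided by.\<close>
  define B' where "B' = max B 1"
  have B': "B' \<ge> 1" "B \<le> B'" by (auto simp: B'_def)
  define \<epsilon> where "\<epsilon> = min 1 (e / (2 * B'))"
  have eps: "0 < \<epsilon>" "\<epsilon> \<le> 1" "\<epsilon> * B' \<le> e / 2"
  proof -
    show "0 < \<epsilon>" "\<epsilon> \<le> 1" using e B' by (auto simp: \<epsilon>_def)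
    have "\<epsilon> * B' \<le> e / (2 * B') * B'" using B' by (intro mult_right_mono) (auto simp: \<epsilon>_def)
    also have "\<dots> = e / 2" using B' by simp
    finally show "\<epsilon> * B' \<le> e / 2" .
  qed
  obtain C where C: "C \<ge> 0" "\<And>X Y :: real^'n.
    \<Phi> (norm (X - Y)) \<le> \<epsilon> * (\<Phi> (norm X) + \<Phi> (norm Y))
      + C * ((\<Phi> (norm X) + \<Phi> (norm Y)) / 2 - \<Phi> (norm ((X + Y) /\<^sub>R 2)))"
    using uniformly_convex[OF eps(1,2), where ?'v = "real^'n"] by blast
  define d where "d = e / (C + 1)"
  have d: "d > 0" "C * (d / 2) \<le> e / 2" using C e by (auto simp: d_def field_simps)
  show thesis
  proof (rule that[OF d(1)])
    fix g h :: "real^'n \<Rightarrow> real^'n"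
    assume m: "g \<in> borel_measurable M" "h \<in> borel_measurable M"
      and bd: "modular g + modular h \<le> ennreal B"
      and mid: "modular g + modular h \<le> 2 * modular (\<lambda>x. (g x + h x) /\<^sub>R 2) + ennreal d"
    have bd': "modular g + modular h \<le> ennreal B'"
      using bd B'(2) ennreal_leI order_trans by blast
    have fg: "modular g < \<infinity>" "modular h < \<infinity>"
      using bd' by (auto simp: less_top[symmetric] top_unique)
    let ?m = "\<lambda>x. (g x + h x) /\<^sub>R 2" and ?d = "\<lambda>x. g x - h x"
    have fm: "modular ?m < \<infinity>"
      using modular_finite_scale[OF _ modular_finite_add[OF m fg], of "inverse 2"] m by simp
    have fd: "modular ?d < \<infinity>"
      using modular_finite_add[OF m(1) _ fg(1) modular_finite_scale[OF m(2) fg(2), of "-1"]] m by simp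
    have mm: "?m \<in> borel_measurable M" "?d \<in> borel_measurable M" using m by auto
    note ig = modular_integrable(1,2)[OF m(1) fg(1)] and ih = modular_integrable(1,2)[OF m(2) fg(2)]
      and im = modular_integrable(1,2)[OF mm(1) fm] and id = modular_integrable(1,2)[OF mm(2) fd]
    define Pg where "Pg = (\<integral>x. \<Phi> (norm (g x)) \<partial>M)"
    define Ph where "Ph = (\<integral>x. \<Phi> (norm (h x)) \<partial>M)"
    define Pm where "Pm = (\<integral>x. \<Phi> (norm (?m x)) \<partial>M)"
    have nn: "Pg \<ge> 0" "Ph \<ge> 0" "Pm \<ge> 0" unfolding Pg_def Ph_def Pm_def by (simp_all add: Phi_nonneg)
    have M: "modular g = ennreal Pg" "modular h = ennreal Ph" "modular ?m = ennreal Pm"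
      using ig(2) ih(2) im(2) by (simp_all add: Pg_def Ph_def Pm_def)
    have "ennreal (Pg + Ph) \<le> ennreal B'" using bd' nn M by (simp add: ennreal_plus)
    then have 1: "Pg + Ph \<le> B'" using B' by (subst (asm) ennreal_le_iff) auto
    have "ennreal (Pg + Ph) \<le> ennreal (2 * Pm + d)"
      using mid nn M d by (simp add: ennreal_plus ennreal_mult)
    then have 2: "Pg + Ph \<le> 2 * Pm + d" using nn d by (subst (asm) ennreal_le_iff) auto
    have "(\<integral>x. \<Phi> (norm (?d x)) \<partial>M) \<le> (\<integral>x. \<epsilon> * (\<Phi> (norm (g x)) + \<Phi> (norm (h x)))
      + C * ((\<Phi> (norm (g x)) + \<Phi> (norm (h x))) / 2 - \<Phi> (norm (?m x))) \<partial>M)"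
      using ig ih im id by (intro integral_mono C(2)) auto
    also have "\<dots> = \<epsilon> * (Pg + Ph) + C * ((Pg + Ph) / 2 - Pm)"
      using ig ih im by (simp add: Pg_def Ph_def Pm_def)
    also have "\<dots> \<le> \<epsilon> * B' + C * (d / 2)"
    proof (intro add_mono mult_left_mono)
      show "(Pg + Ph) / 2 - Pm \<le> d / 2" using 2 by (simp add: field_simps)
    qed (use 1 eps C in auto)
    also have "\<dots> \<le> e" using eps d by simp
    finally show "modular ?d \<le> ennreal e"
      unfolding id(2)[symmetric] by (rule ennreal_leI)
  qed
qed

text \<open>The midpoint of two almost-minimisers cannot go below the infimum \<open>m\<close>.
  Since \<open>E\<close> is convex at midpoints, the convexity deficit of the gradient modular must
  be small, and uniform convexity makes the gradients of a minimising sequence Cauchy.\<close>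

lemma minimizer_exists:
  assumes W: "W0 u0 g0" "E u0 < \<infinity>"
  obtains u g where "W0 u g" "E u < \<infinity>" "\<And>v h. W0 v h \<Longrightarrow> J u g \<le> J v h"
proof -
  define S where "S = {J v h | v h. W0 v h}"
  define m where "m = Inf S"
  have J0: "J u0 g0 \<in> S" "J u0 g0 < \<infinity>"
    using W W0_finite(2)[OF W(1)] by (auto simp: S_def J_def ennreal_mult_less_top)
  have m_le: "m \<le> J v h" if "W0 v h" for v h
    unfolding m_def S_def using that by (auto intro!: Inf_lower)
  have "m \<le> J u0 g0" using m_le W(1) by blast
  then obtain m' where m': "m = ennreal m'" "m' \<ge> 0"
    using J0(2) by (cases m) (auto simp: top_unique)
  have "\<exists>v h. W0 v h \<and> J v h \<le> m + ennreal (1 / real (Suc n))" for n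
  proof -
    have "Inf S < m + ennreal (1 / real (Suc n))"
      unfolding m_def[symmetric] m' using m'(2) by (simp add: ennreal_plus[symmetric] ennreal_less_iff del: ennreal_plus)
    then obtain y where "y \<in> S" "y < m + ennreal (1 / real (Suc n))"
      by (auto simp: Inf_less_iff)
    then show ?thesis unfolding S_def using less_imp_le by blast
  qed
  then have "\<forall>n. \<exists>z. W0 (fst z) (snd z) \<and> J (fst z) (snd z) \<le> m + ennreal (1 / real (Suc n))"
    by (metis fst_conv snd_conv)
  from choice[OF this] obtain z where z: "\<And>n. W0 (fst (z n)) (snd (z n))"
    "\<And>n. J (fst (z n)) (snd (z n)) \<le> m + ennreal (1 / real (Suc n))" by auto
  define u where "u = (\<lambda>n. fst (z n))"
  define g where "g = (\<lambda>n. snd (z n))"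
  have Wn: "W0 (u n) (g n)" and Jn: "J (u n) (g n) \<le> m + ennreal (1 / real (Suc n))" for n
    using z by (auto simp: u_def g_def)
  have Cauchy: "\<exists>N. \<forall>i\<ge>N. \<forall>j\<ge>N. modular (\<lambda>x. g i x - g j x) \<le> ennreal e" if e: "e > 0" for e
  proof -
    obtain d where d: "d > 0" "\<And>g h :: real^'n \<Rightarrow> real^'n. g \<in> borel_measurable M \<Longrightarrow> h \<in> borel_measurable M \<Longrightarrow>
      modular g + modular h \<le> ennreal (2 * (m' + 1)) \<Longrightarrow>
      modular g + modular h \<le> 2 * modular (\<lambda>x. (g x + h x) /\<^sub>R 2) + ennreal d \<Longrightarrow>
      modular (\<lambda>x. g x - h x) \<le> ennreal e"
      using modular_uniformly_convex[OF e, of "2 * (m' + 1)"] by blast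
    obtain N where N: "1 / real (Suc N) < d / 2"
      using d(1) reals_Archimedean[of "d / 2"] by (auto simp: inverse_eq_divide)
    have "modular (\<lambda>x. g i x - g j x) \<le> ennreal e" if ij: "i \<ge> N" "j \<ge> N" for i j
    proof (rule d(2)[OF W0_measurable(2)[OF Wn] W0_measurable(2)[OF Wn]])
      \<comment> \<open>Both values of \<open>J\<close> lie within \<open>f\<close> of the infimum,
        which bounds the midpoint deficit by \<open>2 * f < d\<close>.\<close>
      define f where "f = 1 / real (Suc N)"
      have f: "0 < f" "f \<le> 1" "2 * f < d" using N by (auto simp: f_def)
      have Jk: "J (u k) (g k) \<le> ennreal (m' + f)" if "k \<ge> N" for k
      proof -
        have "1 / real (Suc k) \<le> f" using that by (simp add: f_def field_simps)
        then have "m + ennreal (1 / real (Suc k)) \<le> ennreal m' + ennreal f"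
          unfolding m' by (intro add_left_mono ennreal_leI)
        moreover have "ennreal m' + ennreal f = ennreal (m' + f)" using m' f by simp
        ultimately show ?thesis using order_trans[OF Jn[of k]] by metis
      qed
      have fin: "E (u k) < \<infinity>" "modular (g k) < \<infinity>" if "k \<ge> N" for k
      proof -
        have "J (u k) (g k) < \<infinity>" using Jk[OF that] by (auto intro: le_less_trans)
        then show "E (u k) < \<infinity>" "modular (g k) < \<infinity>"
          using gamma_pos by (auto simp: J_def less_top[symmetric] ennreal_mult_eq_top_iff)
      qed
      obtain p1 p2 q1 q2 where pq: "modular (g i) = ennreal p1" "modular (g j) = ennreal p2"
        "E (u i) = ennreal q1" "E (u j) = ennreal q2" "0 \<le> p1" "0 \<le> p2" "0 \<le> q1" "0 \<le> q2"
        using fin[OF ij(1)] fin[OF ij(2)]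
        by (cases "modular (g i)"; cases "modular (g j)"; cases "E (u i)"; cases "E (u j)") auto
      have g0: "0 \<le> \<gamma>" using gamma_pos by simp
      have J1: "p1 + \<gamma> * q1 \<le> m' + f" "p2 + \<gamma> * q2 \<le> m' + f"
      proof -
        have em: "ennreal (p + \<gamma> * q) = ennreal p + ennreal \<gamma> * ennreal q" if "0 \<le> p" "0 \<le> q" for p q
          by (subst ennreal_plus, rule that, rule mult_nonneg_nonneg[OF g0 that(2)],
              subst ennreal_mult[OF g0 that(2)], rule refl)
        have "ennreal (p1 + \<gamma> * q1) \<le> ennreal (m' + f)" "ennreal (p2 + \<gamma> * q2) \<le> ennreal (m' + f)"
          using Jk[OF ij(1)] Jk[OF ij(2)] em pq unfolding J_def by metis+
        then show "p1 + \<gamma> * q1 \<le> m' + f" "p2 + \<gamma> * q2 \<le> m' + f"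
          using iffD1[OF ennreal_le_iff] m' f by (meson add_nonneg_nonneg less_imp_le)+
      qed
      have gq: "0 \<le> \<gamma> * q1" "0 \<le> \<gamma> * q2" using g0 pq by (intro mult_nonneg_nonneg; simp)+
      have "p1 + p2 \<le> 2 * (m' + 1)" using J1 gq f by argo
      then show "modular (g i) + modular (g j) \<le> ennreal (2 * (m' + 1))"
        using pq by (simp add: ennreal_plus[symmetric] ennreal_leI del: ennreal_plus)
      obtain pm where pm: "modular (\<lambda>x. (g i x + g j x) /\<^sub>R 2) = ennreal pm" "0 \<le> pm"
        using W0_finite(2)[OF W0_midpoint[OF Wn[of i] Wn[of j]]]
        by (cases "modular (\<lambda>x. (g i x + g j x) /\<^sub>R 2)") auto
      have "m \<le> modular (\<lambda>x. (g i x + g j x) /\<^sub>R 2) + ennreal \<gamma> * E (\<lambda>x. (u i x + u j x) / 2)"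
        using m_le[OF W0_midpoint[OF Wn Wn]] by (simp add: J_def)
      also have "\<dots> \<le> ennreal pm + ennreal \<gamma> * (ennreal (1 / 2) * (ennreal q1 + ennreal q2))"
        unfolding pm(1) pq(3,4)[symmetric]
        by (intro add_left_mono mult_left_mono E_midpoint W0_measurable[OF Wn]) simp
      also have "\<dots> = ennreal (pm + \<gamma> * (1 / 2 * (q1 + q2)))"
      proof -
        have q: "0 \<le> q1 + q2" using pq by simp
        have half: "(0::real) \<le> 1 / 2" by simp
        have hq: "0 \<le> 1 / 2 * (q1 + q2)" using q by simp
        have "0 \<le> \<gamma> * (1 / 2 * (q1 + q2))" by (rule mult_nonneg_nonneg[OF g0 hq])
        then show ?thesis
          by (simp only: ennreal_plus[OF pm(2)] ennreal_mult[OF g0 hq] ennreal_mult[OF half q] ennreal_plus[OF pq(7,8)])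
      qed
      finally have "m' \<le> pm + \<gamma> * (1 / 2 * (q1 + q2))"
        unfolding m' using pm pq g0 by (subst (asm) ennreal_le_iff) auto
      moreover have "c * (1 / 2 * (q1 + q2)) = 1 / 2 * (c * q1) + 1 / 2 * (c * q2)" for c :: real
        by (simp add: algebra_simps)
      ultimately have "m' \<le> pm + (1 / 2 * (\<gamma> * q1) + 1 / 2 * (\<gamma> * q2))"
        by metis
      then have "2 * m' \<le> 2 * pm + \<gamma> * q1 + \<gamma> * q2"
        by argo
      then have "p1 + p2 \<le> 2 * pm + d"
        using J1 f by argo
      then have "ennreal (p1 + p2) \<le> ennreal (2 * pm + d)" by (rule ennreal_leI)
      then show "modular (g i) + modular (g j) \<le> 2 * modular (\<lambda>x. (g i x + g j x) /\<^sub>R 2) + ennreal d"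
        using pq pm d(1) by (simp add: ennreal_plus ennreal_mult)
    qed
    then show ?thesis by blast
  qed
  obtain v h r where v: "W0 v h" "strict_mono r" "AE x in M. (\<lambda>n. u (r n) x) \<longlonglongrightarrow> v x"
    "AE x in M. (\<lambda>n. g (r n) x) \<longlonglongrightarrow> h x"
    using Wn Cauchy by (rule W0_Cauchy) blast
  have "J v h \<le> liminf (\<lambda>n. J (u (r n)) (g (r n)))"
    by (rule J_lsc[OF Wn v(1,3,4)])
  also have "\<dots> \<le> liminf (\<lambda>n. m + ennreal (1 / real (Suc n)))"
  proof (rule Liminf_mono[OF always_eventually], rule allI)
    fix n
    have "1 / real (Suc (r n)) \<le> 1 / real (Suc n)"
      using seq_suble[OF v(2), of n] by (simp add: field_simps)
    then have "m + ennreal (1 / real (Suc (r n))) \<le> m + ennreal (1 / real (Suc n))"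
      by (intro add_left_mono ennreal_leI)
    then show "J (u (r n)) (g (r n)) \<le> m + ennreal (1 / real (Suc n))"
      using Jn[of "r n"] by (rule order_trans[rotated])
  qed
  also have "\<dots> = m"
  proof (rule lim_imp_Liminf)
    have "(\<lambda>n. 1 / real (Suc n)) \<longlonglongrightarrow> 0" by real_asymp
    then have "(\<lambda>n. m + ennreal (1 / real (Suc n))) \<longlonglongrightarrow> m + ennreal 0"
      by (intro tendsto_add tendsto_const tendsto_ennrealI)
    then show "(\<lambda>n. m + ennreal (1 / real (Suc n))) \<longlonglongrightarrow> m" by simp
  qed simp
  finally have Jv: "J v h \<le> m" .
  show thesis
  proof (rule that[OF v(1)])
    have "J v h < \<infinity>" using Jv m' by (auto intro: le_less_trans)
    then show "E v < \<infinity>"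
      using gamma_pos by (auto simp: J_def less_top[symmetric] ennreal_mult_eq_top_iff)
    show "J v h \<le> J w k" if "W0 w k" for w k
      using Jv m_le[OF that] by (rule order_trans)
  qed
qed

end

subsection \<open>The Euler-Lagrange equation\<close>

context singular_problem
begin

lemma A_measurable [measurable]: "(A :: real^'n \<Rightarrow> real^'n) \<in> borel_measurable borel"
  using A_continuous by (rule borel_measurable_continuous_onI)

text \<open>Source of integrable majorants for the field. The radius \<open>r\<close> may exceed
  \<open>norm X\<close>, which gives one bound for all perturbations of \<open>g\<close> by
  \<open>t n *\<^sub>R h\<close> with \<open>\<bar>t n\<bar> \<le> 1\<close>.\<close>

lemma A_bound:
  obtains C where "C > 0"
    "\<And>(X :: real^'n) Y r. norm X \<le> r \<Longrightarrow> \<bar>A X \<bullet> Y\<bar> \<le> \<Phi> r + C * \<Phi> (norm Y)"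
proof -
  obtain C where C: "C > 0" "\<And>s t. 0 \<le> s \<Longrightarrow> 0 \<le> t \<Longrightarrow> \<phi> s * t \<le> 1 * \<Phi> s + C * \<Phi> t"
    using young[of 1] by auto
  show thesis
  proof (rule that[OF C(1)])
    fix X Y :: "real^'n" and r assume X: "norm X \<le> r"
    then have r: "0 \<le> r" using norm_ge_zero order_trans by blast
    have "\<bar>A X \<bullet> Y\<bar> \<le> \<phi> (norm X) * norm Y"
      using Cauchy_Schwarz_ineq2[of "A X" Y] by (simp add: norm_A)
    also have "\<dots> \<le> \<phi> r * norm Y" by (intro mult_right_mono phi_mono X) simp
    also have "\<dots> \<le> \<Phi> r + C * \<Phi> (norm Y)" using C(2)[OF r norm_ge_zero] by simp
    finally show "\<bar>A X \<bullet> Y\<bar> \<le> \<Phi> r + C * \<Phi> (norm Y)" .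
  qed
qed

lemma A_integrable:
  fixes g h :: "real^'n \<Rightarrow> real^'n"
  assumes m [measurable]: "g \<in> borel_measurable M" "h \<in> borel_measurable M"
    and fin: "modular g < \<infinity>" "modular h < \<infinity>"
  shows "integrable M (\<lambda>x. A (g x) \<bullet> h x)"
proof -
  obtain C where C: "C > 0"
    "\<And>(X :: real^'n) Y r. norm X \<le> r \<Longrightarrow> \<bar>A X \<bullet> Y\<bar> \<le> \<Phi> r + C * \<Phi> (norm Y)"
    by (rule A_bound) blast
  show ?thesis
  proof (rule Bochner_Integration.integrable_bound)
    show "integrable M (\<lambda>x. \<Phi> (norm (g x)) + C * \<Phi> (norm (h x)))"
      using modular_integrable(1)[OF m(1) fin(1)] modular_integrable(1)[OF m(2) fin(2)] by simp
    show "AE x in M. norm (A (g x) \<bullet> h x) \<le> norm (\<Phi> (norm (g x)) + C * \<Phi> (norm (h x)))"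
    proof (intro AE_I2)
      fix x
      show "norm (A (g x) \<bullet> h x) \<le> norm (\<Phi> (norm (g x)) + C * \<Phi> (norm (h x)))"
        using C(2)[of "g x" "norm (g x)" "h x"] by simp
    qed
  qed measurable
qed

lemma A_perturb_limit:
  fixes g h :: "real^'n \<Rightarrow> real^'n"
  assumes m [measurable]: "g \<in> borel_measurable M" "h \<in> borel_measurable M"
    and fin: "modular g < \<infinity>" "modular h < \<infinity>"
    and t: "t \<longlonglongrightarrow> 0" "\<And>n. \<bar>t n\<bar> \<le> 1"
  shows "(\<lambda>n. \<integral>x. A (g x + t n *\<^sub>R h x) \<bullet> h x \<partial>M) \<longlonglongrightarrow> (\<integral>x. A (g x) \<bullet> h x \<partial>M)"
proof -
  obtain C where C: "C > 0"
    "\<And>(X :: real^'n) Y r. norm X \<le> r \<Longrightarrow> \<bar>A X \<bullet> Y\<bar> \<le> \<Phi> r + C * \<Phi> (norm Y)"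
    by (rule A_bound) blast
  have "modular (\<lambda>x. norm (g x) + norm (h x)) < \<infinity>"
    using fin by (intro modular_finite_add) (auto simp: modular_norm)
  from modular_integrable(1)[OF _ this] have i: "integrable M (\<lambda>x. \<Phi> (norm (g x) + norm (h x)))"
    by simp
  show ?thesis
  proof (rule integral_dominated_convergence[where w = "\<lambda>x. \<Phi> (norm (g x) + norm (h x)) + C * \<Phi> (norm (h x))"])
    show "integrable M (\<lambda>x. \<Phi> (norm (g x) + norm (h x)) + C * \<Phi> (norm (h x)))"
      using i modular_integrable(1)[OF m(2) fin(2)] by simp
    show "AE x in M. norm (A (g x + t n *\<^sub>R h x) \<bullet> h x) \<le> \<Phi> (norm (g x) + norm (h x)) + C * \<Phi> (norm (h x))" for n
    proof (intro AE_I2)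
      fix x
      have "norm (t n *\<^sub>R h x) \<le> norm (h x)" using t(2)[of n] by (simp add: mult_left_le_one_le)
      then have "norm (g x + t n *\<^sub>R h x) \<le> norm (g x) + norm (h x)"
        using norm_triangle_ineq[of "g x" "t n *\<^sub>R h x"] by simp
      from C(2)[OF this, of "h x"]
      show "norm (A (g x + t n *\<^sub>R h x) \<bullet> h x) \<le> \<Phi> (norm (g x) + norm (h x)) + C * \<Phi> (norm (h x))"
        by simp
    qed
    show "AE x in M. (\<lambda>n. A (g x + t n *\<^sub>R h x) \<bullet> h x) \<longlonglongrightarrow> A (g x) \<bullet> h x"
    proof (intro AE_I2)
      fix x
      have "(\<lambda>n. g x + t n *\<^sub>R h x) \<longlonglongrightarrow> g x + 0 *\<^sub>R h x"
        by (intro tendsto_intros t(1))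
      then have "(\<lambda>n. g x + t n *\<^sub>R h x) \<longlonglongrightarrow> g x" by simp
      moreover have "isCont A (g x)"
        using A_continuous[where ?'v = "real^'n"] by (simp add: continuous_on_eq_continuous_at)
      ultimately have "(\<lambda>n. A (g x + t n *\<^sub>R h x)) \<longlonglongrightarrow> A (g x)"
        by (rule isCont_tendsto_compose[rotated])
      then show "(\<lambda>n. A (g x + t n *\<^sub>R h x) \<bullet> h x) \<longlonglongrightarrow> A (g x) \<bullet> h x"
        by (intro tendsto_intros)
    qed
  qed measurable
qed

end

locale minimizer = singular_problem a \<Omega> b \<delta> for a and \<Omega> :: "(real^'n) set" and b \<delta> +
  fixes u :: "real^'n \<Rightarrow> real" and g :: "real^'n \<Rightarrow> real^'n"
  assumes W: "W0 u g" and E_u: "E u < \<infinity>" and min: "\<And>v h. W0 v h \<Longrightarrow> J u g \<le> J v h"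
begin

lemmas measurable_u [measurable] = W0_measurable[OF W]

lemma u_pos: "AE x in M. u x > 0"
  by (rule E_finite(1)[OF measurable_u(1) E_u])

text \<open>Minimality in real numbers, multiplied by \<open>\<delta> - 1\<close> to remove the
  weight \<open>\<gamma>\<close>; finite energy of the competitor justifies leaving
  \<open>ennreal\<close>.\<close>

lemma min_real:
  assumes V: "W0 v h" and Ev: "E v < \<infinity>"
  shows "(\<delta> - 1) * (\<integral>x. \<Phi> (norm (g x)) \<partial>M) + (\<integral>x. b x * u x powr (1 - \<delta>) \<partial>M)
    \<le> (\<delta> - 1) * (\<integral>x. \<Phi> (norm (h x)) \<partial>M) + (\<integral>x. b x * v x powr (1 - \<delta>) \<partial>M)"
proof -
  have J: "J w k = ennreal ((\<integral>x. \<Phi> (norm (k x)) \<partial>M) + \<gamma> * (\<integral>x. b x * w x powr (1 - \<delta>) \<partial>M))"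
    "0 \<le> (\<integral>x. \<Phi> (norm (k x)) \<partial>M) + \<gamma> * (\<integral>x. b x * w x powr (1 - \<delta>) \<partial>M)"
    if w: "W0 w k" "E w < \<infinity>" for w k
  proof -
    have p: "0 \<le> (\<integral>x. \<Phi> (norm (k x)) \<partial>M)" by (simp add: Phi_nonneg)
    have q: "0 \<le> (\<integral>x. b x * w x powr (1 - \<delta>) \<partial>M)"
      by (rule integral_nonneg_AE) (use b_pos in eventually_elim, simp)
    have g0: "0 \<le> \<gamma>" using gamma_pos by simp
    have gq: "0 \<le> \<gamma> * (\<integral>x. b x * w x powr (1 - \<delta>) \<partial>M)" by (rule mult_nonneg_nonneg[OF g0 q])
    show "0 \<le> (\<integral>x. \<Phi> (norm (k x)) \<partial>M) + \<gamma> * (\<integral>x. b x * w x powr (1 - \<delta>) \<partial>M)"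
      by (rule add_nonneg_nonneg[OF p gq])
    show "J w k = ennreal ((\<integral>x. \<Phi> (norm (k x)) \<partial>M) + \<gamma> * (\<integral>x. b x * w x powr (1 - \<delta>) \<partial>M))"
      unfolding J_def ennreal_plus[OF p gq] ennreal_mult[OF g0 q]
        E_finite(3)[OF W0_measurable(1)[OF w(1)] w(2)]
        modular_integrable(2)[OF W0_measurable(2)[OF w(1)] W0_finite(2)[OF w(1)], symmetric] ..
  qed
  define d where "d = \<delta> - 1"
  have d: "d > 0" using delta_gt_1 by (simp add: d_def)
  have "(\<integral>x. \<Phi> (norm (g x)) \<partial>M) + 1 / d * (\<integral>x. b x * u x powr (1 - \<delta>) \<partial>M)
    \<le> (\<integral>x. \<Phi> (norm (h x)) \<partial>M) + 1 / d * (\<integral>x. b x * v x powr (1 - \<delta>) \<partial>M)"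
    using min[OF V] ennreal_le_iff[OF J(2)[OF V Ev]] unfolding J(1)[OF W E_u] J(1)[OF V Ev] d_def by blast
  then have "d * ((\<integral>x. \<Phi> (norm (g x)) \<partial>M) + 1 / d * (\<integral>x. b x * u x powr (1 - \<delta>) \<partial>M))
    \<le> d * ((\<integral>x. \<Phi> (norm (h x)) \<partial>M) + 1 / d * (\<integral>x. b x * v x powr (1 - \<delta>) \<partial>M))"
    using d by (intro mult_left_mono) auto
  then show ?thesis using d by (simp add: d_def[symmetric] distrib_left)
qed

lemma subgradient_integral:
  assumes "W0 v h" "W0 w k"
  shows "(\<integral>x. \<Phi> (norm (h x)) \<partial>M) + (\<integral>x. A (h x) \<bullet> (k x - h x) \<partial>M) \<le> (\<integral>x. \<Phi> (norm (k x)) \<partial>M)"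
proof -
  note m = W0_measurable(2)[OF assms(1)] W0_measurable(2)[OF assms(2)]
  note f = W0_finite(2)[OF assms(1)] W0_finite(2)[OF assms(2)]
  have d: "W0 (\<lambda>x. w x - v x) (\<lambda>x. k x - h x)" by (rule W0_diff[OF assms(2,1)])
  have i: "integrable M (\<lambda>x. \<Phi> (norm (h x)))" "integrable M (\<lambda>x. \<Phi> (norm (k x)))"
    "integrable M (\<lambda>x. A (h x) \<bullet> (k x - h x))"
    using modular_integrable(1)[OF m(1) f(1)] modular_integrable(1)[OF m(2) f(2)]
      A_integrable[OF m(1) W0_measurable(2)[OF d] f(1) W0_finite(2)[OF d]] by auto
  have "(\<integral>x. \<Phi> (norm (h x)) \<partial>M) + (\<integral>x. A (h x) \<bullet> (k x - h x) \<partial>M)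
      = (\<integral>x. \<Phi> (norm (h x)) + A (h x) \<bullet> (k x - h x) \<partial>M)"
    using i by simp
  also have "\<dots> \<le> (\<integral>x. \<Phi> (norm (k x)) \<partial>M)"
    using i by (intro integral_mono Phi_subgradient) auto
  finally show ?thesis .
qed

text \<open>Raising \<open>u\<close> by a nonnegative multiple of \<open>f\<close> does not increase
  \<open>E\<close>, so the competitors have finite energy. Both supporting lines are taken at the
  perturbed point: the change of the modular is then bounded above by \<open>t n * I n\<close>, and
  the gain of the singular part below by a multiple of \<open>t n * f' n x\<close>. As
  \<open>t n\<close> tends to 0, \<open>I\<close> converges by domination while Fatou handles
  \<open>f'\<close>, which also yields the integrability.\<close>

lemma nonneg_direction:
  assumes F: "W0 f k" and nonneg: "AE x in M. f x \<ge> 0"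
  shows "integrable M (\<lambda>x. b x * u x powr (- \<delta>) * f x)"
    "(\<integral>x. b x * u x powr (- \<delta>) * f x \<partial>M) \<le> (\<integral>x. A (g x) \<bullet> k x \<partial>M)"
proof -
  note [measurable] = W0_measurable[OF F]
  define t where "t = (\<lambda>n. 1 / real (Suc n))"
  have t: "t n > 0" "\<bar>t n\<bar> \<le> 1" for n by (auto simp: t_def)
  have t0: "t \<longlonglongrightarrow> 0" unfolding t_def by real_asymp
  define I where "I = (\<lambda>n. \<integral>x. A (g x + t n *\<^sub>R k x) \<bullet> k x \<partial>M)"
  define I0 where "I0 = (\<integral>x. A (g x) \<bullet> k x \<partial>M)"
  have Ilim: "I \<longlonglongrightarrow> I0"
    unfolding I_def I0_def
    using W0_measurable(2)[OF W] W0_measurable(2)[OF F] W0_finite(2)[OF W] W0_finite(2)[OF F] t0 t(2)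
    by (rule A_perturb_limit)
  define f' where "f' = (\<lambda>n x. b x * (u x + t n * f x) powr (- \<delta>) * f x)"
  have f'_nonneg: "AE x in M. 0 \<le> f' n x" for n
    using nonneg b_pos by eventually_elim (simp add: f'_def)
  have key: "integrable M (f' n)" "(\<integral>x. f' n x \<partial>M) \<le> I n" for n
  proof -
    let ?v = "\<lambda>x. u x + t n * f x"
    have V: "W0 ?v (\<lambda>x. g x + t n *\<^sub>R k x)" by (rule W0_add[OF W W0_scale[OF F]])
    have "E ?v \<le> E u"
      by (rule E_antimono) (use nonneg t(1)[of n] in \<open>auto elim!: eventually_mono\<close>)
    then have Ev: "E ?v < \<infinity>" using E_u by (rule le_less_trans)
    note iu = E_finite(2)[OF measurable_u(1) E_u] and iv = E_finite(2)[OF W0_measurable(1)[OF V] Ev]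
    have le: "AE x in M. (\<delta> - 1) * t n * f' n x \<le> b x * u x powr (1 - \<delta>) - b x * ?v x powr (1 - \<delta>)"
      using u_pos nonneg b_pos
    proof eventually_elim
      fix x assume x: "u x > 0" "f x \<ge> 0" "b x > 0"
      have "t n * f x \<ge> 0" using t(1)[of n] x(2) by simp
      then have "?v x > 0" using x(1) by linarith
      from powr_neg_subgradient[OF delta_gt_1 x(1) this]
      have "(\<delta> - 1) * ?v x powr (- \<delta>) * (t n * f x) \<le> u x powr (1 - \<delta>) - ?v x powr (1 - \<delta>)"
        by simp
      then have "b x * ((\<delta> - 1) * ?v x powr (- \<delta>) * (t n * f x)) \<le> b x * (u x powr (1 - \<delta>) - ?v x powr (1 - \<delta>))"
        using x(3) by (intro mult_left_mono) auto
      then show "(\<delta> - 1) * t n * f' n x \<le> b x * u x powr (1 - \<delta>) - b x * ?v x powr (1 - \<delta>)"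
        by (simp add: f'_def algebra_simps)
    qed
    have c: "(\<delta> - 1) * t n > 0" using delta_gt_1 t(1)[of n] by simp
    have "integrable M (\<lambda>x. (\<delta> - 1) * t n * f' n x)"
    proof (rule Bochner_Integration.integrable_bound)
      show "integrable M (\<lambda>x. b x * u x powr (1 - \<delta>) - b x * ?v x powr (1 - \<delta>))"
        using iu iv by simp
      show "AE x in M. norm ((\<delta> - 1) * t n * f' n x) \<le> norm (b x * u x powr (1 - \<delta>) - b x * ?v x powr (1 - \<delta>))"
        using le f'_nonneg[of n]
      proof eventually_elim
        fix x assume l: "(\<delta> - 1) * t n * f' n x \<le> b x * u x powr (1 - \<delta>) - b x * ?v x powr (1 - \<delta>)"
          and "0 \<le> f' n x"
        from mult_nonneg_nonneg[OF less_imp_le[OF c] this(2)] show "norm ((\<delta> - 1) * t n * f' n x) \<le> norm (b x * u x powr (1 - \<delta>) - b x * ?v x powr (1 - \<delta>))"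
          using l by (simp only: real_norm_def abs_of_nonneg)
      qed
    qed (simp add: f'_def)
    then show i: "integrable M (f' n)" using delta_gt_1 t(1)[of n] by simp
    have "(\<delta> - 1) * t n * (\<integral>x. f' n x \<partial>M) = (\<integral>x. (\<delta> - 1) * t n * f' n x \<partial>M)" by simp
    also have "\<dots> \<le> (\<integral>x. b x * u x powr (1 - \<delta>) - b x * ?v x powr (1 - \<delta>) \<partial>M)"
      using i iu iv le by (intro integral_mono_AE) auto
    also have "\<dots> = (\<integral>x. b x * u x powr (1 - \<delta>) \<partial>M) - (\<integral>x. b x * ?v x powr (1 - \<delta>) \<partial>M)"
      using iu iv by simp
    also have "\<dots> \<le> (\<delta> - 1) * (\<integral>x. \<Phi> (norm (g x + t n *\<^sub>R k x)) \<partial>M) - (\<delta> - 1) * (\<integral>x. \<Phi> (norm (g x)) \<partial>M)"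
      using min_real[OF V Ev] by linarith
    also have "\<dots> = (\<delta> - 1) * ((\<integral>x. \<Phi> (norm (g x + t n *\<^sub>R k x)) \<partial>M) - (\<integral>x. \<Phi> (norm (g x)) \<partial>M))"
      by (simp add: right_diff_distrib)
    also have "\<dots> \<le> (\<delta> - 1) * (t n * I n)"
    proof (rule mult_left_mono)
      have "(\<integral>x. A (g x + t n *\<^sub>R k x) \<bullet> (g x - (g x + t n *\<^sub>R k x)) \<partial>M) = - (t n * I n)"
        unfolding I_def by simp
      then show "(\<integral>x. \<Phi> (norm (g x + t n *\<^sub>R k x)) \<partial>M) - (\<integral>x. \<Phi> (norm (g x)) \<partial>M) \<le> t n * I n"
        using subgradient_integral[OF V W] by linarith
    qed (use delta_gt_1 in simp)
    finally have "((\<delta> - 1) * t n) * (\<integral>x. f' n x \<partial>M) \<le> ((\<delta> - 1) * t n) * I n" by (simp add: mult.assoc)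
    then show "(\<integral>x. f' n x \<partial>M) \<le> I n" using c by (rule mult_left_le_imp_le)
  qed
  \<comment> \<open>Needed before passing to \<open>ennreal\<close>, which would truncate a negative
    limit to 0.\<close>
  have I0: "0 \<le> I0"
  proof (rule LIMSEQ_le_const[OF Ilim])
    have "0 \<le> I n" for n
      using integral_nonneg_AE[OF f'_nonneg[of n]] key(2)[of n] by linarith
    then show "\<exists>N. \<forall>n\<ge>N. 0 \<le> I n" by blast
  qed
  have "(\<integral>\<^sup>+x. ennreal (b x * u x powr (- \<delta>) * f x) \<partial>M) = (\<integral>\<^sup>+x. liminf (\<lambda>n. ennreal (f' n x)) \<partial>M)"
  proof (rule nn_integral_cong_AE, use u_pos in eventually_elim)
    fix x assume x: "u x > 0"
    have "(\<lambda>n. u x + t n * f x) \<longlonglongrightarrow> u x + 0 * f x" by (intro tendsto_intros t0)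
    then have "(\<lambda>n. u x + t n * f x) \<longlonglongrightarrow> u x" by simp
    then have "(\<lambda>n. (u x + t n * f x) powr (- \<delta>)) \<longlonglongrightarrow> u x powr (- \<delta>)"
      by (rule tendsto_powr[OF _ tendsto_const]) (use x in simp)
    then have "(\<lambda>n. f' n x) \<longlonglongrightarrow> b x * u x powr (- \<delta>) * f x"
      unfolding f'_def by (intro tendsto_mult tendsto_const)
    then show "ennreal (b x * u x powr (- \<delta>) * f x) = liminf (\<lambda>n. ennreal (f' n x))"
      by (intro lim_imp_Liminf[symmetric] tendsto_ennrealI) auto
  qed
  also have "\<dots> \<le> liminf (\<lambda>n. \<integral>\<^sup>+x. ennreal (f' n x) \<partial>M)"
    by (rule nn_integral_liminf) (simp add: f'_def)
  also have "\<dots> \<le> liminf (\<lambda>n. ennreal (I n))"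
  proof (rule Liminf_mono[OF always_eventually], rule allI)
    fix n
    show "(\<integral>\<^sup>+x. ennreal (f' n x) \<partial>M) \<le> ennreal (I n)"
      using nn_integral_eq_integral[OF key(1) f'_nonneg] key(2)[of n] by (simp add: ennreal_leI)
  qed
  also have "\<dots> = ennreal I0"
    by (rule lim_imp_Liminf[OF _ tendsto_ennrealI[OF Ilim]]) simp
  finally have le: "(\<integral>\<^sup>+x. ennreal (b x * u x powr (- \<delta>) * f x) \<partial>M) \<le> ennreal I0" .
  have nn: "AE x in M. 0 \<le> b x * u x powr (- \<delta>) * f x"
    using nonneg b_pos by eventually_elim simp
  show i: "integrable M (\<lambda>x. b x * u x powr (- \<delta>) * f x)"
    by (rule integrableI_nonneg[OF _ nn]) (use le in \<open>auto intro: le_less_trans\<close>)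
  have "ennreal (\<integral>x. b x * u x powr (- \<delta>) * f x \<partial>M) \<le> ennreal I0"
    using le nn_integral_eq_integral[OF i nn] by simp
  then show "(\<integral>x. b x * u x powr (- \<delta>) * f x \<partial>M) \<le> (\<integral>x. A (g x) \<bullet> k x \<partial>M)"
    using I0 by (simp add: I0_def)
qed

text \<open>For \<open>0 < s < 1\<close> the competitor \<open>s * u\<close> has the finite energy
  \<open>s powr (1 - \<delta>) * E u\<close>. The result is the inequality opposite to
  \<open>nonneg_direction\<close> for \<open>f = u\<close>.\<close>

lemma scaling_direction:
  "(\<integral>x. A (g x) \<bullet> g x \<partial>M) \<le> (\<integral>x. b x * u x powr (1 - \<delta>) \<partial>M)"
proof -
  define Q where "Q = (\<integral>x. b x * u x powr (1 - \<delta>) \<partial>M)"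
  \<comment> \<open>Starts at \<open>1 / 2\<close>, so that the factor \<open>1 - t n\<close> stays
    positive.\<close>
  define t where "t = (\<lambda>n. 1 / real (Suc (Suc n)))"
  have t: "t n > 0" "t n < 1" for n by (auto simp: t_def)
  have t0: "t \<longlonglongrightarrow> 0" unfolding t_def by real_asymp
  note iu = E_finite(2)[OF measurable_u(1) E_u]
  have Q: "Q \<ge> 0"
    unfolding Q_def by (rule integral_nonneg_AE) (use b_pos in eventually_elim, simp)
  have key: "(\<integral>x. A (g x + (- t n) *\<^sub>R g x) \<bullet> g x \<partial>M) \<le> (1 - t n) powr (- \<delta>) * Q" for n
  proof -
    define s where "s = 1 - t n"
    have s: "s > 0" "t n = 1 - s" using t(2)[of n] by (auto simp: s_def)
    have V: "W0 (\<lambda>x. s * u x) (\<lambda>x. s *\<^sub>R g x)" by (rule W0_scale[OF W])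
    have "E (\<lambda>x. s * u x) = (\<integral>\<^sup>+x. ennreal (s powr (1 - \<delta>)) * (ennreal (b x) * G (u x)) \<partial>M)"
      unfolding E_def
    proof (rule nn_integral_cong_AE, use u_pos in eventually_elim)
      fix x assume "u x > 0"
      then show "ennreal (b x) * G (s * u x) = ennreal (s powr (1 - \<delta>)) * (ennreal (b x) * G (u x))"
        using s by (simp add: G_def powr_mult ennreal_mult mult.left_commute)
    qed
    also have "\<dots> = ennreal (s powr (1 - \<delta>)) * E u"
      unfolding E_def by (rule nn_integral_cmult) measurable
    finally have Ev: "E (\<lambda>x. s * u x) < \<infinity>"
      using E_u by (simp add: ennreal_mult_less_top)
    have Qv: "(\<integral>x. b x * (s * u x) powr (1 - \<delta>) \<partial>M) = s powr (1 - \<delta>) * Q"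
    proof -
      have "(\<integral>x. b x * (s * u x) powr (1 - \<delta>) \<partial>M) = (\<integral>x. s powr (1 - \<delta>) * (b x * u x powr (1 - \<delta>)) \<partial>M)"
        by (rule integral_cong_AE) (use u_pos s in \<open>auto elim!: eventually_mono simp: powr_mult\<close>)
      then show ?thesis by (simp add: Q_def)
    qed
    let ?I = "\<integral>x. A (s *\<^sub>R g x) \<bullet> g x \<partial>M"
    have "(\<lambda>x. g x - s *\<^sub>R g x) = (\<lambda>x. t n *\<^sub>R g x)" by (simp add: s(2) scaleR_diff_left)
    then have "(\<integral>x. A (s *\<^sub>R g x) \<bullet> (g x - s *\<^sub>R g x) \<partial>M) = t n * ?I"
      by (simp add: fun_eq_iff)
    then have 1: "(\<integral>x. \<Phi> (norm (s *\<^sub>R g x)) \<partial>M) + t n * ?I \<le> (\<integral>x. \<Phi> (norm (g x)) \<partial>M)"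
      using subgradient_integral[OF V W] by simp
    have 2: "(\<delta> - 1) * (\<integral>x. \<Phi> (norm (g x)) \<partial>M) + Q
        \<le> (\<delta> - 1) * (\<integral>x. \<Phi> (norm (s *\<^sub>R g x)) \<partial>M) + s powr (1 - \<delta>) * Q"
      using min_real[OF V Ev] by (simp only: Qv Q_def[symmetric])
    have "(\<delta> - 1) * ((\<integral>x. \<Phi> (norm (s *\<^sub>R g x)) \<partial>M) + t n * ?I) \<le> (\<delta> - 1) * (\<integral>x. \<Phi> (norm (g x)) \<partial>M)"
      using 1 delta_gt_1 by (intro mult_left_mono) auto
    then have 3: "(\<delta> - 1) * (t n * ?I) \<le> s powr (1 - \<delta>) * Q - Q"
      using 2 by (simp add: distrib_left)
    have "s powr (1 - \<delta>) - 1 \<le> (\<delta> - 1) * s powr (- \<delta>) * t n"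
      using powr_neg_subgradient[OF delta_gt_1, of 1 s] s by simp
    from mult_right_mono[OF this Q] have "s powr (1 - \<delta>) * Q - Q \<le> (\<delta> - 1) * s powr (- \<delta>) * t n * Q"
      by (simp add: left_diff_distrib)
    with 3 have "((\<delta> - 1) * t n) * ?I \<le> ((\<delta> - 1) * t n) * (s powr (- \<delta>) * Q)"
      by (simp add: mult.assoc mult.left_commute)
    moreover have "(\<delta> - 1) * t n > 0" using delta_gt_1 t(1)[of n] by simp
    ultimately have "?I \<le> s powr (- \<delta>) * Q" by (rule mult_left_le_imp_le)
    moreover have "g x + (- t n) *\<^sub>R g x = s *\<^sub>R g x" for x
      by (simp add: s_def scaleR_diff_left)
    ultimately show ?thesis by (simp add: s_def)
  qed
  have "(\<lambda>n. \<integral>x. A (g x + (- t n) *\<^sub>R g x) \<bullet> g x \<partial>M) \<longlonglongrightarrow> (\<integral>x. A (g x) \<bullet> g x \<partial>M)"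
  proof (rule A_perturb_limit[OF measurable_u(2,2) W0_finite(2)[OF W] W0_finite(2)[OF W]])
    show "(\<lambda>n. - t n) \<longlonglongrightarrow> 0" using tendsto_minus[OF t0] by simp
    show "\<bar>- t n\<bar> \<le> 1" for n using t[of n] by simp
  qed
  moreover have "(\<lambda>n. (1 - t n) powr (- \<delta>) * Q) \<longlonglongrightarrow> (1 - 0) powr (- \<delta>) * Q"
    by (intro tendsto_mult tendsto_powr tendsto_diff tendsto_const t0) simp
  ultimately show ?thesis
    using key unfolding Q_def[symmetric] by (intro LIMSEQ_le) auto
qed

text \<open>\<open>nonneg_direction\<close> is applied to the positive part of
  \<open>u + e n * f\<close>. Replacing it by \<open>u + e n * f\<close> only lowers the singular
  side; on the gradient side the nonnegative term \<open>A (g x) \<bullet> g x\<close> missing on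
  the cut set may be added. The terms with \<open>u\<close> alone cancel through
  \<open>scaling_direction\<close>, and after division by \<open>e n\<close> the cut disappears in
  the limit because \<open>u > 0\<close>.\<close>

lemma all_directions_le:
  assumes F: "W0 f k"
  shows "integrable M (\<lambda>x. b x * u x powr (- \<delta>) * f x)"
    "(\<integral>x. b x * u x powr (- \<delta>) * f x \<partial>M) \<le> (\<integral>x. A (g x) \<bullet> k x \<partial>M)"
proof -
  note [measurable] = W0_measurable[OF F]
  have Fm: "W0 (\<lambda>x. - f x) (\<lambda>x. - k x)" using W0_scale[OF F, of "-1"] by simp
  \<comment> \<open>For signed \<open>f\<close> the integrability comes from the positive and
    negative parts, both in the space by \<open>W0_pos\<close>.\<close>
  have "integrable M (\<lambda>x. b x * u x powr (- \<delta>) * max 0 (f x))"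
    "integrable M (\<lambda>x. b x * u x powr (- \<delta>) * max 0 (- f x))"
    using nonneg_direction(1)[OF W0_pos[OF F]] nonneg_direction(1)[OF W0_pos[OF Fm]] by auto
  from Bochner_Integration.integrable_diff[OF this]
  have "integrable M (\<lambda>x. b x * u x powr (- \<delta>) * max 0 (f x) - b x * u x powr (- \<delta>) * max 0 (- f x))" .
  moreover have "b x * u x powr (- \<delta>) * max 0 (f x) - b x * u x powr (- \<delta>) * max 0 (- f x)
      = b x * u x powr (- \<delta>) * f x" for x
    by (simp add: max_def)
  ultimately show i: "integrable M (\<lambda>x. b x * u x powr (- \<delta>) * f x)" by simp
  define e where "e = (\<lambda>n. 1 / real (Suc n))"
  have e: "e n > 0" for n by (auto simp: e_def)
  have e0: "e \<longlonglongrightarrow> 0" unfolding e_def by real_asymp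
  note iu = E_finite(2)[OF measurable_u(1) E_u]
  note iA = A_integrable[OF measurable_u(2) _ W0_finite(2)[OF W]]
  have iAg: "integrable M (\<lambda>x. A (g x) \<bullet> g x)"
    by (rule iA[OF measurable_u(2) W0_finite(2)[OF W]])
  have iAk: "integrable M (\<lambda>x. A (g x) \<bullet> k x)"
    by (rule iA[OF W0_measurable(2)[OF F] W0_finite(2)[OF F]])
  define P where "P = (\<lambda>n x. if u x + e n * f x > 0 then A (g x) \<bullet> k x else 0)"
  have Pm [measurable]: "P n \<in> borel_measurable M" for n unfolding P_def by measurable
  have iP: "integrable M (P n)" for n
    by (rule Bochner_Integration.integrable_bound[OF iAk]) (auto simp: P_def)
  have le: "(\<integral>x. b x * u x powr (- \<delta>) * f x \<partial>M) \<le> (\<integral>x. P n x \<partial>M)" for n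
  proof -
    let ?w = "\<lambda>x. max 0 (u x + e n * f x)"
    let ?k = "\<lambda>x. if u x + e n * f x > 0 then g x + e n *\<^sub>R k x else 0"
    have w: "W0 ?w ?k" by (rule W0_pos[OF W0_add[OF W W0_scale[OF F]]])
    note nd = nonneg_direction[OF w]
    have "(\<integral>x. b x * u x powr (1 - \<delta>) \<partial>M) + e n * (\<integral>x. b x * u x powr (- \<delta>) * f x \<partial>M)
        = (\<integral>x. b x * u x powr (1 - \<delta>) + e n * (b x * u x powr (- \<delta>) * f x) \<partial>M)"
      using iu i by simp
    also have "\<dots> \<le> (\<integral>x. b x * u x powr (- \<delta>) * ?w x \<partial>M)"
    proof (rule integral_mono_AE)
      show "integrable M (\<lambda>x. b x * u x powr (- \<delta>) * ?w x)" by (rule nd(1)) simp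
      show "AE x in M. b x * u x powr (1 - \<delta>) + e n * (b x * u x powr (- \<delta>) * f x) \<le> b x * u x powr (- \<delta>) * ?w x"
        using u_pos b_pos
      proof eventually_elim
        fix x assume x: "u x > 0" "b x > 0"
        have "b x * u x powr (1 - \<delta>) + e n * (b x * u x powr (- \<delta>) * f x) = b x * u x powr (- \<delta>) * (u x + e n * f x)"
          using x(1) powr_add[of "u x" "- \<delta>" 1] by (simp add: algebra_simps)
        also have "\<dots> \<le> b x * u x powr (- \<delta>) * ?w x"
          using x by (intro mult_left_mono) auto
        finally show "b x * u x powr (1 - \<delta>) + e n * (b x * u x powr (- \<delta>) * f x) \<le> b x * u x powr (- \<delta>) * ?w x" .
      qed
    qed (use iu i in simp)
    also have "\<dots> \<le> (\<integral>x. A (g x) \<bullet> ?k x \<partial>M)" by (rule nd(2)) simp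
    also have "\<dots> \<le> (\<integral>x. A (g x) \<bullet> g x + e n * P n x \<partial>M)"
    proof (rule integral_mono)
      show "integrable M (\<lambda>x. A (g x) \<bullet> ?k x)"
        by (rule iA[OF W0_measurable(2)[OF w] W0_finite(2)[OF w]])
      show "A (g x) \<bullet> ?k x \<le> A (g x) \<bullet> g x + e n * P n x" for x
        using phi_nonneg[of "norm (g x)"] by (simp add: P_def inner_add_right A_inner_self)
    qed (use iAg iP in simp)
    also have "\<dots> = (\<integral>x. A (g x) \<bullet> g x \<partial>M) + e n * (\<integral>x. P n x \<partial>M)"
      using iAg iP by simp
    also have "\<dots> \<le> (\<integral>x. b x * u x powr (1 - \<delta>) \<partial>M) + e n * (\<integral>x. P n x \<partial>M)"
      using scaling_direction by simp
    finally have "e n * (\<integral>x. b x * u x powr (- \<delta>) * f x \<partial>M) \<le> e n * (\<integral>x. P n x \<partial>M)" by simp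
    then show ?thesis using e by (rule mult_left_le_imp_le)
  qed
  have "(\<lambda>n. \<integral>x. P n x \<partial>M) \<longlonglongrightarrow> (\<integral>x. A (g x) \<bullet> k x \<partial>M)"
  proof (rule integral_dominated_convergence[where w = "\<lambda>x. \<bar>A (g x) \<bullet> k x\<bar>"])
    show "AE x in M. (\<lambda>n. P n x) \<longlonglongrightarrow> A (g x) \<bullet> k x"
      using u_pos
    proof eventually_elim
      fix x assume x: "u x > 0"
      have "(\<lambda>n. u x + e n * f x) \<longlonglongrightarrow> u x + 0 * f x" by (intro tendsto_intros e0)
      then have "\<forall>\<^sub>F n in sequentially. u x + e n * f x > 0"
        using x by (intro order_tendstoD(1)) auto
      then have "\<forall>\<^sub>F n in sequentially. P n x = A (g x) \<bullet> k x"
        by eventually_elim (simp add: P_def)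
      then show "(\<lambda>n. P n x) \<longlonglongrightarrow> A (g x) \<bullet> k x" by (rule tendsto_eventually)
    qed
    show "AE x in M. norm (P n x) \<le> \<bar>A (g x) \<bullet> k x\<bar>" for n by (simp add: P_def)
  qed (use iAk in auto)
  then show "(\<integral>x. b x * u x powr (- \<delta>) * f x \<partial>M) \<le> (\<integral>x. A (g x) \<bullet> k x \<partial>M)"
    by (rule LIMSEQ_le_const) (use le in auto)
qed

lemma euler_lagrange:
  assumes F: "W0 f k"
  shows "(\<integral>x. A (g x) \<bullet> k x \<partial>M) = (\<integral>x. b x * u x powr (- \<delta>) * f x \<partial>M)"
proof -
  have "W0 (\<lambda>x. - f x) (\<lambda>x. - k x)" using W0_scale[OF F, of "-1"] by simp
  from all_directions_le(2)[OF this] all_directions_le(2)[OF F] show ?thesis by simp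
qed

lemma is_weak_solution: "weak_solution a \<Omega> b \<delta> u"
  unfolding weak_solution_def
proof (intro conjI ballI u_pos)
  show "u \<in> orlicz_sobolev0 \<Phi> \<Omega>" by (rule W0_imp_orlicz_sobolev0[OF W])
  fix f assume "f \<in> orlicz_sobolev0 \<Phi> \<Omega>"
  then have F: "W0 f (weak_gradient \<Omega> f)" by (rule orlicz_sobolev0_imp_W0)
  show "integrable M (\<lambda>x. b x * u x powr (- \<delta>) * f x)" by (rule all_directions_le(1)[OF F])
  note wg = W0_weak_gradient[OF W]
  have "(\<integral>x. A (weak_gradient \<Omega> u x) \<bullet> weak_gradient \<Omega> f x \<partial>M) = (\<integral>x. A (g x) \<bullet> weak_gradient \<Omega> f x \<partial>M)"
  proof (rule integral_cong_AE)
    show "(\<lambda>x. A (weak_gradient \<Omega> u x) \<bullet> weak_gradient \<Omega> f x) \<in> borel_measurable M"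
      using wg(2) W0_measurable(2)[OF F] by measurable
    show "(\<lambda>x. A (g x) \<bullet> weak_gradient \<Omega> f x) \<in> borel_measurable M"
      using W0_measurable(2)[OF F] by measurable
    show "AE x in M. A (weak_gradient \<Omega> u x) \<bullet> weak_gradient \<Omega> f x = A (g x) \<bullet> weak_gradient \<Omega> f x"
      using wg(1) by eventually_elim simp
  qed
  then show "(\<integral>x. (a (norm (weak_gradient \<Omega> u x)) *\<^sub>R weak_gradient \<Omega> u x) \<bullet> weak_gradient \<Omega> f x \<partial>M)
      = (\<integral>x. b x * u x powr (- \<delta>) * f x \<partial>M)"
    using euler_lagrange[OF F] by (simp add: A_def)
qed

end

section \<open>Existence and uniqueness of the weak solution\<close>

context singular_problem
begin

lemma weak_solution_exists:
  assumes "W0 u0 g0" "E u0 < \<infinity>"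
  shows "\<exists>u. weak_solution a \<Omega> b \<delta> u"
proof -
  obtain u g where "W0 u g" "E u < \<infinity>" "\<And>v h. W0 v h \<Longrightarrow> J u g \<le> J v h"
    using assms by (rule minimizer_exists) blast
  then interpret minimizer a \<Omega> b \<delta> u g by unfold_locales
  show ?thesis using is_weak_solution by blast
qed

lemma weak_solution_unique:
  assumes u: "weak_solution a \<Omega> b \<delta> u" and v: "weak_solution a \<Omega> b \<delta> v"
  shows "AE x in M. u x = v x"
proof -
  let ?gu = "weak_gradient \<Omega> u" and ?gv = "weak_gradient \<Omega> v"
  have U: "W0 u ?gu" and V: "W0 v ?gv" and pos: "AE x in M. u x > 0" "AE x in M. v x > 0"
    using u v orlicz_sobolev0_imp_W0 by (auto simp: weak_solution_def)
  let ?f = "\<lambda>x. u x - v x"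
  have D: "W0 ?f (\<lambda>x. ?gu x - ?gv x)" by (rule W0_diff[OF U V])
  note wg = W0_weak_gradient[OF D]
  have f: "?f \<in> orlicz_sobolev0 \<Phi> \<Omega>" by (rule W0_imp_orlicz_sobolev0[OF D])
  have iu: "integrable M (\<lambda>x. b x * u x powr (- \<delta>) * ?f x)" and iv: "integrable M (\<lambda>x. b x * v x powr (- \<delta>) * ?f x)"
    using u v f by (auto simp: weak_solution_def)
  have eu: "(\<integral>x. A (?gu x) \<bullet> weak_gradient \<Omega> ?f x \<partial>M) = (\<integral>x. b x * u x powr (- \<delta>) * ?f x \<partial>M)"
    and ev: "(\<integral>x. A (?gv x) \<bullet> weak_gradient \<Omega> ?f x \<partial>M) = (\<integral>x. b x * v x powr (- \<delta>) * ?f x \<partial>M)"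
    using u v f by (auto simp: weak_solution_def A_def)
  have iAu: "integrable M (\<lambda>x. A (?gu x) \<bullet> weak_gradient \<Omega> ?f x)"
    by (rule A_integrable[OF W0_measurable(2)[OF U] wg(2) W0_finite(2)[OF U] W0_finite(2)[OF wg(3)]])
  have iAv: "integrable M (\<lambda>x. A (?gv x) \<bullet> weak_gradient \<Omega> ?f x)"
    by (rule A_integrable[OF W0_measurable(2)[OF V] wg(2) W0_finite(2)[OF V] W0_finite(2)[OF wg(3)]])
  \<comment> \<open>Nonnegative because the negative power decreases, while monotonicity of
    \<open>A\<close> makes its integral at most 0.\<close>
  let ?R = "\<lambda>x. b x * v x powr (- \<delta>) * ?f x - b x * u x powr (- \<delta>) * ?f x"
  have "0 \<le> (\<integral>x. A (?gu x) \<bullet> weak_gradient \<Omega> ?f x - A (?gv x) \<bullet> weak_gradient \<Omega> ?f x \<partial>M)"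
  proof (rule integral_nonneg_AE, use wg(1) in eventually_elim)
    fix x assume "weak_gradient \<Omega> ?f x = ?gu x - ?gv x"
    then show "0 \<le> A (?gu x) \<bullet> weak_gradient \<Omega> ?f x - A (?gv x) \<bullet> weak_gradient \<Omega> ?f x"
      using A_monotone[of "?gu x" "?gv x"] by (simp add: inner_diff_left)
  qed
  also have "\<dots> = - (\<integral>x. ?R x \<partial>M)"
    using iAu iAv iu iv by (simp add: eu ev)
  finally have le: "(\<integral>x. ?R x \<partial>M) \<le> 0" by simp
  have strict: "?R x > 0" if "u x > 0" "v x > 0" "b x > 0" "u x \<noteq> v x" for x
  proof -
    have "(v x powr (- \<delta>) - u x powr (- \<delta>)) * (u x - v x) > 0"
    proof (cases "u x < v x")
      case True
      then have "v x powr (- \<delta>) < u x powr (- \<delta>)"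
        using that delta_gt_1 by (intro powr_less_mono2_neg) auto
      then show ?thesis using True by (intro mult_neg_neg) auto
    next
      case False
      then have lt: "v x < u x" using that by simp
      then have "u x powr (- \<delta>) < v x powr (- \<delta>)"
        using that delta_gt_1 by (intro powr_less_mono2_neg) auto
      then show ?thesis using lt by (intro mult_pos_pos) auto
    qed
    then have "b x * ((v x powr (- \<delta>) - u x powr (- \<delta>)) * (u x - v x)) > 0"
      by (rule mult_pos_pos[OF that(3)])
    then show ?thesis by (simp add: algebra_simps)
  qed
  have nn: "AE x in M. 0 \<le> ?R x"
    using pos b_pos
  proof eventually_elim
    fix x assume "u x > 0" "v x > 0" "b x > 0"
    then show "0 \<le> ?R x" using strict[of x] by (cases "u x = v x") auto
  qed
  have iR: "integrable M ?R" using iu iv by (rule Bochner_Integration.integrable_diff[rotated])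
  have "(\<integral>x. ?R x \<partial>M) = 0"
    using le integral_nonneg_AE[OF nn] by linarith
  then have "AE x in M. ?R x = 0"
    using integral_nonneg_eq_0_iff_AE[OF iR nn] by blast
  with pos b_pos show ?thesis
  proof eventually_elim
    fix x assume "u x > 0" "v x > 0" "b x > 0" "?R x = 0"
    then show "u x = v x" using strict[of x] by force
  qed
qed

end

section \<open>A function of finite energy\<close>

text \<open>The chart component \<open>\<psi> x $ k\<close> is a defining function \<open>s\<close>
  of the domain. Differentiating \<open>\<psi> (\<eta> y) = y\<close> shows that the derivative of
  \<open>\<eta>\<close> sends the \<open>k\<close>-th axis to a vector \<open>v\<close> along which
  \<open>s\<close> has slope 1 at \<open>p\<close>; shrinking \<open>U\<close> keeps the slope above
  \<open>1 / 2\<close>.\<close>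

lemma boundary_chart:
  fixes \<Omega> :: "(real^'n) set"
  assumes "smooth_boundary \<Omega>" "p \<in> frontier \<Omega>"
  obtains U s v where "open U" "p \<in> U" "\<And>k. Ck_on k U s"
    "\<And>x. x \<in> U \<Longrightarrow> frechet_derivative s (at x) v > 1 / 2"
    "\<And>x. x \<in> U \<Longrightarrow> x \<in> \<Omega> \<longleftrightarrow> s x > (0::real)"
proof -
  obtain U V \<psi> \<eta> k where c: "open U" "p \<in> U" "open V" "homeomorphism U V \<psi> \<eta>"
      "smooth_on U (\<psi> :: real^'n \<Rightarrow> real^'n)" "smooth_on V \<eta>"
      "\<And>x. x \<in> U \<Longrightarrow> x \<in> \<Omega> \<longleftrightarrow> \<psi> x $ k > 0"
    using assms unfolding smooth_boundary_def by meson
  have C\<psi>: "Ck_on m U \<psi>" and C\<eta>: "Ck_on m V \<eta>" for m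
    using c(5,6) by (auto simp: smooth_on_def)
  have inv: "\<psi> p \<in> V" "\<eta> (\<psi> p) = p" "\<And>y. y \<in> V \<Longrightarrow> \<psi> (\<eta> y) = y"
    using c(2,4) by (auto simp: homeomorphism_def)
  define D1 where "D1 = frechet_derivative \<psi> (at p)"
  define D2 where "D2 = frechet_derivative \<eta> (at (\<psi> p))"
  have d1: "(\<psi> has_derivative D1) (at (\<eta> (\<psi> p)))"
    unfolding D1_def inv(2) by (rule Ck_on_has_derivative[OF c(1) C\<psi> c(2)])
  have d2: "(\<eta> has_derivative D2) (at (\<psi> p))"
    unfolding D2_def by (rule Ck_on_has_derivative[OF c(3) C\<eta> inv(1)])
  have "((\<lambda>y. \<psi> (\<eta> y)) has_derivative (\<lambda>v. D1 (D2 v))) (at (\<psi> p))"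
    by (rule has_derivative_compose[OF d2 d1])
  then have "((\<lambda>y. y) has_derivative (\<lambda>v. D1 (D2 v))) (at (\<psi> p))"
    by (rule has_derivative_transform_within_open[OF _ c(3) inv(1)]) (simp add: inv(3))
  then have id: "(\<lambda>v. D1 (D2 v)) = (\<lambda>v. v)"
    using has_derivative_ident by (rule has_derivative_unique)
  define v where "v = D2 (axis k 1)"
  define s where "s = (\<lambda>x. \<psi> x $ k)"
  have Cs: "Ck_on m U s" for m
    unfolding s_def by (rule Ck_on_compose_linear[OF c(1) bounded_linear_vec_nth C\<psi>])
  have fs: "frechet_derivative s (at x) w = frechet_derivative \<psi> (at x) w $ k" if "x \<in> U" for x w
  proof -
    have "(s has_derivative (\<lambda>w. frechet_derivative \<psi> (at x) w $ k)) (at x)"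
      unfolding s_def
      by (rule bounded_linear.has_derivative[OF bounded_linear_vec_nth Ck_on_has_derivative[OF c(1) C\<psi> that]])
    from frechet_derivative_has[OF this] show ?thesis by simp
  qed
  have "D1 v = axis k 1" using fun_cong[OF id] by (simp add: v_def)
  then have at_p: "frechet_derivative s (at p) v = 1"
    using fs[OF c(2)] by (simp add: D1_def)
  have "continuous_on U (\<lambda>x. frechet_derivative s (at x) v)"
    using Cs[of "Suc 0"] by simp
  then have "open (U \<inter> (\<lambda>x. frechet_derivative s (at x) v) -` {1 / 2<..})"
    using c(1) by (rule continuous_open_preimage) simp
  moreover have "Ck_on m (U \<inter> (\<lambda>x. frechet_derivative s (at x) v) -` {1 / 2<..}) s" for m
    using Cs by (rule Ck_on_subset) blast
  ultimately show thesis
    using at_p c(2,7)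
    by (intro that[of "U \<inter> (\<lambda>x. frechet_derivative s (at x) v) -` {1 / 2<..}" s v]) (auto simp: s_def)
qed

text \<open>Since \<open>s\<close> grows along \<open>v\<close>, translates of the strip by multiples of \<open>3 r v\<close> are disjoint;
  about \<open>1 / (3 r)\<close> of them fit into a fixed ball.\<close>

lemma strip_measure:
  fixes s :: "real^'n \<Rightarrow> real"
  assumes U: "open U" "\<And>x. x \<in> U \<Longrightarrow> (s has_derivative frechet_derivative s (at x)) (at x)"
    and K: "cbox c d \<subseteq> U" "\<And>x. x \<in> cbox c d \<Longrightarrow> frechet_derivative s (at x) v > 1 / 2"
  obtains C where "C \<ge> 0" "\<And>r. r > 0 \<Longrightarrow> {x \<in> cbox c d. 0 < s x \<and> s x \<le> r} \<in> lmeasurable \<and>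
    measure lebesgue {x \<in> cbox c d. 0 < s x \<and> s x \<le> r} \<le> C * r"
proof -
  let ?K = "cbox c d"
  have sc: "continuous_on ?K s"
    using U(2) K(1) by (meson has_derivative_at_withinI has_derivative_continuous_on subsetD)
  define st where "st = (\<lambda>x. indicator ?K x *\<^sub>R s x)"
  have st: "st \<in> borel_measurable borel"
    unfolding st_def by (rule borel_measurable_continuous_on_indicator[OF _ sc]) simp
  define S where "S = (\<lambda>r. {x \<in> ?K. 0 < s x \<and> s x \<le> r})"
  have Sm: "S r \<in> lmeasurable" for r
  proof (rule bounded_set_imp_lmeasurable)
    show "bounded (S r)" by (rule bounded_subset[OF bounded_cbox[of c d]]) (auto simp: S_def)
    have "S r = {x. 0 < st x \<and> st x \<le> r}" by (auto simp: S_def st_def indicator_def split: if_splits)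
    also have "\<dots> \<in> sets borel" using st by measurable
    finally show "S r \<in> sets lebesgue" by (simp add: sets_completionI_sets)
  qed
  \<comment> \<open>In direction \<open>v\<close> the function \<open>s\<close> rises at a rate
    above \<open>1 / 2\<close>, while on the strip its values span at most \<open>r\<close>.\<close>
  have mono: "\<bar>\<tau>\<bar> \<le> 2 * r" if x: "x \<in> S r" "x + \<tau> *\<^sub>R v \<in> S r" for x \<tau> r
  proof -
    have *: "\<tau> \<le> 2 * r" if x: "x \<in> S r" "x + \<tau> *\<^sub>R v \<in> S r" and \<tau>: "\<tau> > 0" for x \<tau>
    proof -
      \<comment> \<open>The box is convex, so the segment remains where the slope is
        controlled.\<close>
      have seg: "x + t *\<^sub>R v \<in> ?K" if "0 \<le> t" "t \<le> \<tau>" for t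
      proof -
        have "(1 - t / \<tau>) *\<^sub>R x + (t / \<tau>) *\<^sub>R (x + \<tau> *\<^sub>R v) \<in> ?K"
          using x that \<tau> by (intro convexD[OF convex_box(1)]) (auto simp: S_def)
        moreover have "(1 - t / \<tau>) *\<^sub>R x + (t / \<tau>) *\<^sub>R (x + \<tau> *\<^sub>R v) = x + t *\<^sub>R v"
          using \<tau> by (simp add: algebra_simps)
        ultimately show ?thesis by simp
      qed
      have der: "((\<lambda>t. s (x + t *\<^sub>R v)) has_real_derivative frechet_derivative s (at (x + t *\<^sub>R v)) v) (at t)"
        if "0 \<le> t" "t \<le> \<tau>" for t
      proof -
        have D: "(s has_derivative frechet_derivative s (at (x + t *\<^sub>R v))) (at (x + t *\<^sub>R v))"
          using U(2) K(1) seg[OF that] by blast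
        have "((\<lambda>t. s (x + t *\<^sub>R v)) has_derivative (\<lambda>h. frechet_derivative s (at (x + t *\<^sub>R v)) (h *\<^sub>R v))) (at t)"
          by (rule has_derivative_compose[of "\<lambda>t. x + t *\<^sub>R v" "\<lambda>h. h *\<^sub>R v" t UNIV s, OF _ D])
            (auto intro!: derivative_eq_intros)
        moreover have "(\<lambda>h. frechet_derivative s (at (x + t *\<^sub>R v)) (h *\<^sub>R v)) = (*) (frechet_derivative s (at (x + t *\<^sub>R v)) v)"
          using linear_scale[OF has_derivative_linear[OF D]] by (auto simp: mult.commute)
        ultimately show ?thesis by (simp add: has_field_derivative_def)
      qed
      have "s (x + 0 *\<^sub>R v) - 1 / 2 * 0 \<le> s (x + \<tau> *\<^sub>R v) - 1 / 2 * \<tau>"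
      proof (rule DERIV_nonneg_imp_nondecreasing[of 0 \<tau> "\<lambda>t. s (x + t *\<^sub>R v) - 1 / 2 * t"])
        fix t assume t: "0 \<le> t" "t \<le> \<tau>"
        have "((\<lambda>t. s (x + t *\<^sub>R v) - 1 / 2 * t) has_real_derivative
            frechet_derivative s (at (x + t *\<^sub>R v)) v - 1 / 2 * 1) (at t)"
          by (intro DERIV_diff der[OF t] DERIV_cmult DERIV_ident)
        then show "\<exists>y. ((\<lambda>t. s (x + t *\<^sub>R v) - 1 / 2 * t) has_real_derivative y) (at t) \<and> 0 \<le> y"
          using K(2)[OF seg[OF t]] by (intro exI conjI) auto
      qed (use \<tau> in simp)
      then show ?thesis using x by (simp add: S_def)
    qed
    consider "\<tau> = 0" | "\<tau> > 0" | "- \<tau> > 0" by linarith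
    then show ?thesis
    proof cases
      case 1
      then show ?thesis using x by (auto simp: S_def)
    next
      case 2
      then show ?thesis using *[OF x] by simp
    next
      case 3
      then show ?thesis using *[of "x + \<tau> *\<^sub>R v" "- \<tau>"] x by simp
    qed
  qed
  obtain R where R: "R > 0" "?K \<subseteq> cball 0 R"
    using bounded_cbox[of c d] by (auto simp: bounded_pos subset_iff)
  \<comment> \<open>All translates stay in this ball, since no shift exceeds one full
    \<open>v\<close>.\<close>
  define B where "B = cball (0::real^'n) (R + norm v)"
  define m0 where "m0 = measure lebesgue B"
  have Bm: "B \<in> lmeasurable" by (simp add: B_def)
  have SB: "S r \<subseteq> B" for r
  proof
    fix x assume "x \<in> S r"
    then have "norm x \<le> R" using R(2) by (auto simp: S_def)
    then show "x \<in> B" by (simp add: B_def add_increasing2)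
  qed
  have m0: "m0 \<ge> 0" by (simp add: m0_def)
  have small: "measure lebesgue (S r) \<le> 6 * m0 * r" if r: "0 < r" "3 * r \<le> 1" for r
  proof -
    \<comment> \<open>Larger than the bound \<open>2 * r\<close>, hence disjoint translates; as
      \<open>1 / h \<ge> 1\<close>, rounding down still leaves at least \<open>1 / (2 * h)\<close>
      of them.\<close>
    define h where "h = 3 * r"
    have h: "0 < h" "h \<le> 1" using r by (auto simp: h_def)
    define n where "n = nat \<lfloor>1 / h\<rfloor>"
    have "1 / h \<ge> 1" using h by simp
    then have fl: "1 \<le> \<lfloor>1 / h\<rfloor>" by (simp only: le_floor_iff of_int_1)
    have "0 \<le> \<lfloor>1 / h\<rfloor>" using fl by (rule order_trans[rotated]) simp
    then have "real n = of_int \<lfloor>1 / h\<rfloor>" unfolding n_def by (rule of_nat_nat)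
    moreover have "(1::real) \<le> of_int \<lfloor>1 / h\<rfloor>" using fl by (simp only: of_int_1_le_iff)
    ultimately have n1: "real n \<le> 1 / h" "1 / h < real n + 1" "real n \<ge> 1"
      using of_int_floor_le[of "1 / h"] real_of_int_floor_add_one_gt[of "1 / h"] by simp_all
    then have n: "real n * h \<le> 1" "1 \<le> 2 * h * real n"
    proof -
      show "real n * h \<le> 1" using n1(1) h by (simp add: field_simps)
      have "1 / h \<le> 2 * real n" using n1 by linarith
      then show "1 \<le> 2 * h * real n" using h by (simp add: field_simps)
    qed
    define T where "T = (\<lambda>j::nat. (+) ((real j * h) *\<^sub>R v) ` S r)"
    have Tm: "T j \<in> lmeasurable" for j unfolding T_def by (rule measurable_translation[OF Sm])
    have disj: "disjoint_family_on T {..<n}"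
      unfolding disjoint_family_on_def
    proof (intro ballI impI)
      fix i j :: nat assume ij: "i \<noteq> j"
      show "T i \<inter> T j = {}"
      proof (rule ccontr)
        assume "T i \<inter> T j \<noteq> {}"
        then obtain x y where xy: "x \<in> S r" "y \<in> S r" "(real i * h) *\<^sub>R v + x = (real j * h) *\<^sub>R v + y"
          by (auto simp: T_def)
        then have "y = x + ((real i - real j) * h) *\<^sub>R v" by (simp add: algebra_simps)
        then have "\<bar>(real i - real j) * h\<bar> \<le> 2 * r" using mono xy by blast
        moreover have "\<bar>real i - real j\<bar> \<ge> 1" using ij by linarith
        then have "\<bar>(real i - real j) * h\<bar> \<ge> h" using h by (simp add: abs_mult)
        ultimately show False using r by (simp add: h_def)
      qed
    qed
    have sub: "T j \<subseteq> B" if "j < n" for j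
    proof
      fix z assume "z \<in> T j"
      then obtain x where x: "x \<in> S r" "z = (real j * h) *\<^sub>R v + x" by (auto simp: T_def)
      have "real j * h \<le> real n * h" using that h by (intro mult_right_mono) auto
      then have jh: "real j * h \<le> 1" using n(1) by simp
      have "norm ((real j * h) *\<^sub>R v) \<le> 1 * norm v"
        using jh h by (simp add: mult_left_le_one_le)
      moreover have "norm x \<le> R" using x(1) R by (auto simp: S_def subset_iff)
      ultimately show "z \<in> B"
        using norm_triangle_ineq[of "(real j * h) *\<^sub>R v" x] by (simp add: B_def x(2))
    qed
    have "real n * measure lebesgue (S r) = (\<Sum>j<n. measure lebesgue (T j))"
      by (simp add: T_def measure_translation)
    also have "\<dots> = measure lebesgue (\<Union>j<n. T j)"
    proof (rule measure_finite_Union[symmetric])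
      show "T ` {..<n} \<subseteq> sets lebesgue" using Tm by (auto simp: fmeasurableD)
      show "emeasure lebesgue (T j) \<noteq> \<infinity>" for j using fmeasurableD2[OF Tm[of j]] by simp
    qed (use disj in auto)
    also have "\<dots> \<le> m0"
      unfolding m0_def using sub Tm Bm by (intro measure_mono_fmeasurable) (auto simp: fmeasurableD)
    finally have 1: "real n * measure lebesgue (S r) \<le> m0" .
    have "measure lebesgue (S r) \<le> (2 * h * real n) * measure lebesgue (S r)"
      using mult_right_mono[OF n(2) measure_nonneg[of lebesgue "S r"]] by simp
    also have "\<dots> = 2 * h * (real n * measure lebesgue (S r))" by simp
    also have "\<dots> \<le> 2 * h * m0" using 1 h by (intro mult_left_mono) auto
    finally show ?thesis by (simp add: h_def mult.commute mult.left_commute)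
  qed
  show thesis
  \<comment> \<open>For \<open>3 * r \<le> 1\<close> the count gives \<open>2 * h * m0\<close>,
    which is \<open>6 * m0 * r\<close>; for larger \<open>r\<close> the same constant covers the
    trivial bound \<open>m0\<close>.\<close>
  proof (rule that[of "6 * m0"])
    fix r :: real assume r: "r > 0"
    have "measure lebesgue (S r) \<le> 6 * m0 * r"
    proof (cases "3 * r \<le> 1")
      case False
      have "measure lebesgue (S r) \<le> m0 * 1"
        unfolding m0_def using SB Sm Bm by (simp add: measure_mono_fmeasurable fmeasurableD)
      also have "\<dots> \<le> m0 * (6 * r)" using False m0 by (intro mult_left_mono) auto
      finally show ?thesis by (simp add: mult.commute mult.left_commute)
    qed (use small r in auto)
    then show "{x \<in> ?K. 0 < s x \<and> s x \<le> r} \<in> lmeasurable \<and>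
        measure lebesgue {x \<in> ?K. 0 < s x \<and> s x \<le> r} \<le> 6 * m0 * r"
      using Sm[of r] by (simp add: S_def)
  qed (use m0 in simp)
qed

text \<open>Dyadic layers: where \<open>s\<close> lies between
  \<open>2 powr (- real (Suc j))\<close> and \<open>2 powr (- real j)\<close>, the integrand is at
  most \<open>q j\<close>, and the measure is at most \<open>C * 2 powr (- real j)\<close>. The
  resulting series is geometric with ratio \<open>2 powr (\<alpha> - 1) < 1\<close>. Where
  \<open>s > 1\<close>, the integrand is at most 1 on a set of finite measure.\<close>

lemma negative_power_integrable:
  fixes s :: "'a \<Rightarrow> real"
  assumes [measurable]: "s \<in> borel_measurable N" and \<alpha>: "0 < \<alpha>" "\<alpha> < 1" and C: "C \<ge> 0"
    and strip: "\<And>r. r > 0 \<Longrightarrow> emeasure N {x \<in> space N. 0 < s x \<and> s x \<le> r} \<le> ennreal (C * r)"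
    and fin: "emeasure N {x \<in> space N. 0 < s x} < \<infinity>"
  shows "(\<integral>\<^sup>+x. ennreal (s x powr (- \<alpha>)) * indicator {x. 0 < s x} x \<partial>N) < \<infinity>"
proof -
  define q where "q = (\<lambda>j::nat. 2 powr (real (Suc j) * \<alpha>))"
  define S where "S = (\<lambda>j::nat. {x \<in> space N. 0 < s x \<and> s x \<le> 2 powr (- real j)})"
  define P where "P = {x \<in> space N. 0 < s x}"
  have [measurable]: "S j \<in> sets N" "P \<in> sets N" for j unfolding S_def P_def by measurable
  have "(\<integral>\<^sup>+x. ennreal (s x powr (- \<alpha>)) * indicator {x. 0 < s x} x \<partial>N)
      \<le> (\<integral>\<^sup>+x. indicator P x + (\<Sum>j. ennreal (q j) * indicator (S j) x) \<partial>N)"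
  proof (rule nn_integral_mono)
    fix x assume x: "x \<in> space N"
    show "ennreal (s x powr (- \<alpha>)) * indicator {x. 0 < s x} x
      \<le> indicator P x + (\<Sum>j. ennreal (q j) * indicator (S j) x)"
    proof (cases "0 < s x")
      case False
      then show ?thesis by simp
    next
      case True
      note pos = this
      show ?thesis
      proof (cases "s x \<le> 1")
        case False
        then have "s x powr (- \<alpha>) \<le> 1 powr (- \<alpha>)" using \<alpha> by (intro powr_mono2') auto
        then have "ennreal (s x powr (- \<alpha>)) \<le> ennreal 1" by (intro ennreal_leI) simp
        then have "ennreal (s x powr (- \<alpha>)) * indicator {x. 0 < s x} x \<le> indicator P x"
          using pos x by (simp add: P_def)
        then show ?thesis by (rule add_increasing2[rotated]) simp
      next
        case True
        define L where "L = log 2 (1 / s x)"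
        have L: "L \<ge> 0" using True pos by (simp add: L_def zero_le_log_cancel_iff)
        have sx: "s x = 2 powr (- L)" using pos by (simp add: L_def powr_minus divide_inverse)
        \<comment> \<open>Index of the dyadic layer of \<open>x\<close>. The sets \<open>S j\<close>
          are nested strips, but this one term of the sum already dominates the integrand.\<close>
        define j where "j = nat \<lfloor>L\<rfloor>"
        have j: "real j \<le> L" "L \<le> real (Suc j)" using L unfolding j_def by linarith+
        have "s x \<le> 2 powr (- real j)" unfolding sx using j by (intro powr_mono) auto
        then have xS: "x \<in> S j" using pos x by (simp add: S_def)
        have "s x powr (- \<alpha>) = 2 powr (L * \<alpha>)" unfolding sx by (simp add: powr_powr)
        also have "\<dots> \<le> q j" unfolding q_def using j \<alpha> by (intro powr_mono mult_right_mono) auto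
        finally have "ennreal (s x powr (- \<alpha>)) \<le> ennreal (q j) * indicator (S j) x"
          using xS by (simp add: ennreal_leI)
        also have "\<dots> \<le> (\<Sum>j. ennreal (q j) * indicator (S j) x)"
        proof -
          define F where "F = (\<lambda>j. ennreal (q j) * indicator (S j) x)"
          have "F j \<le> suminf F" using sum_le_suminf[of F "{j}"] by simp
          then show ?thesis by (simp only: F_def)
        qed
        finally have "ennreal (s x powr (- \<alpha>)) * indicator {x. 0 < s x} x \<le> (\<Sum>j. ennreal (q j) * indicator (S j) x)"
          using pos by simp
        then show ?thesis by (rule add_increasing[rotated]) simp
      qed
    qed
  qed
  also have "\<dots> = emeasure N P + (\<Sum>j. ennreal (q j) * emeasure N (S j))"
    by (simp add: nn_integral_add nn_integral_suminf nn_integral_cmult_indicator)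
  also have "\<dots> \<le> emeasure N P + (\<Sum>j. ennreal (q j * (C * 2 powr (- real j))))"
  proof (intro add_left_mono suminf_le allI)
    fix j
    have "ennreal (q j) * emeasure N (S j) \<le> ennreal (q j) * ennreal (C * 2 powr (- real j))"
      unfolding S_def by (intro mult_left_mono strip) auto
    also have "\<dots> = ennreal (q j * (C * 2 powr (- real j)))"
      using C by (simp add: q_def ennreal_mult)
    finally show "ennreal (q j) * emeasure N (S j) \<le> ennreal (q j * (C * 2 powr (- real j)))" .
  qed auto
  also have "\<dots> < \<infinity>"
  proof -
    have "summable (\<lambda>j. (C * 2 powr \<alpha>) * (2 powr (\<alpha> - 1)) ^ j)"
      using \<alpha> powr_less_mono[of "\<alpha> - 1" 0 2] by (intro summable_mult summable_geometric) simp
    moreover have "q j * (C * 2 powr (- real j)) = (C * 2 powr \<alpha>) * (2 powr (\<alpha> - 1)) ^ j" for j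
    proof -
      have "q j * 2 powr (- real j) = 2 powr (real (Suc j) * \<alpha> + - real j)"
        unfolding q_def by (simp only: powr_add)
      also have "real (Suc j) * \<alpha> + - real j = \<alpha> + (\<alpha> - 1) * real j" by (simp add: algebra_simps)
      also have "2 powr (\<alpha> + (\<alpha> - 1) * real j) = 2 powr \<alpha> * (2 powr (\<alpha> - 1)) ^ j"
        by (simp add: powr_add powr_powr[symmetric] powr_realpow)
      finally show ?thesis by (simp add: mult.left_commute mult.assoc)
    qed
    ultimately have "summable (\<lambda>j. q j * (C * 2 powr (- real j)))" by (simp only:)
    then have "(\<Sum>j. ennreal (q j * (C * 2 powr (- real j)))) \<noteq> top"
      using C by (intro ennreal_suminf_neq_top) (auto simp: q_def)
    then show ?thesis using fin by (simp add: P_def less_top)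
  qed
  finally show ?thesis .
qed

subsection \<open>Smooth approximation of powers\<close>

text \<open>The shift by 1 makes the cutoff vanish for \<open>s \<le> 1 / real (Suc n)\<close>, so
  the function is smooth on the whole line and its composition with a defining function vanishes
  near the boundary.\<close>

definition cutpow :: "real \<Rightarrow> nat \<Rightarrow> real \<Rightarrow> real" where
  "cutpow \<theta> n s = s powr \<theta> * flat 0 (real (Suc n) * s - 1)"

text \<open>The derivative of \<open>cutpow\<close> at \<open>s > 0\<close>, with the power taken
  out so that the remaining bracket is bounded independently of \<open>n\<close>.\<close>

definition cutpow' :: "real \<Rightarrow> nat \<Rightarrow> real \<Rightarrow> real" where
  "cutpow' \<theta> n s = s powr (\<theta> - 1) *
     (\<theta> * flat 0 (real (Suc n) * s - 1) + (real (Suc n) * s) * flat 2 (real (Suc n) * s - 1))"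

lemma cutpow_eq_0: "s \<le> 1 / real (Suc n) \<Longrightarrow> cutpow \<theta> n s = 0"
  by (simp add: cutpow_def flat0_bounds field_simps)

text \<open>Two overlapping open sets cover the line: on the positive numbers the function is a
  product of smooth ones, and below \<open>1 / real (Suc n)\<close> it is zero.\<close>

lemma Ck_on_cutpow: "Ck_on k UNIV (cutpow \<theta> n)"
proof -
  have "Ck_on k {0<..} (cutpow \<theta> n)"
    unfolding cutpow_def
  proof (intro Ck_on_mult Ck_on_powr)
    show "Ck_on k {0<..} (\<lambda>s. flat 0 (real (Suc n) * s - 1))"
    proof (rule Ck_on_compose[where h = "flat 0" and T = UNIV and f = "\<lambda>s. real (Suc n) * s - 1"])
      have "Ck_on k {0<..} (\<lambda>s. real (Suc n) * s + (- 1))"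
        by (intro Ck_on_add Ck_on_const Ck_on_linear bounded_linear_mult_right) auto
      then show "Ck_on k {0<..} (\<lambda>s. real (Suc n) * s - 1)" by simp
    qed (auto intro: Ck_on_flat)
  qed auto
  moreover have "Ck_on k {..<1 / real (Suc n)} (cutpow \<theta> n)"
    by (subst Ck_on_cong[where g = "\<lambda>_. 0"]) (auto intro: Ck_on_const cutpow_eq_0)
  ultimately have "Ck_on k ({0<..} \<union> {..<1 / real (Suc n)}) (cutpow \<theta> n)"
    by (intro Ck_on_Un) auto
  moreover have "{0<..} \<union> {..<1 / real (Suc n)} = (UNIV :: real set)"
  proof -
    have "x < 1 / real (Suc n)" if "\<not> 0 < x" for x
    proof -
      have "x \<le> 0" using that by simp
      also have "0 < 1 / real (Suc n)" by simp
      finally show ?thesis .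
    qed
    then show ?thesis by (auto simp del: of_nat_Suc)
  qed
  ultimately show ?thesis by simp
qed

lemma cutpow_has_derivative:
  assumes "s > 0"
  shows "(cutpow \<theta> n has_real_derivative cutpow' \<theta> n s) (at s)"
proof -
  let ?c = "real (Suc n)"
  have "((\<lambda>s. flat 0 (?c * s - 1)) has_real_derivative flat 2 (?c * s - 1) * ?c) (at s)"
    by (rule DERIV_chain2[where f = "flat 0" and g = "\<lambda>s. ?c * s - 1"])
      (use flat_has_derivative[of 0 "?c * s - 1"] in
        \<open>auto intro!: derivative_eq_intros simp: numeral_2_eq_2 simp del: of_nat_Suc\<close>)
  from DERIV_mult[OF has_real_derivative_powr[OF assms] this, of \<theta>]
  have "(cutpow \<theta> n has_real_derivative
      \<theta> * s powr (\<theta> - 1) * flat 0 (?c * s - 1) + flat 2 (?c * s - 1) * ?c * s powr \<theta>) (at s)"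
    by (simp add: cutpow_def[abs_def] del: of_nat_Suc)
  moreover have "s powr \<theta> = s powr (\<theta> - 1) * s"
    using assms powr_add[of s "\<theta> - 1" 1] by simp
  then have "\<theta> * s powr (\<theta> - 1) * flat 0 (?c * s - 1) + flat 2 (?c * s - 1) * ?c * s powr \<theta> = cutpow' \<theta> n s"
    by (simp add: cutpow'_def distrib_left mult.commute mult.left_commute del: of_nat_Suc)
  ultimately show ?thesis by simp
qed

text \<open>With \<open>t = real (Suc n) * s - 1\<close> this is the term of \<open>cutpow'\<close>
  that comes from differentiating the cutoff; the bound does not depend on \<open>n\<close>.\<close>

lemma flat2_weighted:
  assumes "t > -1"
  shows "0 \<le> (t + 1) * flat 2 t" "(t + 1) * flat 2 t \<le> 2"
proof -
  show "0 \<le> (t + 1) * flat 2 t" using assms by (simp add: flat_def)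
  show "(t + 1) * flat 2 t \<le> 2"
  proof (cases "t > 0")
    case True
    define z where "z = 1 / t"
    have z: "z > 0" "t = 1 / z" using True by (auto simp: z_def)
    have "z + z\<^sup>2 \<le> 2 * exp z"
      using exp_lower_Taylor_quadratic[of z] z by simp
    then have "(z + z\<^sup>2) * exp (- z) \<le> 2"
      by (simp add: exp_minus field_simps)
    moreover have "(t + 1) / t\<^sup>2 = z + z\<^sup>2"
      using True by (simp add: z_def field_simps power2_eq_square)
    moreover have "(t + 1) * flat 2 t = (t + 1) / t\<^sup>2 * exp (- z)"
      using True by (simp add: flat_def z_def)
    ultimately show ?thesis by (simp only:)
  qed (simp add: flat_def)
qed

lemma cutpow_bounds:
  assumes "s > 0" "0 < \<theta>" "\<theta> < 1"
  shows "0 \<le> cutpow \<theta> n s" "cutpow \<theta> n s \<le> s powr \<theta>" "\<bar>cutpow' \<theta> n s\<bar> \<le> 3 * s powr (\<theta> - 1)"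
proof -
  let ?t = "real (Suc n) * s - 1"
  show "0 \<le> cutpow \<theta> n s" "cutpow \<theta> n s \<le> s powr \<theta>"
    using flat0_bounds(1,2)[of ?t] by (simp_all add: cutpow_def mult_left_le del: of_nat_Suc)
  have t: "?t > - 1" using assms by simp
  have "\<theta> * flat 0 ?t \<le> 1 * 1"
    using assms flat0_bounds(1,2)[of ?t] by (intro mult_mono) auto
  moreover have "0 \<le> \<theta> * flat 0 ?t" using assms flat0_bounds(1)[of ?t] by simp
  ultimately have "\<bar>\<theta> * flat 0 ?t + (?t + 1) * flat 2 ?t\<bar> \<le> 3"
    using flat2_weighted[OF t] by linarith
  then have "s powr (\<theta> - 1) * \<bar>\<theta> * flat 0 ?t + (?t + 1) * flat 2 ?t\<bar> \<le> s powr (\<theta> - 1) * 3"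
    by (intro mult_left_mono) auto
  then show "\<bar>cutpow' \<theta> n s\<bar> \<le> 3 * s powr (\<theta> - 1)"
    by (simp add: cutpow'_def abs_mult mult.commute del: of_nat_Suc)
qed

lemma cutpow_tendsto:
  assumes "s > 0"
  shows "(\<lambda>n. cutpow \<theta> n s) \<longlonglongrightarrow> s powr \<theta>" "(\<lambda>n. cutpow' \<theta> n s) \<longlonglongrightarrow> \<theta> * s powr (\<theta> - 1)"
proof -
  have f0: "(\<lambda>n. flat 0 (real (Suc n) * s - 1)) \<longlonglongrightarrow> 1"
    using LIMSEQ_Suc[OF flat0_scaled_tendsto[OF assms, of 1]] by simp
  from tendsto_mult_left[OF this, of "s powr \<theta>"] show "(\<lambda>n. cutpow \<theta> n s) \<longlonglongrightarrow> s powr \<theta>"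
    by (simp add: cutpow_def)
  have "filterlim (\<lambda>n. real (Suc n) * s - 1) at_top sequentially"
    using assms by real_asymp
  moreover have "((\<lambda>t. (t + 1) * flat 2 t) \<longlongrightarrow> 0) at_top"
  proof (rule Lim_transform_eventually)
    show "((\<lambda>t::real. (t + 1) * (exp (- 1 / t) / t ^ 2)) \<longlongrightarrow> 0) at_top" by real_asymp
    show "\<forall>\<^sub>F t in at_top. (t + 1) * (exp (- 1 / t) / t ^ 2) = (t + 1) * flat 2 t"
      using eventually_gt_at_top[of "0::real"] by eventually_elim (simp add: flat_def)
  qed
  ultimately have "(\<lambda>n. (real (Suc n) * s - 1 + 1) * flat 2 (real (Suc n) * s - 1)) \<longlonglongrightarrow> 0"
    by (rule filterlim_compose[rotated])
  then have "(\<lambda>n. real (Suc n) * s * flat 2 (real (Suc n) * s - 1)) \<longlonglongrightarrow> 0" by simp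
  from tendsto_mult_left[OF tendsto_add[OF tendsto_mult_left[OF f0, of \<theta>] this], of "s powr (\<theta> - 1)"]
  show "(\<lambda>n. cutpow' \<theta> n s) \<longlonglongrightarrow> \<theta> * s powr (\<theta> - 1)"
    by (simp add: cutpow'_def mult.commute del: of_nat_Suc)
qed

section \<open>The boundary power as a limit of test functions\<close>

context orlicz_domain
begin

lemma modular_const_finite: "modular (\<lambda>x. c :: real) < \<infinity>"
  by (simp add: modular_def ennreal_mult_eq_top_iff less_top[symmetric])

lemma W0_zero: "W0 (\<lambda>x. 0) (\<lambda>x. 0)"
proof -
  have "grad (\<lambda>x::real^'n. 0 :: real) = (\<lambda>x. 0)"
    by (rule ext, rule grad_unique) simp
  then show ?thesis using W0_test[OF test_function_zero] by simp
qed

lemma W0_sum: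
  assumes "finite D" "\<And>i. i \<in> D \<Longrightarrow> W0 (w i) (h i)"
  shows "W0 (\<lambda>x. \<Sum>i\<in>D. w i x) (\<lambda>x. \<Sum>i\<in>D. h i x)"
  using assms by (induction D rule: finite_induct) (auto intro: W0_zero W0_add)

lemma sets_M: "S \<in> sets lebesgue \<Longrightarrow> S \<subseteq> \<Omega> \<Longrightarrow> S \<in> sets M"
  by (auto simp: sets_restrict_space)

text \<open>Near the boundary, \<open>s\<close> is comparable to the distance to the boundary, and
  \<open>s powr \<theta>\<close>, cut off by \<open>\<zeta>\<close>, is the local model of the function of finite energy.\<close>

lemma boundary_power_W0:
  assumes U: "open U" "\<And>k. Ck_on k U s" "\<And>x. x \<in> U \<Longrightarrow> x \<in> \<Omega> \<longleftrightarrow> s x > (0::real)"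
    and K: "cbox c d \<subseteq> U"
    and v: "\<And>x. x \<in> cbox c d \<Longrightarrow> frechet_derivative s (at x) v > 1 / 2"
    and \<theta>: "0 < \<theta>" "\<theta> < 1" "(1 - \<theta>) * p < 1"
  obtains g where
    "W0 (\<lambda>x. bump 1 c d x * (indicat_real (cbox c d) x * s x) powr \<theta>) g"
    "(\<lambda>x. indicat_real (cbox c d) x * s x) \<in> borel_measurable M"
    "\<And>\<alpha>. 0 < \<alpha> \<Longrightarrow> \<alpha> < 1 \<Longrightarrow> (\<integral>\<^sup>+x. ennreal ((indicat_real (cbox c d) x * s x) powr (- \<alpha>)) *
        indicator {x. 0 < indicat_real (cbox c d) x * s x} x \<partial>M) < \<infinity>"
proof -
  let ?K = "cbox c d"
  define \<zeta> where "\<zeta> = bump 1 c d"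
  \<comment> \<open>\<open>s\<close> is controlled only on \<open>U\<close>; the indicator makes it
    measurable on the whole domain.\<close>
  define sK where "sK = (\<lambda>x. indicat_real ?K x * s x)"
  have sd: "(s has_derivative frechet_derivative s (at x)) (at x)" if "x \<in> U" for x
    by (rule Ck_on_has_derivative[OF U(1,2) that])
  have sc: "continuous_on ?K s" using U(2)[of 0] K by (auto intro: continuous_on_subset)
  have gc: "continuous_on ?K (grad s)"
  proof (rule continuous_on_subset[OF _ K])
    show "continuous_on U (grad s)"
      unfolding grad_def using U(2)[of "Suc 0"] by (intro continuous_on_vec_lambda) simp
  qed
  have sKb: "sK \<in> borel_measurable borel"
    unfolding sK_def using borel_measurable_continuous_on_indicator[OF _ sc] by simp
  then have sKm [measurable]: "sK \<in> borel_measurable M" by (rule measurable_M)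
  define sg where "sg = (\<lambda>x. indicat_real ?K x *\<^sub>R grad s x)"
  have [measurable]: "sg \<in> borel_measurable M"
    unfolding sg_def by (rule measurable_M[OF borel_measurable_continuous_on_indicator[OF _ gc]]) simp
  have "\<zeta> \<in> test_functions ?K" unfolding \<zeta>_def by (rule test_function_bump) simp
  then obtain L where L: "C1_compact L \<zeta>" "L \<subseteq> ?K" by (rule test_function_C1)
  have \<zeta>0: "\<zeta> x = 0" "grad \<zeta> x = 0" if "x \<notin> ?K" for x
    using that L C1_compact_grad_outside[OF L(1), of x] by (auto simp: C1_compact_def)
  have \<zeta>d: "(\<zeta> has_derivative (\<lambda>v. grad \<zeta> x \<bullet> v)) (at x)" for x
    using L(1) by (simp add: C1_compact_def)
  have [measurable]: "\<zeta> \<in> borel_measurable M" "grad \<zeta> \<in> borel_measurable M"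
    using C1_compact_borel[OF L(1)] measurable_M by blast+
  have \<zeta>b: "0 \<le> \<zeta> x" "\<zeta> x \<le> 1" for x unfolding \<zeta>_def by (rule bump_bounds)+
  have spos: "0 < s x" if "x \<in> ?K" "x \<in> \<Omega>" for x using that U(3) K by blast
  obtain S where S: "\<And>x. x \<in> ?K \<Longrightarrow> \<bar>s x\<bar> \<le> S"
    using compact_imp_bounded[OF compact_continuous_image[OF sc compact_cbox]] by (auto simp: bounded_iff)
  obtain Bs where Bs: "\<And>x. x \<in> ?K \<Longrightarrow> norm (grad s x) \<le> Bs"
    using compact_imp_bounded[OF compact_continuous_image[OF gc compact_cbox]] by (auto simp: bounded_iff)
  have "\<exists>B>0. \<forall>x. norm (grad \<zeta> x) \<le> B"
    by (rule continuous_compact_support_bounded[of "grad \<zeta>" L])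
      (use L C1_compact_grad_outside[OF L(1)] in \<open>auto simp: C1_compact_def\<close>)
  then obtain Bx where Bx: "Bx > 0" "\<And>x. norm (grad \<zeta> x) \<le> Bx" by auto
  \<comment> \<open>These are test functions, because \<open>cutpow\<close> vanishes near the
    boundary and \<open>\<zeta>\<close> outside the box.\<close>
  define f where "f = (\<lambda>n x. \<zeta> x * cutpow \<theta> n (s x))"
  have ft: "f n \<in> test_functions \<Omega>" for n
  proof (rule test_functionI)
    let ?c = "1 / real (Suc n)"
    show "compact (?K \<inter> s -` {?c..})"
    proof -
      have "closed (?K \<inter> s -` {?c..})"
        by (rule continuous_closed_preimage[OF sc]) auto
      then show ?thesis by (auto simp: compact_eq_bounded_closed intro: bounded_subset[OF bounded_cbox])
    qed
    show "?K \<inter> s -` {?c..} \<subseteq> \<Omega>"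
    proof
      fix x assume x: "x \<in> ?K \<inter> s -` {?c..}"
      have "0 < ?c" by simp
      also have "?c \<le> s x" using x by simp
      finally show "x \<in> \<Omega>" using x U(3) K by auto
    qed
    show "f n x = 0" if "x \<notin> ?K \<inter> s -` {?c..}" for x
    proof (cases "x \<in> ?K")
      case True
      then have "s x \<le> ?c" using that by (simp del: of_nat_Suc)
      then show ?thesis by (simp add: f_def cutpow_eq_0)
    qed (simp add: f_def \<zeta>0)
    fix k
    have "Ck_on k U (f n)"
      unfolding f_def
    proof (rule Ck_on_mult[OF U(1)])
      show "Ck_on k U \<zeta>" unfolding \<zeta>_def by (rule Ck_on_subset[OF Ck_on_bump]) simp
      show "Ck_on k U (\<lambda>x. cutpow \<theta> n (s x))"
        by (rule Ck_on_compose[where h = "cutpow \<theta> n" and f = s and T = UNIV])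
          (use U Ck_on_cutpow in auto)
    qed
    moreover have "Ck_on k (- ?K) (f n)"
      by (subst Ck_on_cong[where g = "\<lambda>_. 0"])
        (auto intro!: Ck_on_const simp: f_def \<zeta>0 open_Compl closed_cbox)
    ultimately have "Ck_on k (U \<union> - ?K) (f n)"
      using U(1) by (intro Ck_on_Un) (auto simp: open_Compl closed_cbox)
    moreover have "U \<union> - ?K = UNIV" using K by blast
    ultimately show "Ck_on k UNIV (f n)" by simp
  qed
  have fg: "grad (f n) x = cutpow \<theta> n (s x) *\<^sub>R grad \<zeta> x + (\<zeta> x * cutpow' \<theta> n (s x)) *\<^sub>R grad s x"
    if x: "x \<in> ?K" "x \<in> \<Omega>" for n x
  proof (rule grad_unique)
    have D: "(s has_derivative (\<lambda>v. grad s x \<bullet> v)) (at x)"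
      using sd[of x] grad_has_derivative[OF sd[of x]] x(1) K by auto
    have "((\<lambda>x. cutpow \<theta> n (s x)) has_derivative (\<lambda>v. cutpow' \<theta> n (s x) * (grad s x \<bullet> v))) (at x)"
      by (rule has_derivative_compose_real[where h = "cutpow \<theta> n" and f = s, OF cutpow_has_derivative[OF spos[OF x]] D])
    from has_derivative_mult[OF \<zeta>d this]
    show "(f n has_derivative (\<lambda>v. (cutpow \<theta> n (s x) *\<^sub>R grad \<zeta> x + (\<zeta> x * cutpow' \<theta> n (s x)) *\<^sub>R grad s x) \<bullet> v)) (at x)"
      by (simp add: f_def inner_add_left mult.commute mult.left_commute add.commute)
  qed
  have fg0: "grad (f n) x = 0" if "x \<notin> ?K" for n x
  proof (rule grad_unique)
    have "(f n has_derivative (\<lambda>v. 0)) (at x)"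
      by (rule has_derivative_transform_within_open[of "\<lambda>_. 0" _ _ _ "- ?K"])
        (use that in \<open>auto simp: f_def \<zeta>0 open_Compl closed_cbox\<close>)
    then show "(f n has_derivative (\<lambda>v. 0 \<bullet> v)) (at x)" by simp
  qed
  define w where "w = (\<lambda>x. \<zeta> x * sK x powr \<theta>)"
  define g where "g = (\<lambda>x. sK x powr \<theta> *\<^sub>R grad \<zeta> x + (\<zeta> x * (\<theta> * sK x powr (\<theta> - 1))) *\<^sub>R sg x)"
  have [measurable]: "w \<in> borel_measurable M" "g \<in> borel_measurable M"
    unfolding w_def g_def by measurable
  have fm: "f n \<in> borel_measurable M" "grad (f n) \<in> borel_measurable M" for n
    using test_measurable[OF ft] by auto
  note [measurable] = fm
  have flim: "(\<lambda>n. f n x) \<longlonglongrightarrow> w x" "(\<lambda>n. grad (f n) x) \<longlonglongrightarrow> g x" if x: "x \<in> \<Omega>" for x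
  proof -
    show "(\<lambda>n. f n x) \<longlonglongrightarrow> w x"
    proof (cases "x \<in> ?K")
      case True
      from tendsto_mult_left[OF cutpow_tendsto(1)[OF spos[OF True x]], of "\<zeta> x" \<theta>]
      show ?thesis using True by (simp add: f_def w_def sK_def)
    qed (simp add: f_def w_def \<zeta>0)
    show "(\<lambda>n. grad (f n) x) \<longlonglongrightarrow> g x"
    proof (cases "x \<in> ?K")
      case True
      have "(\<lambda>n. cutpow \<theta> n (s x) *\<^sub>R grad \<zeta> x + (\<zeta> x * cutpow' \<theta> n (s x)) *\<^sub>R grad s x) \<longlonglongrightarrow>
          s x powr \<theta> *\<^sub>R grad \<zeta> x + (\<zeta> x * (\<theta> * s x powr (\<theta> - 1))) *\<^sub>R grad s x"
        using cutpow_tendsto[OF spos[OF True x]] by (intro tendsto_intros)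
      then show ?thesis using True by (simp add: fg[OF True x] g_def sK_def sg_def)
    qed (simp add: fg0 g_def \<zeta>0)
  qed
  have "\<exists>C\<ge>0. \<forall>r>0. {x \<in> ?K. 0 < s x \<and> s x \<le> r} \<in> lmeasurable \<and>
    measure lebesgue {x \<in> ?K. 0 < s x \<and> s x \<le> r} \<le> C * r"
    by (rule strip_measure[OF U(1) sd K v]) blast+
  then obtain C where C: "C \<ge> 0" "\<And>r. r > 0 \<Longrightarrow> {x \<in> ?K. 0 < s x \<and> s x \<le> r} \<in> lmeasurable \<and>
    measure lebesgue {x \<in> ?K. 0 < s x \<and> s x \<le> r} \<le> C * r"
    by blast
  have powint: "(\<integral>\<^sup>+x. ennreal (sK x powr (- \<alpha>)) * indicator {x. 0 < sK x} x \<partial>M) < \<infinity>"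
    if \<alpha>: "0 < \<alpha>" "\<alpha> < 1" for \<alpha>
  proof (rule negative_power_integrable[OF sKm \<alpha> C(1)])
    fix r :: real assume r: "r > 0"
    let ?T = "{x \<in> ?K. 0 < s x \<and> s x \<le> r}"
    have T: "?T \<in> lmeasurable" "measure lebesgue ?T \<le> C * r" using C(2)[OF r] by auto
    have sub: "{x \<in> space M. 0 < sK x \<and> sK x \<le> r} \<subseteq> ?T"
      by (auto simp: sK_def indicator_def split: if_splits)
    have "emeasure M {x \<in> space M. 0 < sK x \<and> sK x \<le> r} = emeasure lebesgue {x \<in> space M. 0 < sK x \<and> sK x \<le> r}"
      by (rule emeasure_restrict_space) auto
    also have "\<dots> \<le> emeasure lebesgue ?T"
      by (rule emeasure_mono[OF sub fmeasurableD[OF T(1)]])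
    also have "\<dots> = ennreal (measure lebesgue ?T)" using T(1) by (simp add: emeasure_eq_measure2)
    also have "\<dots> \<le> ennreal (C * r)" by (rule ennreal_leI[OF T(2)])
    finally show "emeasure M {x \<in> space M. 0 < sK x \<and> sK x \<le> r} \<le> ennreal (C * r)" .
  qed (simp add: less_top[symmetric] emeasure_finite)
  \<comment> \<open>Bound for the gradients, uniform in \<open>n\<close>: since
    \<open>s x powr \<theta> \<le> S * s x powr (\<theta> - 1)\<close>, the term with
    \<open>grad \<zeta>\<close> is no worse than the singular one; the 3 is that of
    \<open>cutpow_bounds\<close>.\<close>
  define Cb where "Cb = S * Bx + 3 * Bs"
  define D where "D = (\<lambda>x. indicat_real ?K x * (Cb * sK x powr (\<theta> - 1)))"
  have [measurable]: "D \<in> borel_measurable M"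
  proof -
    have "indicat_real ?K \<in> borel_measurable M" by (rule measurable_M) simp
    then show ?thesis unfolding D_def by measurable
  qed
  have Dbound: "norm (grad (f n) x) \<le> D x" if x: "x \<in> \<Omega>" for n x
  proof (cases "x \<in> ?K")
    case True
    note sp = spos[OF True x]
    note cb = cutpow_bounds[OF sp \<theta>(1,2), of n]
    have "s x powr \<theta> = s x * s x powr (\<theta> - 1)" using sp powr_add[of "s x" 1 "\<theta> - 1"] by simp
    also have "\<dots> \<le> S * s x powr (\<theta> - 1)" using S[OF True] by (intro mult_right_mono) auto
    finally have sS: "s x powr \<theta> \<le> S * s x powr (\<theta> - 1)" .
    have "norm (grad (f n) x) \<le> norm (cutpow \<theta> n (s x) *\<^sub>R grad \<zeta> x) + norm ((\<zeta> x * cutpow' \<theta> n (s x)) *\<^sub>R grad s x)"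
      unfolding fg[OF True x] by (rule norm_triangle_ineq)
    also have "norm (cutpow \<theta> n (s x) *\<^sub>R grad \<zeta> x) \<le> (S * s x powr (\<theta> - 1)) * Bx"
      using cb(1,2) sS Bx(2)[of x] by (simp, intro mult_mono) auto
    also have "norm ((\<zeta> x * cutpow' \<theta> n (s x)) *\<^sub>R grad s x) \<le> (1 * (3 * s x powr (\<theta> - 1))) * Bs"
      unfolding norm_scaleR real_norm_def abs_mult
      using cb(3) \<zeta>b[of x] Bs[OF True] by (intro mult_mono) auto
    also have "(S * s x powr (\<theta> - 1)) * Bx + (1 * (3 * s x powr (\<theta> - 1))) * Bs = Cb * s x powr (\<theta> - 1)"
      by (simp add: Cb_def algebra_simps)
    finally show ?thesis using True by (simp add: D_def sK_def)
  qed (simp add: fg0 D_def)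
  have D_fin: "modular D < \<infinity>"
  proof -
    \<comment> \<open>The growth bound of \<open>\<Phi>\<close> turns a gradient of size
      \<open>sK x powr (\<theta> - 1)\<close> into a modular density of size
      \<open>sK x powr (- \<alpha>)\<close>, up to bounded terms; it is integrable since
      \<open>\<alpha> < 1\<close>.\<close>
    define \<alpha> where "\<alpha> = (1 - \<theta>) * p"
    have \<alpha>: "0 < \<alpha>" "\<alpha> < 1" using \<theta> p_gt_1 by (auto simp: \<alpha>_def)
    have "modular D \<le> (\<integral>\<^sup>+x. ennreal (\<Phi> Cb) * (1 + ennreal (sK x powr (- \<alpha>)) * indicator {x. 0 < sK x} x) \<partial>M)"
      unfolding modular_real
    proof (rule nn_integral_mono)
      fix x assume "x \<in> space M"
      then have x: "x \<in> \<Omega>" by simp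
      show "ennreal (\<Phi> (D x)) \<le> ennreal (\<Phi> Cb) * (1 + ennreal (sK x powr (- \<alpha>)) * indicator {x. 0 < sK x} x)"
      proof (cases "x \<in> ?K")
        case True
        have sp: "0 < sK x" using spos[OF True x] True by (simp add: sK_def)
        have "\<Phi> (D x) = \<Phi> (sK x powr (\<theta> - 1) * Cb)" using True by (simp add: D_def mult.commute)
        also have "\<dots> \<le> max 1 ((sK x powr (\<theta> - 1)) powr p) * \<Phi> Cb" by (rule Phi_scale) simp
        also have "(sK x powr (\<theta> - 1)) powr p = sK x powr (- \<alpha>)"
          by (simp add: powr_powr \<alpha>_def algebra_simps)
        also have "max 1 (sK x powr (- \<alpha>)) * \<Phi> Cb \<le> (1 + sK x powr (- \<alpha>)) * \<Phi> Cb"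
          by (intro mult_right_mono Phi_nonneg) auto
        finally have "ennreal (\<Phi> (D x)) \<le> ennreal ((1 + sK x powr (- \<alpha>)) * \<Phi> Cb)" by (rule ennreal_leI)
        also have "\<dots> = ennreal (\<Phi> Cb) * (1 + ennreal (sK x powr (- \<alpha>)))"
          by (simp add: ennreal_mult Phi_nonneg mult.commute)
        finally show ?thesis using sp by simp
      qed (simp add: D_def)
    qed
    also have "\<dots> = ennreal (\<Phi> Cb) * (emeasure M (space M) + (\<integral>\<^sup>+x. ennreal (sK x powr (- \<alpha>)) * indicator {x. 0 < sK x} x \<partial>M))"
      by (simp add: nn_integral_cmult nn_integral_add)
    also have "\<dots> < \<infinity>"
      using powint[OF \<alpha>] emeasure_finite[of "space M"] by (simp add: ennreal_mult_eq_top_iff less_top[symmetric])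
    finally show ?thesis .
  qed
  have D2_fin: "modular (\<lambda>x. 2 * D x) < \<infinity>"
    using modular_finite_scale[OF _ D_fin, of 2] by simp
  have W: "W0 w g"
  proof (rule W0_limit[where v = f and h = "\<lambda>n. grad (f n)"])
    show "W0 (f n) (grad (f n))" for n by (rule W0_test[OF ft])
    show "(\<lambda>n. modular (\<lambda>x. f n x - w x)) \<longlonglongrightarrow> 0"
    proof (rule modular_dominated)
      show "modular (\<lambda>x. 2 * \<bar>S\<bar> powr \<theta>) < \<infinity>" by (rule modular_const_finite)
      show "AE x in M. (\<lambda>n. f n x - w x) \<longlonglongrightarrow> 0"
        using flim(1) by (intro AE_I2 LIM_zero) simp
      show "AE x in M. norm (f n x - w x) \<le> 2 * \<bar>S\<bar> powr \<theta>" for n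
      proof (rule AE_I2)
        fix x assume "x \<in> space M"
        then have x: "x \<in> \<Omega>" by simp
        show "norm (f n x - w x) \<le> 2 * \<bar>S\<bar> powr \<theta>"
        proof (cases "x \<in> ?K")
          case True
          note cb = cutpow_bounds[OF spos[OF True x] \<theta>(1,2), of n]
          have "s x \<le> \<bar>S\<bar>" using S[OF True] by linarith
          then have sS: "s x powr \<theta> \<le> \<bar>S\<bar> powr \<theta>"
            using spos[OF True x] \<theta> by (intro powr_mono2) auto
          have "\<bar>f n x\<bar> \<le> 1 * \<bar>S\<bar> powr \<theta>"
            unfolding f_def abs_mult using \<zeta>b[of x] cb(1,2) sS by (intro mult_mono) auto
          moreover have "\<bar>w x\<bar> \<le> 1 * \<bar>S\<bar> powr \<theta>"
            unfolding w_def abs_mult using \<zeta>b[of x] sS True by (intro mult_mono) (auto simp: sK_def)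
          ultimately show ?thesis by simp
        qed (simp add: f_def w_def \<zeta>0)
      qed
    qed measurable
    show "(\<lambda>n. modular (\<lambda>x. grad (f n) x - g x)) \<longlonglongrightarrow> 0"
    proof (rule modular_dominated[OF _ _ _ _ D2_fin])
      show "AE x in M. (\<lambda>n. grad (f n) x - g x) \<longlonglongrightarrow> 0"
        using flim(2) by (intro AE_I2 LIM_zero) simp
      show "AE x in M. norm (grad (f n) x - g x) \<le> 2 * D x" for n
      proof (rule AE_I2)
        fix x assume "x \<in> space M"
        then have x: "x \<in> \<Omega>" by simp
        have "norm (g x) \<le> D x"
          by (rule LIMSEQ_le_const2[OF tendsto_norm[OF flim(2)[OF x]]]) (use Dbound[OF x] in auto)
        then show "norm (grad (f n) x - g x) \<le> 2 * D x"
          using Dbound[OF x, of n] norm_triangle_ineq4[of "grad (f n) x" "g x"] by simp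
      qed
    qed measurable
  qed measurable
  show thesis
    using that[of g] W sKm powint by (simp only: w_def sK_def \<zeta>_def)
qed

end

section \<open>Finite singular energy from local pieces\<close>

context singular_problem
begin

lemma G_pos: "s > 0 \<Longrightarrow> G s = ennreal (s powr (1 - \<delta>))"
  by (simp add: G_def)

text \<open>Young's inequality for the exponents \<open>q\<close> and \<open>q / (q - 1)\<close>
  with constants 1: comparing \<open>y\<close> with \<open>x powr (q - 1)\<close> decides which of
  the two powers dominates the product.\<close>

lemma product_le_powers:
  fixes x y q :: real
  assumes "x \<ge> 0" "y \<ge> 0" "q > 1"
  shows "x * y \<le> x powr q + y powr (q / (q - 1))"
proof (cases "x = 0 \<or> y = 0")
  case False
  then have pos: "x > 0" "y > 0" using assms by auto
  show ?thesis
  proof (cases "y \<le> x powr (q - 1)")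
    case True
    have "x * y \<le> x * x powr (q - 1)" using True pos by simp
    also have "\<dots> = x powr q" using pos powr_add[of x 1 "q - 1"] by simp
    finally show ?thesis by (simp add: add_increasing2)
  next
    case False
    then have "(x powr (q - 1)) powr (1 / (q - 1)) \<le> y powr (1 / (q - 1))"
      using assms by (intro powr_mono2) auto
    then have "x \<le> y powr (1 / (q - 1))" using pos assms by (simp add: powr_powr)
    then have "x * y \<le> y powr (1 / (q - 1)) * y powr 1" using pos by (simp add: mult_right_mono)
    also have "\<dots> = y powr (1 / (q - 1) + 1)" by (simp only: powr_add)
    also have "1 / (q - 1) + 1 = q / (q - 1)" using assms by (simp add: field_simps)
    finally show ?thesis by (simp add: add_increasing)
  qed
qed (use assms in auto)

text \<open>Near an interior point a bump suffices, being bounded below on \<open>N\<close>. Near a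
  boundary point the piece is a bump times \<open>sK x powr \<theta>\<close>, whose singular energy
  density on \<open>N\<close> is at most a multiple of
  \<open>\<bar>b x\<bar> * sK x powr (- (\<theta> * (\<delta> - 1)))\<close>.\<close>

lemma local_piece:
  assumes sb: "smooth_boundary \<Omega>" and q: "q > 1" "integrable M (\<lambda>x. \<bar>b x\<bar> powr q)"
    and \<theta>: "0 < \<theta>" "\<theta> < 1" "(1 - \<theta>) * p < 1" "\<theta> * (\<delta> - 1) * (q / (q - 1)) < 1"
    and x0: "x0 \<in> closure \<Omega>"
  shows "\<exists>w g N. open N \<and> x0 \<in> N \<and> W0 w g \<and> (\<forall>x. 0 \<le> w x) \<and>
    (\<integral>\<^sup>+x. ennreal (b x) * G (w x) * indicator N x \<partial>M) < \<infinity>"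
proof -
  have iq: "(\<integral>\<^sup>+x. ennreal (\<bar>b x\<bar> powr q) \<partial>M) < \<infinity>"
    using q(2) by (subst nn_integral_eq_integral) auto
  have nbhd: "open {x. bump 1 c d x > r}" for c d :: "real^'n" and r
    using Ck_on_bump[of 0 1 c d] by (intro open_Collect_less) (auto intro: continuous_intros)
  show ?thesis
  proof (cases "x0 \<in> \<Omega>")
    case True
    obtain c d where cd: "cbox c d \<subseteq> \<Omega>" "x0 \<in> box c d"
      using open_dom True by (rule open_contains_cbox) blast
    \<comment> \<open>Half the value at \<open>x0\<close>, so that the bump exceeds a positive
      constant on a whole neighbourhood.\<close>
    define r where "r = bump 1 c d x0 / 2"
    have r: "r > 0" using bump_pos[of 1 x0 c d] cd by (simp add: r_def)
    have "(\<integral>\<^sup>+x. ennreal (b x) * G (bump 1 c d x) * indicator {x. bump 1 c d x > r} x \<partial>M)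
        \<le> (\<integral>\<^sup>+x. ennreal (r powr (1 - \<delta>)) * (1 + ennreal (\<bar>b x\<bar> powr q)) \<partial>M)"
    proof (rule nn_integral_mono)
      fix x
      show "ennreal (b x) * G (bump 1 c d x) * indicator {x. bump 1 c d x > r} x
        \<le> ennreal (r powr (1 - \<delta>)) * (1 + ennreal (\<bar>b x\<bar> powr q))"
      proof (cases "bump 1 c d x > r")
        case True
        have "G (bump 1 c d x) \<le> ennreal (r powr (1 - \<delta>))"
          using G_antimono[of r "bump 1 c d x"] True r by (simp add: G_pos)
        moreover have "b x \<le> 1 + \<bar>b x\<bar> powr q"
        proof (cases "\<bar>b x\<bar> \<le> 1")
          case False
          then have "\<bar>b x\<bar> powr 1 \<le> \<bar>b x\<bar> powr q" using q by (intro powr_mono) auto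
          then show ?thesis using False by simp
        qed (simp add: add_increasing2)
        then have "ennreal (b x) \<le> 1 + ennreal (\<bar>b x\<bar> powr q)"
          by (metis ennreal_1 ennreal_leI ennreal_plus powr_ge_zero zero_le_one)
        ultimately have "ennreal (b x) * G (bump 1 c d x) \<le> (1 + ennreal (\<bar>b x\<bar> powr q)) * ennreal (r powr (1 - \<delta>))"
          by (intro mult_mono) auto
        then show ?thesis using True by (simp add: mult.commute)
      qed simp
    qed
    also have "\<dots> = ennreal (r powr (1 - \<delta>)) * (emeasure M (space M) + (\<integral>\<^sup>+x. ennreal (\<bar>b x\<bar> powr q) \<partial>M))"
      by (simp add: nn_integral_cmult nn_integral_add)
    also have "\<dots> < \<infinity>"
      using iq emeasure_finite[of "space M"] by (simp add: ennreal_mult_eq_top_iff less_top[symmetric])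
    finally show ?thesis
      using nbhd[of r c d] r W0_test[OF test_function_bump[OF cd(1)]] bump_bounds
      by (intro exI[of _ "bump 1 c d"] exI[of _ "grad (bump 1 c d)"] exI[of _ "{x. bump 1 c d x > r}"])
        (auto simp: r_def)
  next
    case False
    then have "x0 \<in> frontier \<Omega>"
      using x0 open_dom by (simp add: frontier_def interior_open)
    with sb obtain U s v where U: "open U" "x0 \<in> U" "\<And>k. Ck_on k U s"
      "\<And>x. x \<in> U \<Longrightarrow> frechet_derivative s (at x) v > 1 / 2"
      "\<And>x. x \<in> U \<Longrightarrow> x \<in> \<Omega> \<longleftrightarrow> s x > (0::real)"
      by (rule boundary_chart) blast
    obtain c d where cd: "cbox c d \<subseteq> U" "x0 \<in> box c d"
      using U(1,2) by (rule open_contains_cbox) blast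
    define sK where "sK = (\<lambda>x. indicat_real (cbox c d) x * s x)"
    obtain g where g: "W0 (\<lambda>x. bump 1 c d x * sK x powr \<theta>) g" and sKm [measurable]: "sK \<in> borel_measurable M"
      and pw: "\<And>\<alpha>. 0 < \<alpha> \<Longrightarrow> \<alpha> < 1 \<Longrightarrow> (\<integral>\<^sup>+x. ennreal (sK x powr (- \<alpha>)) * indicator {x. 0 < sK x} x \<partial>M) < \<infinity>"
      unfolding sK_def
      by (rule boundary_power_W0[OF U(1,3,5) cd(1) _ \<theta>(1,2,3), of v]) (use U(4) cd(1) in blast)+
    define w where "w = (\<lambda>x. bump 1 c d x * sK x powr \<theta>)"
    define r where "r = bump 1 c d x0 / 2"
    have r: "r > 0" using bump_pos[of 1 x0 c d] cd by (simp add: r_def)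
    \<comment> \<open>The exponent left on \<open>sK\<close> once \<open>product_le_powers\<close>
      has split off \<open>\<bar>b x\<bar> powr q\<close>.\<close>
    define \<alpha> where "\<alpha> = \<theta> * (\<delta> - 1) * (q / (q - 1))"
    have \<alpha>: "0 < \<alpha>" "\<alpha> < 1" using \<theta> q delta_gt_1 by (auto simp: \<alpha>_def)
    let ?N = "{x. bump 1 c d x > r}"
    have "(\<integral>\<^sup>+x. ennreal (b x) * G (w x) * indicator ?N x \<partial>M)
        \<le> (\<integral>\<^sup>+x. ennreal (r powr (1 - \<delta>)) *
            (ennreal (\<bar>b x\<bar> powr q) + ennreal (sK x powr (- \<alpha>)) * indicator {x. 0 < sK x} x) \<partial>M)"
    proof (rule nn_integral_mono)
      fix x assume "x \<in> space M"
      then have x: "x \<in> \<Omega>" by simp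
      show "ennreal (b x) * G (w x) * indicator ?N x \<le> ennreal (r powr (1 - \<delta>)) *
            (ennreal (\<bar>b x\<bar> powr q) + ennreal (sK x powr (- \<alpha>)) * indicator {x. 0 < sK x} x)"
      proof (cases "x \<in> ?N")
        case True
        then have "x \<in> box c d" using bump_eq_0[of x c d 1] r by auto
        then have xK: "x \<in> cbox c d" using box_subset_cbox by blast
        then have sp: "0 < sK x" using U(5) cd(1) x by (auto simp: sK_def)
        define y where "y = sK x powr (- (\<theta> * (\<delta> - 1)))"
        have "r * sK x powr \<theta> \<le> w x" unfolding w_def using True by (intro mult_right_mono) auto
        then have "G (w x) \<le> G (r * sK x powr \<theta>)" by (rule G_antimono)
        also have "\<dots> = ennreal (r powr (1 - \<delta>) * y)"
          using r sp by (simp add: G_pos powr_mult powr_powr y_def algebra_simps)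
        finally have "ennreal (b x) * G (w x) \<le> ennreal \<bar>b x\<bar> * ennreal (r powr (1 - \<delta>) * y)"
          by (intro mult_mono ennreal_leI) auto
        also have "\<dots> = ennreal (r powr (1 - \<delta>) * (\<bar>b x\<bar> * y))"
          by (simp add: ennreal_mult[symmetric] y_def mult.left_commute)
        also have "\<dots> \<le> ennreal (r powr (1 - \<delta>) * (\<bar>b x\<bar> powr q + y powr (q / (q - 1))))"
          by (intro ennreal_leI mult_left_mono product_le_powers q) (auto simp: y_def)
        also have "y powr (q / (q - 1)) = sK x powr (- \<alpha>)"
          by (simp add: y_def powr_powr \<alpha>_def)
        also have "ennreal (r powr (1 - \<delta>) * (\<bar>b x\<bar> powr q + sK x powr (- \<alpha>)))
            = ennreal (r powr (1 - \<delta>)) * (ennreal (\<bar>b x\<bar> powr q) + ennreal (sK x powr (- \<alpha>)))"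
          by (simp add: ennreal_mult)
        finally show ?thesis using True sp by simp
      qed simp
    qed
    also have "\<dots> = ennreal (r powr (1 - \<delta>)) * ((\<integral>\<^sup>+x. ennreal (\<bar>b x\<bar> powr q) \<partial>M) +
        (\<integral>\<^sup>+x. ennreal (sK x powr (- \<alpha>)) * indicator {x. 0 < sK x} x \<partial>M))"
      by (simp add: nn_integral_cmult nn_integral_add)
    also have "\<dots> < \<infinity>"
      using iq pw[OF \<alpha>] by (simp add: ennreal_mult_less_top)
    finally have fin: "(\<integral>\<^sup>+x. ennreal (b x) * G (w x) * indicator ?N x \<partial>M) < \<infinity>" .
    show ?thesis
    proof (intro exI conjI)
      show "open ?N" by (rule nbhd)
      show "x0 \<in> ?N" using r by (simp add: r_def)
      show "W0 w g" using g by (simp only: w_def)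
      show "\<forall>x. 0 \<le> w x"
        unfolding w_def by (intro allI mult_nonneg_nonneg bump_bounds(1) powr_ge_zero)
    qed (rule fin)
  qed
qed

text \<open>Finitely many neighbourhoods cover the compact closure. The pieces are nonnegative and
  \<open>G\<close> is nonincreasing, so on each neighbourhood the sum has no larger energy density
  than the piece belonging to it.\<close>

lemma finite_energy:
  assumes "smooth_boundary \<Omega>" "q > 1" "integrable M (\<lambda>x. \<bar>b x\<bar> powr q)"
    "0 < \<theta>" "\<theta> < 1" "(1 - \<theta>) * p < 1" "\<theta> * (\<delta> - 1) * (q / (q - 1)) < 1"
  shows "\<exists>u g. W0 u g \<and> E u < \<infinity>"
proof -
  have "\<forall>x0\<in>closure \<Omega>. \<exists>z. open (snd (snd z)) \<and> x0 \<in> snd (snd z) \<and> W0 (fst z) (fst (snd z)) \<and>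
      (\<forall>x. 0 \<le> fst z x) \<and> (\<integral>\<^sup>+x. ennreal (b x) * G (fst z x) * indicator (snd (snd z)) x \<partial>M) < \<infinity>"
  proof
    fix x0 assume "x0 \<in> closure \<Omega>"
    from local_piece[OF assms this] obtain w g N where "open N" "x0 \<in> N" "W0 w g" "\<forall>x. 0 \<le> w x"
      "(\<integral>\<^sup>+x. ennreal (b x) * G (w x) * indicator N x \<partial>M) < \<infinity>"
      by blast
    then show "\<exists>z. open (snd (snd z)) \<and> x0 \<in> snd (snd z) \<and> W0 (fst z) (fst (snd z)) \<and>
      (\<forall>x. 0 \<le> fst z x) \<and> (\<integral>\<^sup>+x. ennreal (b x) * G (fst z x) * indicator (snd (snd z)) x \<partial>M) < \<infinity>"
      by (intro exI[of _ "(w, g, N)"]) simp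
  qed
  from bchoice[OF this] obtain z where z: "\<And>x0. x0 \<in> closure \<Omega> \<Longrightarrow> open (snd (snd (z x0))) \<and>
      x0 \<in> snd (snd (z x0)) \<and> W0 (fst (z x0)) (fst (snd (z x0))) \<and> (\<forall>x. 0 \<le> fst (z x0) x) \<and>
      (\<integral>\<^sup>+x. ennreal (b x) * G (fst (z x0) x) * indicator (snd (snd (z x0))) x \<partial>M) < \<infinity>"
    by blast
  define w where "w = (\<lambda>i. fst (z i))"
  define h where "h = (\<lambda>i. fst (snd (z i)))"
  define N where "N = (\<lambda>i. snd (snd (z i)))"
  have w: "open (N i)" "i \<in> N i" "W0 (w i) (h i)" "0 \<le> w i x"
    "(\<integral>\<^sup>+x. ennreal (b x) * G (w i x) * indicator (N i) x \<partial>M) < \<infinity>" if "i \<in> closure \<Omega>" for i x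
    using z[OF that] by (simp_all add: w_def h_def N_def)
  have "compact (closure \<Omega>)" using bounded_dom by simp
  then obtain D where D: "D \<subseteq> closure \<Omega>" "finite D" "closure \<Omega> \<subseteq> (\<Union>i\<in>D. N i)"
    by (rule compactE_image[of _ "closure \<Omega>" N]) (use w(1,2) in auto)
  define u where "u = (\<lambda>x. \<Sum>i\<in>D. w i x)"
  have W: "W0 u (\<lambda>x. \<Sum>i\<in>D. h i x)"
    unfolding u_def using D w(3) by (intro W0_sum) auto
  have Nm: "(\<lambda>x. indicator (N i) x :: ennreal) \<in> borel_measurable M" if "i \<in> D" for i
  proof -
    have "N i \<inter> \<Omega> \<in> sets M" using w(1)[of i] that D(1) open_dom by (intro sets_M) auto
    then have "(\<lambda>x. indicator (N i \<inter> \<Omega>) x :: ennreal) \<in> borel_measurable M" by simp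
    then show ?thesis by (rule measurable_cong[THEN iffD1, rotated]) (auto simp: indicator_def)
  qed
  have "E u \<le> (\<integral>\<^sup>+x. (\<Sum>i\<in>D. ennreal (b x) * G (w i x) * indicator (N i) x) \<partial>M)"
    unfolding E_def
  proof (rule nn_integral_mono)
    fix x assume "x \<in> space M"
    then have "x \<in> closure \<Omega>" using closure_subset by auto
    then obtain i where i: "i \<in> D" "x \<in> N i" using D(3) by auto
    have "w i x \<le> u x"
      unfolding u_def using i D w(4) by (intro member_le_sum) auto
    then have "ennreal (b x) * G (u x) \<le> ennreal (b x) * G (w i x) * indicator (N i) x"
      using i by (simp add: mult_left_mono G_antimono)
    also have "\<dots> \<le> (\<Sum>i\<in>D. ennreal (b x) * G (w i x) * indicator (N i) x)"
      using i D by (intro member_le_sum) auto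
    finally show "ennreal (b x) * G (u x) \<le> \<dots>" .
  qed
  also have "\<dots> = (\<Sum>i\<in>D. \<integral>\<^sup>+x. ennreal (b x) * G (w i x) * indicator (N i) x \<partial>M)"
  proof (rule nn_integral_sum)
    fix i assume i: "i \<in> D"
    then have [measurable]: "w i \<in> borel_measurable M" using W0_measurable(1)[OF w(3)] D(1) by blast
    show "(\<lambda>x. ennreal (b x) * G (w i x) * indicator (N i) x) \<in> borel_measurable M"
      using Nm[OF i] by measurable
  qed
  also have "\<dots> < \<infinity>"
    using w(5) D by (simp add: less_top[symmetric] subset_iff)
  finally show ?thesis using W by blast
qed

end

text \<open>The last two requirements amount to \<open>(p - 1) / p < \<theta>\<close> and
  \<open>\<theta> < (q - 1) / ((\<delta> - 1) * q)\<close>. Such \<open>\<theta>\<close> exist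
  exactly under the bound on \<open>\<delta>\<close>, and they can be taken below 1 because
  \<open>(p - 1) / p < 1\<close>.\<close>

lemma exponent_exists:
  fixes p q \<delta> :: real
  assumes "p > 1" "q > 1" "\<delta> > 1" "\<delta> < (q * (2 * p - 1) - p) / (q * (p - 1))"
  obtains \<theta> where "0 < \<theta>" "\<theta> < 1" "(1 - \<theta>) * p < 1" "\<theta> * (\<delta> - 1) * (q / (q - 1)) < 1"
proof -
  have "\<delta> * (q * (p - 1)) < q * (2 * p - 1) - p"
    using assms by (simp add: pos_less_divide_eq)
  then have "(\<delta> - 1) * q * (p - 1) < p * (q - 1)" by (simp add: algebra_simps)
  then have "(p - 1) / p < (q - 1) / ((\<delta> - 1) * q)"
    using assms by (simp add: divide_simps mult.commute mult.left_commute)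
  moreover have "(p - 1) / p < 1" using assms by simp
  ultimately obtain \<theta> where \<theta>: "(p - 1) / p < \<theta>" "\<theta> < min 1 ((q - 1) / ((\<delta> - 1) * q))"
    using dense[of "(p - 1) / p" "min 1 ((q - 1) / ((\<delta> - 1) * q))"] by auto
  have "0 < (p - 1) / p" using assms by simp
  then have 0: "0 < \<theta>" using \<theta> by linarith
  have "p - 1 < \<theta> * p" using \<theta>(1) assms by (simp add: pos_divide_less_eq)
  then have 1: "(1 - \<theta>) * p < 1" by (simp add: algebra_simps)
  have c: "(\<delta> - 1) * q > 0" using assms by simp
  have "\<theta> < (q - 1) / ((\<delta> - 1) * q)" using \<theta>(2) by simp
  then have "\<theta> * ((\<delta> - 1) * q) < q - 1" using pos_less_divide_eq[OF c] by blast
  then have "(\<theta> * ((\<delta> - 1) * q)) / (q - 1) < 1" using assms by simp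
  then have 2: "\<theta> * (\<delta> - 1) * (q / (q - 1)) < 1" by (simp add: mult.assoc)
  show thesis using that[of \<theta>] 0 1 2 \<theta>(2) by simp
qed

theorem corollary1p1:
  fixes \<Omega> :: "(real^'n) set" and a phis :: "real \<Rightarrow> real"
    and b :: "real^'n \<Rightarrow> real" and q \<delta> :: real
  assumes "smooth_bounded_domain \<Omega>"
    and "admissible a"
    and "(\<integral>\<^sup>+s\<in>{0<..1}. ennreal (sobolev_integrand CARD('n) a s) \<partial>lborel) < \<infinity>"
    and "(\<integral>\<^sup>+s\<in>{1..}. ennreal (sobolev_integrand CARD('n) a s) \<partial>lborel) = \<infinity>"
    and "sobolev_conjugate_density CARD('n) a phis"
    and "phi_plus a < phi_star_minus phis"
    and "q > 1" and "in_Lp q \<Omega> b" and "AE x in lebesgue_on \<Omega>. b x > 0"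
    and "1 < \<delta>"
    and "\<delta> < (q * (2 * phi_plus a - 1) - phi_plus a) / (q * (phi_plus a - 1))"
  shows "(\<exists>u. weak_solution a \<Omega> b \<delta> u) \<and>
         (\<forall>u v. weak_solution a \<Omega> b \<delta> u \<and> weak_solution a \<Omega> b \<delta> v \<longrightarrow>
                (AE x in lebesgue_on \<Omega>. u x = v x))"
proof -
  interpret N_function a by unfold_locales (rule assms(2))
  have dom: "open \<Omega>" "bounded \<Omega>" "smooth_boundary \<Omega>"
    using assms(1) by (auto simp: smooth_bounded_domain_def)
  interpret orlicz_domain a \<Omega> by unfold_locales (rule dom)+
  have b: "b \<in> borel_measurable M" "integrable M (\<lambda>x. \<bar>b x\<bar> powr q)"
    using assms(8) by (auto simp: in_Lp_def)
  interpret singular_problem a \<Omega> b \<delta>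
    by unfold_locales (rule b assms)+
  obtain \<theta> where "0 < \<theta>" "\<theta> < 1" "(1 - \<theta>) * p < 1" "\<theta> * (\<delta> - 1) * (q / (q - 1)) < 1"
    using exponent_exists[OF p_gt_1 assms(7,10,11)] by blast
  then obtain u g where "W0 u g" "E u < \<infinity>"
    using finite_energy[OF dom(3) assms(7) b(2)] by blast
  then show ?thesis
    using weak_solution_exists weak_solution_unique by blast
qed

end
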